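(* Let $\mathcal{L}$ be a semisimple finite-dimensional Lie algebra over an algebraically closed field $\mathbb{F}$ of characteristic $0$, let $G$ be an abelian group, and let $\Gamma:\mathcal{L}=\bigoplus_{g\in G}\mathcal{L}_g$ be a $G$-grading on $\mathcal{L}$ with $\mathrm{tor.rank}(\Gamma)\geq 1$. Let $T$ be a maximal torus in $\mathrm{Stab}(\Gamma)$, and let $\mathcal{H}\subset\mathcal{L}$ be the Lie algebra of $T$, regarded as a subalgebra of $\mathcal{L}$ via $\mathrm{ad}\colon\mathcal{L}\simeq\mathrm{Der}(\mathcal{L})$. Let \[ \Phi=\{\lambda\in\mathcal{H}^*\smallsetminus\{0\}\mid\mathcal{L}(\lambda)\neq 0\},\qquad \mathcal{L}(\lambda)=\{x\in\mathcal{L}\mid[h,x]=\lambda(h)x\ \forall h\in\mathcal{H}\}, \] be the set of nonzero weights of the adjoint action of $\mathcal{H}$ on $\mathcal{L}$, and let $\mathbb{Z}\Phi$ be the subgroup of $\mathcal{H}^*$ generated by $\Phi$. Then $\Phi$ is a (possibly nonreduced) root system in $\mathbb{R}\otimes_{\mathbb{Z}}\mathbb{Z}\Phi$. If $\mathcal{L}$ is simple, then $\Phi$ is an irreducible root system.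
   Context: A $G$-grading on $\mathcal{L}$ is a vector space decomposition $\mathcal{L}=\bigoplus_{g\in G}\mathcal{L}_g$ with $[\mathcal{L}_g,\mathcal{L}_h]\subset\mathcal{L}_{gh}$ for all $g,h\in G$. $\mathrm{Stab}(\Gamma)$ is the algebraic group of all automorphisms of $\mathcal{L}$ that map each component $\mathcal{L}_g$ to itself. The toral rank $\mathrm{tor.rank}(\Gamma)$ is the dimension of a maximal (algebraic) torus in $\mathrm{Stab}(\Gamma)$. The Lie algebra of $\mathrm{Aut}(\mathcal{L})$ is $\mathrm{Der}(\mathcal{L})$. The weight spaces of $\mathcal{H}$ are the weight spaces of $T$: a character of $T$ is identified with its differential in $\mathcal{H}^*$, which identifies the character group of $T$ with $\mathbb{Z}\Phi$, a free abelian group of rank $\dim T$. $\Phi$ is viewed in $\mathbb{R}\otimes_{\mathbb{Z}}\mathbb{Z}\Phi$ via $\lambda\mapsto 1\otimes\lambda$. A possibly nonreduced root system in a finite-dimensional real vector space $V$ is a finite spanning subset $\Phi\not\ni 0$ such that for each $\alpha\in\Phi$ there is $\alpha^\vee\in V^*$ with $\alpha^\vee(\alpha)=2$, such that the reflection $v\mapsto v-\alpha^\vee(v)\alpha$ maps $\Phi$ to itself and $\alpha^\vee(\Phi)\subset\mathbb{Z}$ (it is not required that $2\alpha\notin\Phi$). *)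

theory Defs
  imports
    "HOL-Algebra.Elementary_Groups"
    "HOL-Algebra.Free_Abelian_Groups"
    "HOL-Algebra.Module"
    "HOL-Algebra.Algebraic_Closure_Type"
begin

section \<open>Affine algebraic groups of linear transformations\<close>

text \<open>
  A variety over an algebraically closed field is treated as its set of points together with its
  algebra of regular functions.
\<close>

inductive_set function_algebra :: "('x \<Rightarrow> 'k::comm_ring_1) set \<Rightarrow> ('x \<Rightarrow> 'k) set"
  for S :: "('x \<Rightarrow> 'k) set"
where
  const: "(\<lambda>_. c) \<in> function_algebra S"
| gen: "r \<in> S \<Longrightarrow> r \<in> function_algebra S"
| add: "r \<in> function_algebra S \<Longrightarrow> s \<in> function_algebra S \<Longrightarrow> (\<lambda>p. r p + s p) \<in> function_algebra S"
| mult: "r \<in> function_algebra S \<Longrightarrow> s \<in> function_algebra S \<Longrightarrow> (\<lambda>p. r p * s p) \<in> function_algebra S"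

text \<open>The split torus of dimension \<open>n\<close>; coordinates from \<open>n\<close> on are padded with \<open>1\<close>.\<close>

definition mult_torus :: "nat \<Rightarrow> (nat \<Rightarrow> 'k::field) monoid" where
  "mult_torus n =
     \<lparr>carrier = {t. (\<forall>i<n. t i \<noteq> 0) \<and> (\<forall>i\<ge>n. t i = 1)},
      monoid.mult = (\<lambda>s t i. s i * t i), one = (\<lambda>_. 1)\<rparr>"

definition mult_torus_regular :: "nat \<Rightarrow> ((nat \<Rightarrow> 'k::field) \<Rightarrow> 'k) set" where
  "mult_torus_regular n =
     function_algebra ({\<lambda>t. t i | i. i < n} \<union> {\<lambda>t. inverse (t i) | i. i < n})"

context
  fixes scale :: "'a::field \<Rightarrow> 'b::ab_group_add \<Rightarrow> 'b"
begin

definition GL :: "('b \<Rightarrow> 'b) monoid" where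
  "GL = \<lparr>carrier = {f. Vector_Spaces.linear scale scale f \<and> bij f}, monoid.mult = (\<circ>), one = id\<rparr>"

text \<open>
  The coordinate ring of the general linear group is generated by the matrix coefficients
  of \<open>f\<close> and of its inverse (the latter account for the inverse of the determinant).
  These are functions on all maps; only their values on invertible linear maps matter.
\<close>

definition GL_regular :: "(('b \<Rightarrow> 'b) \<Rightarrow> 'a) set" where
  "GL_regular = function_algebra
     ({\<lambda>f. \<xi> (f x) | \<xi> x. Vector_Spaces.linear scale (*) \<xi>} \<union>
      {\<lambda>f. \<xi> (inv_into UNIV f x) | \<xi> x. Vector_Spaces.linear scale (*) \<xi>})"

definition zariski_closed :: "('b \<Rightarrow> 'b) set \<Rightarrow> bool" where
  "zariski_closed Z \<longleftrightarrow> (\<exists>S \<subseteq> GL_regular. Z = {f \<in> carrier GL. \<forall>r\<in>S. r f = 0})"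

definition algebraic_subgroup :: "('b \<Rightarrow> 'b) set \<Rightarrow> bool" where
  "algebraic_subgroup T \<longleftrightarrow> subgroup T GL \<and> zariski_closed T"

text \<open>
  An algebraic torus of dimension \<open>n\<close>: an algebraic subgroup isomorphic, as an algebraic group,
  to the \<open>n\<close>-th power of the multiplicative group.  The last two clauses say that \<open>\<phi>\<close> and
  its inverse are morphisms of varieties.
\<close>

definition torus_of_dim :: "nat \<Rightarrow> ('b \<Rightarrow> 'b) set \<Rightarrow> bool" where
  "torus_of_dim n T \<longleftrightarrow> algebraic_subgroup T \<and>
     (\<exists>\<phi> \<in> iso (mult_torus n) (GL\<lparr>carrier := T\<rparr>).
        (\<forall>r \<in> GL_regular. \<exists>s \<in> mult_torus_regular n. \<forall>t \<in> carrier (mult_torus n). r (\<phi> t) = s t) \<and>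
        (\<forall>s \<in> mult_torus_regular n. \<exists>r \<in> GL_regular. \<forall>t \<in> carrier (mult_torus n). s t = r (\<phi> t)))"

definition maximal_torus :: "('b \<Rightarrow> 'b) set \<Rightarrow> ('b \<Rightarrow> 'b) set \<Rightarrow> bool" where
  "maximal_torus S T \<longleftrightarrow> (\<exists>n. torus_of_dim n T) \<and> T \<subseteq> S \<and>
     (\<forall>T' n. torus_of_dim n T' \<and> T \<subseteq> T' \<and> T' \<subseteq> S \<longrightarrow> T' = T)"

definition point_derivation_id :: "((('b \<Rightarrow> 'b) \<Rightarrow> 'a) \<Rightarrow> 'a) \<Rightarrow> bool" where
  "point_derivation_id \<delta> \<longleftrightarrow>
     (\<forall>r\<in>GL_regular. \<forall>s\<in>GL_regular.
        \<delta> (\<lambda>f. r f + s f) = \<delta> r + \<delta> s \<and>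
        \<delta> (\<lambda>f. r f * s f) = r id * \<delta> s + \<delta> r * s id) \<and>
     (\<forall>c. \<forall>r\<in>GL_regular. \<delta> (\<lambda>f. c * r f) = c * \<delta> r)"

text \<open>
  The Lie algebra of \<open>T\<close> inside the linear endomorphisms: the tangent space at the identity, i.e.
  those \<open>D\<close> whose associated point derivation kills all regular functions vanishing on \<open>T\<close>.
  As \<open>\<delta>\<close> kills these, it does not depend on values outside the general linear group.
\<close>

definition lie_of_group :: "('b \<Rightarrow> 'b) set \<Rightarrow> ('b \<Rightarrow> 'b) set" where
  "lie_of_group T = {D. Vector_Spaces.linear scale scale D \<and>
     (\<exists>\<delta>. point_derivation_id \<delta> \<and>
        (\<forall>\<xi> x. Vector_Spaces.linear scale (*) \<xi> \<longrightarrow> \<delta> (\<lambda>f. \<xi> (f x)) = \<xi> (D x)) \<and>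
        (\<forall>r\<in>GL_regular. (\<forall>f\<in>T. r f = 0) \<longrightarrow> \<delta> r = 0))}"

text \<open>
  The dual of a subspace \<open>H\<close>, as an additive group written with the monoid record.
  A functional on \<open>H\<close> is represented by the function extending it by \<open>0\<close> outside \<open>H\<close>.
\<close>

definition dual_group :: "'b set \<Rightarrow> ('b \<Rightarrow> 'a) monoid" where
  "dual_group H =
     \<lparr>carrier = {\<mu>. (\<forall>x\<in>H. \<forall>y\<in>H. \<mu> (x + y) = \<mu> x + \<mu> y) \<and>
                    (\<forall>c. \<forall>x\<in>H. \<mu> (scale c x) = c * \<mu> x) \<and> (\<forall>x. x \<notin> H \<longrightarrow> \<mu> x = 0)},
      monoid.mult = (\<lambda>\<mu> \<nu> x. \<mu> x + \<nu> x), one = (\<lambda>_. 0)\<rparr>"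

end


section \<open>Lie algebras, gradings and weights\<close>

locale lie_algebra = vector_space scale
  for scale :: "'k::field \<Rightarrow> 'l::ab_group_add \<Rightarrow> 'l" +
  fixes bracket :: "'l \<Rightarrow> 'l \<Rightarrow> 'l"
  assumes bracket_add_left: "bracket (x + y) z = bracket x z + bracket y z"
    and bracket_add_right: "bracket x (y + z) = bracket x y + bracket x z"
    and bracket_scale_left: "bracket (scale c x) y = scale c (bracket x y)"
    and bracket_scale_right: "bracket x (scale c y) = scale c (bracket x y)"
    and bracket_self: "bracket x x = 0"
    and jacobi: "bracket x (bracket y z) + bracket y (bracket z x) + bracket z (bracket x y) = 0"
begin

definition lie_ideal :: "'l set \<Rightarrow> bool" where
  "lie_ideal I \<longleftrightarrow> subspace I \<and> (\<forall>x. \<forall>y\<in>I. bracket x y \<in> I)"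

primrec derived_series :: "'l set \<Rightarrow> nat \<Rightarrow> 'l set" where
  "derived_series I 0 = I"
| "derived_series I (Suc n) =
     span {bracket x y | x y. x \<in> derived_series I n \<and> y \<in> derived_series I n}"

definition solvable :: "'l set \<Rightarrow> bool" where
  "solvable I \<longleftrightarrow> (\<exists>n. derived_series I n = {0})"

definition semisimple :: bool where
  "semisimple \<longleftrightarrow> (\<forall>I. lie_ideal I \<and> solvable I \<longrightarrow> I = {0})"

definition simple :: bool where
  "simple \<longleftrightarrow> (\<exists>x y. bracket x y \<noteq> 0) \<and> (\<forall>I. lie_ideal I \<longrightarrow> I = {0} \<or> I = UNIV)"

definition grading :: "('g, 'm) monoid_scheme \<Rightarrow> ('g \<Rightarrow> 'l set) \<Rightarrow> bool" where
  "grading G \<Gamma> \<longleftrightarrow>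
     (\<forall>g\<in>carrier G. subspace (\<Gamma> g)) \<and>
     (\<forall>x. \<exists>!c. (\<forall>g\<in>carrier G. c g \<in> \<Gamma> g) \<and> (\<forall>g. g \<notin> carrier G \<longrightarrow> c g = 0) \<and>
               finite {g. c g \<noteq> 0} \<and> x = (\<Sum>g | c g \<noteq> 0. c g)) \<and>
     (\<forall>g\<in>carrier G. \<forall>h\<in>carrier G. \<forall>x\<in>\<Gamma> g. \<forall>y\<in>\<Gamma> h. bracket x y \<in> \<Gamma> (g \<otimes>\<^bsub>G\<^esub> h))"

definition Aut :: "('l \<Rightarrow> 'l) set" where
  "Aut = {f \<in> carrier (GL scale). \<forall>x y. f (bracket x y) = bracket (f x) (f y)}"

definition Stab :: "('g, 'm) monoid_scheme \<Rightarrow> ('g \<Rightarrow> 'l set) \<Rightarrow> ('l \<Rightarrow> 'l) set" where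
  "Stab G \<Gamma> = {f \<in> Aut. \<forall>g\<in>carrier G. f ` \<Gamma> g = \<Gamma> g}"

text \<open>Well defined because all maximal tori of an algebraic group are conjugate.\<close>

definition toral_rank :: "('g, 'm) monoid_scheme \<Rightarrow> ('g \<Rightarrow> 'l set) \<Rightarrow> nat" where
  "toral_rank G \<Gamma> = (THE n. \<exists>T. maximal_torus scale (Stab G \<Gamma>) T \<and> torus_of_dim scale n T)"

text \<open>
  The Lie algebra of \<open>T \<subseteq> Aut\<close>, pulled back along \<open>ad\<close>, which for semisimple finite-dimensional
  algebras in characteristic \<open>0\<close> is an isomorphism onto the derivations.
\<close>

definition lie_subalgebra_of :: "('l \<Rightarrow> 'l) set \<Rightarrow> 'l set" where
  "lie_subalgebra_of T = {h. bracket h \<in> lie_of_group scale T}"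

definition weight_space :: "'l set \<Rightarrow> ('l \<Rightarrow> 'k) \<Rightarrow> 'l set" where
  "weight_space H \<mu> = {x. \<forall>h\<in>H. bracket h x = scale (\<mu> h) x}"

definition nonzero_weights :: "'l set \<Rightarrow> ('l \<Rightarrow> 'k) set" where
  "nonzero_weights H =
     {\<mu> \<in> carrier (dual_group scale H) - {\<one>\<^bsub>dual_group scale H\<^esub>}. weight_space H \<mu> \<noteq> {0}}"

end


section \<open>The tensor product of the reals with an abelian group\<close>

text \<open>
  The usual construction: the free abelian group on pairs \<open>(r, a)\<close> modulo the subgroup generated by
  the bilinearity relations.
\<close>

definition tensor_free :: "('a, 'm) monoid_scheme \<Rightarrow> ((real \<times> 'a) \<Rightarrow>\<^sub>0 int) monoid" where
  "tensor_free A = free_Abelian_group (UNIV \<times> carrier A)"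

definition tensor_relations :: "('a, 'm) monoid_scheme \<Rightarrow> ((real \<times> 'a) \<Rightarrow>\<^sub>0 int) set" where
  "tensor_relations A = generate (tensor_free A)
     ({frag_of (r + s, a) - frag_of (r, a) - frag_of (s, a) | r s a. a \<in> carrier A} \<union>
      {frag_of (r, a \<otimes>\<^bsub>A\<^esub> b) - frag_of (r, a) - frag_of (r, b) | r a b.
         a \<in> carrier A \<and> b \<in> carrier A})"

definition tensor_coset ::
  "('a, 'm) monoid_scheme \<Rightarrow> ((real \<times> 'a) \<Rightarrow>\<^sub>0 int) \<Rightarrow> ((real \<times> 'a) \<Rightarrow>\<^sub>0 int) set" where
  "tensor_coset A p = tensor_relations A #>\<^bsub>tensor_free A\<^esub> p"

text \<open>
  Scalars act on the real factor.  The ring multiplication and unit demanded by the record type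
  of modules are irrelevant.
\<close>

definition real_tensor ::
  "('a, 'm) monoid_scheme \<Rightarrow> (real, ((real \<times> 'a) \<Rightarrow>\<^sub>0 int) set) module" where
  "real_tensor A =
     \<lparr>carrier = carrier (tensor_free A Mod tensor_relations A),
      monoid.mult = undefined, one = undefined,
      ring.zero = \<one>\<^bsub>tensor_free A Mod tensor_relations A\<^esub>,
      add = (\<otimes>\<^bsub>tensor_free A Mod tensor_relations A\<^esub>),
      module.smult = (\<lambda>c C. \<Union>p\<in>C. tensor_coset A (frag_extend (\<lambda>(r, a). frag_of (c * r, a)) p))\<rparr>"

definition one_tensor :: "('a, 'm) monoid_scheme \<Rightarrow> 'a \<Rightarrow> ((real \<times> 'a) \<Rightarrow>\<^sub>0 int) set" where
  "one_tensor A a = tensor_coset A (frag_of (1, a))"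


section \<open>Root systems\<close>

text \<open>Real vector spaces with explicit carrier: modules over the field of reals.\<close>

abbreviation real_field :: "real ring" where
  "real_field \<equiv> ring_of_type_algebra"

definition real_functional :: "(real, 'v) module \<Rightarrow> ('v \<Rightarrow> real) \<Rightarrow> bool" where
  "real_functional V f \<longleftrightarrow>
     (\<forall>x\<in>carrier V. \<forall>y\<in>carrier V. f (x \<oplus>\<^bsub>V\<^esub> y) = f x + f y) \<and>
     (\<forall>c. \<forall>x\<in>carrier V. f (c \<odot>\<^bsub>V\<^esub> x) = c * f x)"

definition is_coroot :: "(real, 'v) module \<Rightarrow> 'v set \<Rightarrow> 'v \<Rightarrow> ('v \<Rightarrow> real) \<Rightarrow> bool" where
  "is_coroot V \<Phi> \<alpha> f \<longleftrightarrow> real_functional V f \<and> f \<alpha> = 2 \<and>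
     (\<lambda>v. v \<ominus>\<^bsub>V\<^esub> f v \<odot>\<^bsub>V\<^esub> \<alpha>) ` \<Phi> = \<Phi> \<and> f ` \<Phi> \<subseteq> \<int>"

text \<open>Possibly nonreduced.  The space is finite-dimensional since a finite set spans it.\<close>

definition root_system :: "(real, 'v) module \<Rightarrow> 'v set \<Rightarrow> bool" where
  "root_system V \<Phi> \<longleftrightarrow> Module.module real_field V \<and>
     finite \<Phi> \<and> \<Phi> \<subseteq> carrier V \<and> (\<forall>W. submodule W real_field V \<and> \<Phi> \<subseteq> W \<longrightarrow> W = carrier V) \<and>
     \<zero>\<^bsub>V\<^esub> \<notin> \<Phi> \<and> (\<forall>\<alpha>\<in>\<Phi>. \<exists>f. is_coroot V \<Phi> \<alpha> f)"

text \<open>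
  In a root system the coroot of each root is unique; orthogonality of roots
  (for any invariant inner product) is the vanishing of the pairing with coroots.
\<close>

definition orthogonal_roots :: "(real, 'v) module \<Rightarrow> 'v set \<Rightarrow> 'v \<Rightarrow> 'v \<Rightarrow> bool" where
  "orthogonal_roots V \<Phi> \<alpha> \<beta> \<longleftrightarrow>
     (\<forall>f. is_coroot V \<Phi> \<alpha> f \<longrightarrow> f \<beta> = 0) \<and> (\<forall>f. is_coroot V \<Phi> \<beta> f \<longrightarrow> f \<alpha> = 0)"

definition irreducible_root_system :: "(real, 'v) module \<Rightarrow> 'v set \<Rightarrow> bool" where
  "irreducible_root_system V \<Phi> \<longleftrightarrow> root_system V \<Phi> \<and> \<Phi> \<noteq> {} \<and>
     \<not> (\<exists>\<Phi>1 \<Phi>2. \<Phi>1 \<noteq> {} \<and> \<Phi>2 \<noteq> {} \<and> \<Phi>1 \<inter> \<Phi>2 = {} \<and> \<Phi> = \<Phi>1 \<union> \<Phi>2 \<and>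
          (\<forall>\<alpha>\<in>\<Phi>1. \<forall>\<beta>\<in>\<Phi>2. orthogonal_roots V \<Phi> \<alpha> \<beta>))"

end

theory Submission
  imports Defs "HOL-Library.Function_Algebras" "HOL-Library.Product_Plus"
begin

text \<open>
  Let \<open>C\<close> be the set of \<open>T\<close>-fixed elements of the identity component of the grading.  The key fact is
  \<open>C = H\<close>.  The semisimple part of an element of \<open>C\<close> lies in \<open>H\<close>: together with \<open>T\<close> it generates
  a torus in the stabilizer (act on the joint weight spaces through a basis of the lattice of
  weights), which is \<open>T\<close> by maximality.  The ad-nilpotent elements of \<open>C\<close> then form a totally
  isotropic subspace orthogonal to \<open>H\<close>, so they lie in the radical of the Killing form on \<open>C\<close>,
  which vanishes.  Hence for a weight \<open>\<alpha>\<close> and homogeneous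
  \<open>x\<close>, \<open>y\<close> of opposite degrees and weights \<open>\<alpha>\<close>, \<open>- \<alpha>\<close> that are paired nontrivially by the Killing
  form, \<open>[x, y]\<close> lies in \<open>H\<close>, so that \<open>x\<close> and \<open>y\<close> span an \<open>sl\<^sub>2\<close> whose representation theory yields
  the reflection in \<open>\<alpha>\<close>.
\<close>

section \<open>Linear algebra\<close>

text \<open>The field is an arbitrary algebraically closed one of characteristic 0: semisimple
  derivations cannot be exponentiated, and their eigenvalues carry no integrality. What survives is
  that the pairs (character of \<open>T\<close>, eigenvalue) occurring on the algebra generate a
  finitely generated torsion-free group; a basis of it is the character lattice of a torus that
  contains \<open>T\<close> and has the derivation in its Lie algebra. Only this makes maximality of
  \<open>T\<close> say something about semisimple elements of \<open>C\<close>. A root space may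
  have dimension above one and meet several degrees, and 2\<alpha> may be a root too. So strings
  start from single vectors, and the degrees of \<open>x\<close> and \<open>y\<close> must be
  opposite to put \<open>[x, y]\<close> into the identity component. That \<alpha> does not vanish
  on \<open>[x, y]\<close> comes from the same string computation, applied to the case where
  \<open>[x, y]\<close> commutes with \<open>x\<close> and \<open>y\<close>. The roots are defined
  by \<open>H\<close>, but the argument runs on characters of \<open>T\<close>; \<open>wt\<close>
  passes from a character to its differential. Toral rank at least 1 becomes
  \<open>T \<noteq> {id}\<close>, which makes the set of roots nonempty for irreducibility.\<close>

text \<open>
  A locale of its own, because everything added to \<^locale>\<open>vector_space\<close> would also be
  instantiated, under the same short name, for the real vector spaces.
\<close>

locale endomorphisms = vector_space scale
  for scale :: "'a::field \<Rightarrow> 'b::ab_group_add \<Rightarrow> 'b"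
begin

section \<open>Linear endomorphisms and joint eigenvectors\<close>

abbreviation lin :: "('b \<Rightarrow> 'b) \<Rightarrow> bool" where
  "lin \<equiv> Vector_Spaces.linear scale scale"

lemma lin_iff:
  "lin f \<longleftrightarrow> (\<forall>x y. f (x + y) = f x + f y) \<and> (\<forall>c x. f (scale c x) = scale c (f x))"
  using vector_space_axioms by (simp add: Vector_Spaces.linear_iff)

lemma lin_add: "lin f \<Longrightarrow> f (x + y) = f x + f y"
  and lin_scale: "lin f \<Longrightarrow> f (scale c x) = scale c (f x)"
  by (simp_all add: lin_iff)

lemma lin_0: "lin f \<Longrightarrow> f 0 = 0"
  using lin_scale[of f 0 0] by simp

lemma lin_neg: "lin f \<Longrightarrow> f (- x) = - f x"
  using lin_add[of f x "- x"] by (simp add: lin_0 eq_neg_iff_add_eq_0 add.commute)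

lemma lin_diff: "lin f \<Longrightarrow> f (x - y) = f x - f y"
  using lin_add[of f x "- y"] by (simp add: lin_neg)

lemma lin_sum: "lin f \<Longrightarrow> f (sum g S) = (\<Sum>a\<in>S. f (g a))"
  by (induction S rule: infinite_finite_induct) (auto simp: lin_0 lin_add)

lemma lin_ident: "lin (\<lambda>x. x)"
  and lin_const_0: "lin (\<lambda>x. 0)"
  and lin_comp: "lin f \<Longrightarrow> lin g \<Longrightarrow> lin (\<lambda>x. f (g x))"
  and lin_compose: "lin f \<Longrightarrow> lin g \<Longrightarrow> lin (f \<circ> g)"
  and lin_plus: "lin f \<Longrightarrow> lin g \<Longrightarrow> lin (\<lambda>x. f x + g x)"
  and lin_minus: "lin f \<Longrightarrow> lin g \<Longrightarrow> lin (\<lambda>x. f x - g x)"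
  and lin_smult: "lin f \<Longrightarrow> lin (\<lambda>x. scale c (f x))"
  by (auto simp: lin_iff algebra_simps)

lemma lin_funpow: "lin f \<Longrightarrow> lin (f ^^ n)"
  by (induction n) (auto simp: lin_iff)

lemma lin_sum_fun: "(\<And>i. i \<in> S \<Longrightarrow> lin (f i)) \<Longrightarrow> lin (\<lambda>x. \<Sum>i\<in>S. f i x)"
  by (induction S rule: infinite_finite_induct) (auto intro: lin_const_0 lin_plus)

lemma lin_eq_on_Basis:
  assumes "lin f" "lin g" "span B = UNIV" "\<And>b. b \<in> B \<Longrightarrow> f b = g b"
  shows "f x = g x"
proof -
  have "x \<in> span B" using assms by simp
  then show ?thesis
    by (induction rule: span_induct_alt)
       (use assms in \<open>auto simp: lin_0 lin_add lin_scale\<close>)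
qed

text \<open>Subtracting a scalar from one operator removes one summand and rescales the others,
  which gives the induction. The family of operators may be infinite and may act on a function
  space; both occur in Dedekind's lemma below.\<close>

lemma eigenvector_sum_zero:
  assumes "finite K"
    and "\<And>i. i \<in> I \<Longrightarrow> lin (A i)"
    and "\<And>\<chi> i. \<chi> \<in> K \<Longrightarrow> i \<in> I \<Longrightarrow> A i (v \<chi>) = scale (ev \<chi> i) (v \<chi>)"
    and "\<And>\<chi> \<psi>. \<chi> \<in> K \<Longrightarrow> \<psi> \<in> K \<Longrightarrow> \<chi> \<noteq> \<psi> \<Longrightarrow> \<exists>i\<in>I. ev \<chi> i \<noteq> ev \<psi> i"
    and "(\<Sum>\<chi>\<in>K. v \<chi>) = 0"
  shows "\<forall>\<chi>\<in>K. v \<chi> = 0"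
  using assms(1,3,4,5)
proof (induction K arbitrary: v rule: finite_induct)
  case (insert \<psi> F)
  have zF: "v \<chi> = 0" if \<chi>: "\<chi> \<in> F" for \<chi>
  proof -
    have "\<chi> \<noteq> \<psi>" using \<chi> insert.hyps by auto
    then obtain i where i: "i \<in> I" "ev \<chi> i \<noteq> ev \<psi> i" using insert.prems(2) \<chi> by blast
    \<comment> \<open>This is (\<open>A i\<close> - \<open>ev \<psi> i\<close>) applied to
      \<open>v \<chi>'\<close>: it vanishes at \<psi> and has a nonzero factor at \<chi>.\<close>
    define w where "w \<chi>' = scale (ev \<chi>' i - ev \<psi> i) (v \<chi>')" for \<chi>'
    have 0: "(\<Sum>\<chi>'\<in>insert \<psi> F. A i (v \<chi>')) = 0"
      using insert.prems(3) assms(2)[OF i(1)] by (metis lin_0 lin_sum)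
    have "(\<Sum>\<chi>'\<in>insert \<psi> F. w \<chi>') =
        (\<Sum>\<chi>'\<in>insert \<psi> F. A i (v \<chi>')) - scale (ev \<psi> i) (\<Sum>\<chi>'\<in>insert \<psi> F. v \<chi>')"
      unfolding scale_sum_right sum_subtractf[symmetric]
      by (rule sum.cong[OF refl]) (simp add: w_def insert.prems(1)[OF _ i(1)] scale_left_diff_distrib)
    then have "sum w (insert \<psi> F) = 0" using 0 insert.prems(3) by simp
    then have "sum w F = 0" using insert.hyps by (simp add: w_def)
    moreover have "A j (w \<chi>') = scale (ev \<chi>' j) (w \<chi>')" if "\<chi>' \<in> F" "j \<in> I" for \<chi>' j
      using that insert.prems(1)[of \<chi>' j] assms(2)[of j]
      by (simp add: w_def lin_scale mult.commute)
    ultimately have "\<forall>\<chi>'\<in>F. w \<chi>' = 0"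
      using insert.prems(2) by (intro insert.IH) auto
    then have "w \<chi> = 0" using \<chi> by blast
    then show ?thesis using i by (simp add: w_def)
  qed
  then have "sum v F = 0" by simp
  then show ?case using zF insert by simp
qed simp

subsection \<open>Direct sum decompositions\<close>

definition direct_sum_of :: "'i set \<Rightarrow> ('i \<Rightarrow> 'b set) \<Rightarrow> bool" where
  "direct_sum_of K V \<longleftrightarrow> finite K \<and> (\<forall>i\<in>K. subspace (V i)) \<and>
     (\<forall>x. \<exists>c. (\<forall>i\<in>K. c i \<in> V i) \<and> x = sum c K) \<and>
     (\<forall>c. (\<forall>i\<in>K. c i \<in> V i) \<and> sum c K = 0 \<longrightarrow> (\<forall>i\<in>K. c i = 0))"

text \<open>A whole family is chosen for \<open>x\<close> before evaluating at \<open>i\<close>, so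
  all components of \<open>x\<close> belong to one decomposition. Outside \<open>K\<close> the value
  is arbitrary.\<close>

definition component :: "'i set \<Rightarrow> ('i \<Rightarrow> 'b set) \<Rightarrow> 'i \<Rightarrow> 'b \<Rightarrow> 'b" where
  "component K V i x = (SOME c. (\<forall>i\<in>K. c i \<in> V i) \<and> x = sum c K) i"

definition diagonal_map :: "'i set \<Rightarrow> ('i \<Rightarrow> 'b set) \<Rightarrow> ('i \<Rightarrow> 'a) \<Rightarrow> 'b \<Rightarrow> 'b" where
  "diagonal_map K V f x = (\<Sum>i\<in>K. scale (f i) (component K V i x))"

lemma direct_sum_ofI:
  assumes "finite K" "\<And>i. i \<in> K \<Longrightarrow> subspace (V i)"
    and "\<And>x. \<exists>c. (\<forall>i\<in>K. c i \<in> V i) \<and> x = sum c K"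
    and "\<And>c. (\<And>i. i \<in> K \<Longrightarrow> c i \<in> V i) \<Longrightarrow> sum c K = 0 \<Longrightarrow> \<forall>i\<in>K. c i = 0"
  shows "direct_sum_of K V"
  using assms unfolding direct_sum_of_def by blast

lemma direct_sum_ofD:
  assumes "direct_sum_of K V"
  shows "finite K" "i \<in> K \<Longrightarrow> subspace (V i)"
  using assms unfolding direct_sum_of_def by blast+

lemma component:
  assumes "direct_sum_of K V"
  shows component_in: "i \<in> K \<Longrightarrow> component K V i x \<in> V i"
    and sum_component: "(\<Sum>i\<in>K. component K V i x) = x"
proof -
  have "\<exists>c. (\<forall>i\<in>K. c i \<in> V i) \<and> x = sum c K"
    using assms unfolding direct_sum_of_def by blast
  from someI_ex[OF this] show "i \<in> K \<Longrightarrow> component K V i x \<in> V i"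
    "(\<Sum>i\<in>K. component K V i x) = x"
    unfolding component_def by auto
qed

lemma component_eqI:
  assumes ds: "direct_sum_of K V" and c: "\<And>i. i \<in> K \<Longrightarrow> c i \<in> V i" and x: "x = sum c K" and "i \<in> K"
  shows "component K V i x = c i"
proof -
  have "(\<Sum>i\<in>K. component K V i x - c i) = 0"
    by (simp add: sum_subtractf sum_component[OF ds] x)
  moreover have "\<And>i. i \<in> K \<Longrightarrow> component K V i x - c i \<in> V i"
    using c component_in[OF ds] direct_sum_ofD(2)[OF ds] by (simp add: subspace_diff)
  ultimately have "\<forall>i\<in>K. component K V i x - c i = 0"
    using ds unfolding direct_sum_of_def by (elim conjE) (drule spec[of _ "\<lambda>i. component K V i x - c i"], blast)
  then show ?thesis using assms(4) by simp
qed

lemma component_same: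
  assumes "direct_sum_of K V" "j \<in> K" "x \<in> V j" "i \<in> K"
  shows "component K V i x = (if i = j then x else 0)"
  by (rule component_eqI[OF assms(1), of "\<lambda>i. if i = j then x else 0"])
     (use assms in \<open>auto simp: direct_sum_ofD subspace_0\<close>)

lemma lin_component:
  assumes ds: "direct_sum_of K V" and "i \<in> K"
  shows "lin (component K V i)"
  unfolding lin_iff
proof (intro conjI allI)
  note cs = component_in[OF ds] and sub = direct_sum_ofD(2)[OF ds]
  fix x y c
  show "component K V i (x + y) = component K V i x + component K V i y"
    by (rule component_eqI[OF ds, of "\<lambda>i. component K V i x + component K V i y"])
       (use assms in \<open>simp_all add: sum.distrib sum_component[OF ds] subspace_add[OF sub] cs\<close>)
  show "component K V i (scale c x) = scale c (component K V i x)"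
    by (rule component_eqI[OF ds, of "\<lambda>i. scale c (component K V i x)"])
       (use assms in \<open>simp_all add: scale_sum_right[symmetric] sum_component[OF ds] subspace_scale[OF sub] cs\<close>)
qed

lemma component_commute:
  assumes ds: "direct_sum_of K V" and A: "lin A" "\<And>i x. i \<in> K \<Longrightarrow> x \<in> V i \<Longrightarrow> A x \<in> V i" and "i \<in> K"
  shows "component K V i (A x) = A (component K V i x)"
  by (rule component_eqI[OF ds])
     (use assms in \<open>simp_all add: lin_sum[OF A(1), symmetric] sum_component[OF ds] component_in[OF ds]\<close>)

lemma direct_sum_eqI:
  assumes ds: "direct_sum_of K V" and "lin A" "lin B" "\<And>i x. i \<in> K \<Longrightarrow> x \<in> V i \<Longrightarrow> A x = B x"
  shows "A x = B x"
proof -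
  have "A (\<Sum>i\<in>K. component K V i x) = B (\<Sum>i\<in>K. component K V i x)"
    unfolding lin_sum[OF assms(2)] lin_sum[OF assms(3)]
    by (rule sum.cong) (auto simp: assms(4) component_in[OF ds])
  then show ?thesis by (simp add: sum_component[OF ds])
qed

lemma lin_diagonal_map: "direct_sum_of K V \<Longrightarrow> lin (diagonal_map K V f)"
  unfolding diagonal_map_def[abs_def]
  by (intro lin_sum_fun lin_smult lin_component)

lemma diagonal_map_eq:
  assumes "direct_sum_of K V" "j \<in> K" "x \<in> V j"
  shows "diagonal_map K V f x = scale (f j) x"
proof -
  have "diagonal_map K V f x = (\<Sum>i\<in>K. if i = j then scale (f j) x else 0)"
    unfolding diagonal_map_def by (rule sum.cong) (auto simp: component_same[OF assms])
  then show ?thesis using assms by (simp add: direct_sum_ofD)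
qed

lemma diagonal_map_commute:
  assumes ds: "direct_sum_of K V" and A: "lin A" "\<And>i x. i \<in> K \<Longrightarrow> x \<in> V i \<Longrightarrow> A x \<in> V i"
  shows "diagonal_map K V f (A x) = A (diagonal_map K V f x)"
  by (rule direct_sum_eqI[OF ds lin_comp[OF lin_diagonal_map[OF ds] A(1)] lin_comp[OF A(1) lin_diagonal_map[OF ds]]])
     (simp add: diagonal_map_eq[OF ds] A lin_scale[OF A(1)])

lemma span_Union_sum:
  assumes "x \<in> span (\<Union>i\<in>K. V i)" "finite K" "\<And>i. i \<in> K \<Longrightarrow> subspace (V i)"
  shows "\<exists>c. (\<forall>i\<in>K. c i \<in> V i) \<and> x = sum c K"
  using assms(1)
proof (induction rule: span_induct_alt)
  case base
  show ?case by (rule exI[of _ "\<lambda>i. 0"]) (auto simp: assms(3) subspace_0)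
next
  case (step c x y)
  then obtain d j where d: "\<forall>i\<in>K. d i \<in> V i" "y = sum d K" and j: "j \<in> K" "x \<in> V j" by auto
  let ?e = "\<lambda>i. (if i = j then scale c x else 0) + d i"
  show ?case
    by (rule exI[of _ ?e])
       (use d j assms in \<open>auto simp: sum.distrib subspace_add subspace_scale\<close>)
qed

lemma subspace_eigenspace:
  assumes "\<And>i. i \<in> I \<Longrightarrow> lin (A i)"
  shows "subspace {x. \<forall>i\<in>I. A i x = scale (ev i) x}"
  using assms by (intro subspaceI) (auto simp: lin_0 lin_add lin_scale algebra_simps)


subsection \<open>Generalized eigenspaces\<close>

definition shift :: "('b \<Rightarrow> 'b) \<Rightarrow> 'a \<Rightarrow> 'b \<Rightarrow> 'b" where
  "shift A a x = A x - scale a x"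

definition gen_eigenspace :: "('b \<Rightarrow> 'b) \<Rightarrow> 'a \<Rightarrow> 'b set" where
  "gen_eigenspace A a = {v. \<exists>n. (shift A a ^^ n) v = 0}"

lemma lin_shift: "lin A \<Longrightarrow> lin (shift A a)"
  unfolding shift_def[abs_def] by (intro lin_minus lin_smult lin_ident)

lemma funpow_zero_mono: "lin A \<Longrightarrow> (A ^^ n) x = 0 \<Longrightarrow> n \<le> m \<Longrightarrow> (A ^^ m) x = 0"
  by (metis comp_apply funpow_add le_Suc_ex add.commute lin_0 lin_funpow)

lemma subspace_gen_eigenspace:
  assumes "lin A"
  shows "subspace (gen_eigenspace A a)"
proof (rule subspaceI)
  have L: "lin (shift A a ^^ n)" for n using assms lin_shift lin_funpow by blast
  show "0 \<in> gen_eigenspace A a" by (auto simp: gen_eigenspace_def intro!: exI[of _ 0])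
  fix x y c assume x: "x \<in> gen_eigenspace A a"
  then obtain n where n: "(shift A a ^^ n) x = 0" by (auto simp: gen_eigenspace_def)
  then have "(shift A a ^^ n) (scale c x) = 0" by (simp add: lin_scale[OF L])
  then show "scale c x \<in> gen_eigenspace A a" by (auto simp: gen_eigenspace_def)
  assume "y \<in> gen_eigenspace A a"
  then obtain m where m: "(shift A a ^^ m) y = 0" by (auto simp: gen_eigenspace_def)
  have "(shift A a ^^ (n + m)) (x + y) = 0"
    using funpow_zero_mono[OF lin_shift[OF assms] n, of "n + m"]
      funpow_zero_mono[OF lin_shift[OF assms] m, of "n + m"]
    by (simp add: lin_add[OF L])
  then show "x + y \<in> gen_eigenspace A a" by (auto simp: gen_eigenspace_def)
qed

lemma funpow_commute:
  assumes "\<And>x. f (g x) = g (f x)"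
  shows "(f ^^ n) (g x) = g ((f ^^ n) x)"
  by (induction n) (simp_all add: assms)

lemma gen_eigenspace_commute:
  assumes "lin B" "\<And>x. A (B x) = B (A x)" "x \<in> gen_eigenspace A a"
  shows "B x \<in> gen_eigenspace A a"
proof -
  obtain n where n: "(shift A a ^^ n) x = 0" using assms(3) by (auto simp: gen_eigenspace_def)
  have "(shift A a ^^ n) (B x) = B ((shift A a ^^ n) x)"
    by (rule funpow_commute) (simp add: shift_def assms lin_diff lin_scale)
  then show ?thesis using n assms(1) by (auto simp: gen_eigenspace_def lin_0 intro!: exI[of _ n])
qed

lemma shift_gen_eigenspace:
  assumes "lin A" "x \<in> gen_eigenspace A b"
  shows "shift A a x \<in> gen_eigenspace A b"
  by (rule gen_eigenspace_commute)
     (use assms in \<open>simp_all add: lin_shift, simp add: shift_def lin_diff lin_scale\<close>)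

text \<open>On the generalized eigenspace of \<open>b\<close>, A - a is the nonzero scalar b - a
  plus a nilpotent map. The induction is on the nilpotency index of \<open>w\<close>.\<close>

lemma shift_surj_gen_eigenspace:
  assumes A: "lin A" and "a \<noteq> b" and w: "w \<in> gen_eigenspace A b"
  shows "\<exists>u\<in>gen_eigenspace A b. shift A a u = w"
proof -
  obtain n where "(shift A b ^^ n) w = 0" using w by (auto simp: gen_eigenspace_def)
  then show ?thesis using w
  proof (induction n arbitrary: w)
    case 0
    then show ?case using subspace_0[OF subspace_gen_eigenspace[OF A]] A
      by (intro bexI[of _ 0]) (auto simp: lin_0[OF lin_shift])
  next
    case (Suc n)
    have "(shift A b ^^ n) (shift A b w) = 0" using Suc.prems(1) by (simp add: funpow_swap1)
    from Suc.IH[OF this shift_gen_eigenspace[OF A Suc.prems(2)]]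
    obtain u where u: "u \<in> gen_eigenspace A b" "shift A a u = shift A b w" by blast
    \<comment> \<open>From (A - a) u = (A - b) w it follows that (A - a)(w - u) = (b - a) w.\<close>
    let ?v = "scale (1 / (b - a)) (w - u)"
    have "shift A a (w - u) = scale (b - a) w"
      using u by (simp add: lin_diff[OF lin_shift[OF A]]) (simp add: shift_def scale_left_diff_distrib)
    then have "shift A a ?v = w" using assms(2) by (simp add: lin_scale[OF lin_shift[OF A]])
    moreover have "?v \<in> gen_eigenspace A b"
      using Suc.prems u by (intro subspace_scale subspace_diff subspace_gen_eigenspace A)
    ultimately show ?case by blast
  qed
qed

text \<open>If A v = a v, then A - b acts on \<open>v\<close> as the scalar a - b, and no power of a
  nonzero scalar kills a nonzero vector.\<close>

lemma shift_inj_gen_eigenspace: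
  assumes A: "lin A" and "a \<noteq> b" and v: "v \<in> gen_eigenspace A b" and "(shift A a ^^ n) v = 0"
  shows "v = 0"
  using v assms(4)
proof (induction n arbitrary: v)
  case (Suc n)
  have "shift A a v = 0"
  proof (rule Suc.IH)
    show "shift A a v \<in> gen_eigenspace A b" by (rule shift_gen_eigenspace[OF A Suc.prems(1)])
    show "(shift A a ^^ n) (shift A a v) = 0" using Suc.prems(2) by (simp add: funpow_swap1)
  qed
  then have 1: "shift A b v = scale (a - b) v" by (simp add: shift_def algebra_simps)
  obtain m where "(shift A b ^^ m) v = 0" using Suc.prems by (auto simp: gen_eigenspace_def)
  moreover have "(shift A b ^^ m) v = scale ((a - b) ^ m) v" for m
    by (induction m) (simp_all add: lin_scale[OF lin_shift[OF A]] 1 mult.commute)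
  ultimately show ?case using assms(2) by simp
qed simp

text \<open>A power of A - a kills the summand at \<open>a\<close> and is injective on the
  generalized eigenspaces of all other scalars.\<close>

lemma gen_eigenspace_independent:
  assumes A: "lin A" and "finite K" "\<And>a. a \<in> K \<Longrightarrow> c a \<in> gen_eigenspace A a" "sum c K = 0"
  shows "\<forall>a\<in>K. c a = 0"
  using assms(2,3,4)
proof (induction K arbitrary: c rule: finite_induct)
  case (insert a F)
  obtain n where n: "(shift A a ^^ n) (c a) = 0"
    using insert.prems(1)[of a] by (auto simp: gen_eigenspace_def)
  have L: "lin (shift A a ^^ n)" using A lin_shift lin_funpow by blast
  have "(\<Sum>b\<in>insert a F. (shift A a ^^ n) (c b)) = 0"
    using insert.prems(2) by (metis lin_sum[OF L] lin_0[OF L])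
  then have "(\<Sum>b\<in>F. (shift A a ^^ n) (c b)) = 0" using insert.hyps n by simp
  moreover have "(shift A a ^^ n) (c b) \<in> gen_eigenspace A b" if "b \<in> F" for b
    using insert.prems(1)[of b] that
    by (induction n) (auto intro: shift_gen_eigenspace[OF A])
  ultimately have "\<forall>b\<in>F. (shift A a ^^ n) (c b) = 0" by (intro insert.IH)
  then have "\<forall>b\<in>F. c b = 0"
    using insert.prems(1) insert.hyps by (metis insertCI shift_inj_gen_eigenspace[OF A])
  then show ?case using insert by simp
qed simp

end

locale fin_dim_endomorphisms = endomorphisms scale + finite_dimensional_vector_space scale Basis
  for scale :: "'a::field \<Rightarrow> 'b::ab_group_add \<Rightarrow> 'b" and Basis
begin

text \<open>Only finitely many of the summands are nonzero because a basis involves finitely many of them.\<close>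

lemma direct_sum_of_finite:
  assumes sub: "\<And>i. i \<in> J \<Longrightarrow> subspace (V i)"
    and gen: "span (\<Union>i\<in>J. V i) = UNIV"
    and ind: "\<And>K c. finite K \<Longrightarrow> K \<subseteq> J \<Longrightarrow> (\<And>i. i \<in> K \<Longrightarrow> c i \<in> V i) \<Longrightarrow> sum c K = 0 \<Longrightarrow> \<forall>i\<in>K. c i = 0"
  shows "\<exists>K\<subseteq>J. direct_sum_of K V \<and> (\<forall>i\<in>J - K. V i = {0})"
proof -
  have "\<exists>t. finite t \<and> t \<subseteq> (\<Union>i\<in>J. V i) \<and> b \<in> span t" for b
  proof -
    have "b \<in> span (\<Union>i\<in>J. V i)" using gen by simp
    then obtain t r where "finite t" "t \<subseteq> (\<Union>i\<in>J. V i)" "b = (\<Sum>a\<in>t. scale (r a) a)"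
      unfolding span_explicit by blast
    then show ?thesis by (intro exI[of _ t]) (auto intro: span_sum span_scale span_base)
  qed
  then obtain t where t: "\<And>b. finite (t b)" "\<And>b. t b \<subseteq> (\<Union>i\<in>J. V i)" "\<And>b. b \<in> span (t b)" by metis
  define S where "S = (\<Union>b\<in>Basis. t b)"
  have S: "finite S" "S \<subseteq> (\<Union>i\<in>J. V i)" using t finite_Basis by (auto simp: S_def)
  then have "\<forall>s\<in>S. \<exists>i. i \<in> J \<and> s \<in> V i" by auto
  then obtain ix where ix: "\<And>s. s \<in> S \<Longrightarrow> ix s \<in> J \<and> s \<in> V (ix s)" by metis
  define K where "K = ix ` S"
  have K: "finite K" "K \<subseteq> J" using S ix by (auto simp: K_def)
  have "Basis \<subseteq> span (\<Union>i\<in>K. V i)"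
  proof
    fix b assume "b \<in> Basis"
    then have "t b \<subseteq> (\<Union>i\<in>K. V i)" using ix by (auto simp: K_def S_def)
    then show "b \<in> span (\<Union>i\<in>K. V i)" using t(3) span_mono by blast
  qed
  then have "span Basis \<subseteq> span (\<Union>i\<in>K. V i)" by (intro span_minimal) auto
  then have spX: "x \<in> span (\<Union>i\<in>K. V i)" for x using span_Basis by auto
  have dec: "\<exists>c. (\<forall>i\<in>K. c i \<in> V i) \<and> x = sum c K" for x
    by (rule span_Union_sum[OF spX K(1)]) (use sub K in auto)
  have ds: "direct_sum_of K V"
    by (rule direct_sum_ofI) (use K sub dec ind[OF K] in blast)+
  have "V j = {0}" if j: "j \<in> J - K" for j
  proof -
    have "x = 0" if x: "x \<in> V j" for x
    proof -
      obtain c where c: "\<forall>i\<in>K. c i \<in> V i" "x = sum c K" using dec by blast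
      \<comment> \<open>Moving \<open>x\<close> to the other side of its decomposition over
        \<open>K\<close> gives a relation over \<open>insert j K\<close>.\<close>
      have "\<forall>i\<in>insert j K. (c(j := - x)) i = 0"
      proof (rule ind)
        have "sum (c(j := - x)) K = sum c K" using j by (intro sum.cong) auto
        then show "sum (c(j := - x)) (insert j K) = 0" using j K c(2) by simp
      qed (use j K x c sub in \<open>auto intro: subspace_neg\<close>)
      then show "x = 0" by simp
    qed
    then show ?thesis using sub[of j] j subspace_0 by auto
  qed
  then show ?thesis using ds K by auto
qed

lemma direct_sum_of_eigenspaces:
  fixes ev :: "'j \<Rightarrow> 'i \<Rightarrow> 'a"
  assumes A: "\<And>i. i \<in> I \<Longrightarrow> lin (A i)"
    and V: "\<And>\<chi>. V \<chi> = {x. \<forall>i\<in>I. A i x = scale (ev \<chi> i) x}"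
    and dist: "\<And>\<chi> \<psi>. \<chi> \<in> J \<Longrightarrow> \<psi> \<in> J \<Longrightarrow> \<chi> \<noteq> \<psi> \<Longrightarrow> \<exists>i\<in>I. ev \<chi> i \<noteq> ev \<psi> i"
    and gen: "span (\<Union>\<chi>\<in>J. V \<chi>) = UNIV"
  shows "\<exists>K\<subseteq>J. direct_sum_of K V \<and> (\<forall>\<chi>\<in>J - K. V \<chi> = {0})"
proof (rule direct_sum_of_finite)
  show "subspace (V i)" for i unfolding V by (rule subspace_eigenspace[OF A])
  show "span (\<Union>\<chi>\<in>J. V \<chi>) = UNIV" by fact
  show "\<forall>i\<in>K. c i = 0" if "finite K" "K \<subseteq> J" "\<And>i. i \<in> K \<Longrightarrow> c i \<in> V i" "sum c K = 0" for K c
  proof (rule eigenvector_sum_zero[of K I A c ev])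
    show "\<exists>i\<in>I. ev \<chi> i \<noteq> ev \<psi> i" if "\<chi> \<in> K" "\<psi> \<in> K" "\<chi> \<noteq> \<psi>" for \<chi> \<psi>
      using dist that \<open>K \<subseteq> J\<close> by blast
  qed (use A that in \<open>auto simp: V\<close>)
qed


subsection \<open>The trace\<close>

lemma finite_basis: "independent B \<Longrightarrow> finite B"
  by (rule finiteI_independent)

lemma representation_sum_scale:
  assumes "independent B" "span B = UNIV"
  shows "representation B (\<Sum>i\<in>I. scale (c i) (w i)) b = (\<Sum>i\<in>I. c i * representation B (w i) b)"
  using assms by (simp add: representation_sum representation_scale)

lemma sum_representation:
  assumes "independent B" "span B = UNIV"
  shows "(\<Sum>b\<in>B. scale (representation B v b) b) = v"
  using assms by (intro sum_representation_eq) (auto simp: finite_basis)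

definition tr :: "('b \<Rightarrow> 'b) \<Rightarrow> 'a" where
  "tr A = (\<Sum>b\<in>Basis. representation Basis (A b) b)"

text \<open>Allows the trace of a projection to be computed in a basis adapted to its image. The
  matrix entries are expanded in both bases and the double sum is swapped.\<close>

lemma tr_eq_basis:
  assumes A: "lin A" and B: "independent B" "span B = UNIV"
  shows "tr A = (\<Sum>b\<in>B. representation B (A b) b)"
proof -
  let ?R = "representation B" and ?S = "representation Basis"
  note E = independent_Basis span_Basis
  have "?S (A b') b' = (\<Sum>b\<in>B. ?R b' b * ?S (A b) b')" for b'
  proof -
    have "A b' = A (\<Sum>b\<in>B. scale (?R b' b) b)" using sum_representation[OF B] by simp
    also have "\<dots> = (\<Sum>b\<in>B. scale (?R b' b) (A b))" by (simp add: lin_sum[OF A] lin_scale[OF A])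
    finally show ?thesis using representation_sum_scale[OF E] by simp
  qed
  then have "tr A = (\<Sum>b\<in>B. \<Sum>b'\<in>Basis. ?S (A b) b' * ?R b' b)"
    unfolding tr_def by (subst sum.swap) (simp add: mult.commute)
  also have "\<dots> = (\<Sum>b\<in>B. ?R (A b) b)"
    using representation_sum_scale[OF B, of "\<lambda>b'. ?S (A _) b'" "\<lambda>b'. b'" Basis]
    by (intro sum.cong refl) (metis (no_types, lifting) E sum_representation sum.cong)
  finally show ?thesis .
qed

lemma tr_comm:
  assumes A: "lin A" and C: "lin C"
  shows "tr (\<lambda>x. A (C x)) = tr (\<lambda>x. C (A x))"
proof -
  let ?S = "representation Basis"
  note E = independent_Basis span_Basis
  have *: "?S (A (C b)) b = (\<Sum>b'\<in>Basis. ?S (C b) b' * ?S (A b') b)" if A: "lin A" for A C b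
  proof -
    have "A (C b) = A (\<Sum>b'\<in>Basis. scale (?S (C b) b') b')" using sum_representation[OF E] by simp
    also have "\<dots> = (\<Sum>b'\<in>Basis. scale (?S (C b) b') (A b'))" by (simp add: lin_sum[OF A] lin_scale[OF A])
    finally show ?thesis using representation_sum_scale[OF E] by simp
  qed
  have "tr (\<lambda>x. A (C x)) = (\<Sum>b\<in>Basis. \<Sum>b'\<in>Basis. ?S (C b) b' * ?S (A b') b)"
    unfolding tr_def by (intro sum.cong refl *[OF A])
  also have "\<dots> = (\<Sum>b\<in>Basis. \<Sum>b'\<in>Basis. ?S (A b) b' * ?S (C b') b)"
    by (subst sum.swap) (simp add: mult.commute)
  also have "\<dots> = tr (\<lambda>x. C (A x))"
    unfolding tr_def by (intro sum.cong refl *[OF C, symmetric])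
  finally show ?thesis .
qed

lemma tr_cong: "(\<And>x. A x = C x) \<Longrightarrow> tr A = tr C"
  by (simp add: tr_def)

lemma tr_add: "tr (\<lambda>x. A x + C x) = tr A + tr C"
  and tr_diff: "tr (\<lambda>x. A x - C x) = tr A - tr C"
  and tr_scale: "tr (\<lambda>x. scale c (A x)) = c * tr A"
  and tr_zero: "tr (\<lambda>x. 0) = 0"
  by (simp_all add: tr_def representation_add representation_diff representation_scale representation_zero
      independent_Basis span_Basis sum.distrib sum_subtractf sum_distrib_left)

lemma tr_sum: "tr (\<lambda>x. \<Sum>i\<in>I. A i x) = (\<Sum>i\<in>I. tr (A i))"
  by (induction I rule: infinite_finite_induct) (simp_all add: tr_zero tr_add)

lemma projection_exists:
  assumes "subspace W"
  shows "\<exists>P. lin P \<and> (\<forall>x. P x \<in> W) \<and> (\<forall>w\<in>W. P w = w)"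
proof -
  interpret p: vector_space_pair scale scale by unfold_locales
  show ?thesis
    using p.linear_exists_left_inverse_on[OF lin_ident assms] by auto
qed

definition nilp :: "('b \<Rightarrow> 'b) \<Rightarrow> bool" where
  "nilp A \<longleftrightarrow> (\<exists>n. \<forall>x. (A ^^ n) x = 0)"

lemma nilpI:
  assumes A: "lin A" and "\<And>x. \<exists>n. (A ^^ n) x = 0"
  shows "nilp A"
proof -
  obtain n where n: "\<And>x. (A ^^ n x) x = 0" using assms by metis
  define N where "N = Max (n ` Basis)"
  have "(A ^^ N) x = (\<lambda>x. 0) x" for x
  proof (rule lin_eq_on_Basis[OF lin_funpow[OF A] lin_const_0 span_Basis])
    fix b assume "b \<in> Basis"
    then have "n b \<le> N" using finite_Basis by (simp add: N_def)
    then show "(A ^^ N) b = 0" by (rule funpow_zero_mono[OF A n])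
  qed
  then show ?thesis unfolding nilp_def by auto
qed

text \<open>If \<open>P\<close> projects onto the image of \<open>A\<close>, then \<open>A = P A\<close> has the same trace as \<open>A P\<close>, whose nilpotency index is smaller.\<close>

lemma tr_nilp:
  assumes "lin A" "nilp A"
  shows "tr A = 0"
proof -
  obtain n where "\<And>x. (A ^^ n) x = 0" using assms(2) by (auto simp: nilp_def)
  then show ?thesis using assms(1)
  proof (induction n arbitrary: A)
    case 0
    then have "A = (\<lambda>x. 0)" by (metis funpow_0)
    then show ?case by (simp add: tr_zero)
  next
    case (Suc n)
    show ?case
    proof (cases n)
      case 0
      then have "A = (\<lambda>x. 0)" using Suc.prems(1) by auto
      then show ?thesis by (simp add: tr_zero)
    next
      case (Suc m)
      have "subspace (range A)"
        using module_hom.subspace_image[of scale scale A UNIV] Suc.prems(2)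
        by (simp add: module_hom_eq_linear)
      then obtain P where P: "lin P" "\<And>x. P x \<in> range A" "\<And>x. P (A x) = A x"
        using projection_exists[of "range A"] by auto
      let ?C = "\<lambda>x. A (P x)"
      have "((\<lambda>x. A (P x)) ^^ k) (A y) = (A ^^ k) (A y)" for k y
      proof (induction k)
        case (Suc k)
        have "P ((A ^^ k) (A y)) = (A ^^ k) (A y)" using P(3)[of "(A ^^ k) y"] by (simp only: funpow_swap1)
        then show ?case using Suc by simp
      qed simp
      then have "(?C ^^ n) x = (A ^^ n) (P x)" for x
        unfolding Suc by (simp only: funpow_Suc_right comp_apply)
      then have "(?C ^^ n) x = 0" for x
        using P(2)[of x] Suc.prems(1) by (auto simp del: funpow.simps simp: funpow_Suc_right)
      then have "tr ?C = 0"
        by (intro Suc.IH) (use P Suc.prems lin_comp in auto)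
      moreover have "tr A = tr (\<lambda>x. P (A x))" by (rule tr_cong) (simp add: P)
      ultimately show ?thesis using tr_comm[OF P(1) Suc.prems(2)] by simp
    qed
  qed
qed

lemma tr_projection:
  assumes P: "lin P" "\<And>x. P x \<in> W" "\<And>w. w \<in> W \<Longrightarrow> P w = w" and W: "subspace W"
  shows "tr P = of_nat (dim W)"
proof -
  obtain B where B: "B \<subseteq> W" "independent B" "W \<subseteq> span B" "card B = dim W"
    using basis_exists[of W] by blast
  let ?E = "extend_basis B"
  have E: "independent ?E" "span ?E = UNIV" "B \<subseteq> ?E"
    using B by (auto simp: independent_extend_basis span_extend_basis extend_basis_superset)
  have "representation ?E (P b) b = (if b \<in> B then 1 else 0)" if b: "b \<in> ?E" for b
  proof (cases "b \<in> B")
    case True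
    then have "P b = b" using B P by auto
    then show ?thesis using True b by (simp add: representation_basis[OF E(1)])
  next
    case False
    have "P b \<in> span B" using B P by auto
    then have "representation ?E (P b) = representation B (P b)"
      by (rule representation_extend[OF E(1) _ E(3)])
    then show ?thesis using False representation_ne_zero by auto
  qed
  then have "tr P = (\<Sum>b\<in>?E. if b \<in> B then 1 else 0)"
    unfolding tr_eq_basis[OF P(1) E(1,2)] by (intro sum.cong) auto
  also have "\<dots> = of_nat (card B)"
    using E finite_basis[OF E(1)] by (simp add: sum.If_cases Int_absorb1)
  finally show ?thesis using B by simp
qed

lemma tr_diagonal_map:
  assumes ds: "direct_sum_of K V"
  shows "tr (diagonal_map K V f) = (\<Sum>i\<in>K. f i * of_nat (dim (V i)))"
proof -
  have "tr (component K V i) = of_nat (dim (V i))" if "i \<in> K" for i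
    by (rule tr_projection)
       (use ds that in \<open>auto simp: component_same component_in direct_sum_ofD intro: lin_component\<close>)
  then show ?thesis unfolding diagonal_map_def[abs_def] tr_sum tr_scale by simp
qed

text \<open>The trace is the sum of the traces of the diagonal blocks: since each projection is
  idempotent, cyclicity turns A P into P A P, which is zero. This will make graded pieces of
  non-inverse degrees orthogonal.\<close>

lemma tr_shift_components:
  assumes ds: "direct_sum_of K V" and A: "lin A"
    and "\<And>i x. i \<in> K \<Longrightarrow> x \<in> V i \<Longrightarrow> component K V i (A x) = 0"
  shows "tr A = 0"
proof -
  let ?P = "component K V"
  note L = lin_component[OF ds]
  have "tr A = tr (\<lambda>x. \<Sum>i\<in>K. A (?P i x))"
    by (rule tr_cong) (simp add: lin_sum[OF A, symmetric] sum_component[OF ds])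
  also have "\<dots> = (\<Sum>i\<in>K. tr (\<lambda>x. A (?P i x)))" by (rule tr_sum)
  also have "\<dots> = (\<Sum>i\<in>K. 0)"
  proof (rule sum.cong)
    fix i assume i: "i \<in> K"
    have "tr (\<lambda>x. A (?P i x)) = tr (\<lambda>x. A (?P i (?P i x)))"
      by (rule tr_cong) (simp add: component_same[OF ds i component_in[OF ds i] i])
    also have "\<dots> = tr (\<lambda>x. ?P i (A (?P i x)))"
      using tr_comm[OF lin_comp[OF A L[OF i]] L[OF i]] by simp
    also have "\<dots> = tr (\<lambda>x. 0)"
      by (rule tr_cong) (rule assms(3)[OF i component_in[OF ds i]])
    finally show "tr (\<lambda>x. A (?P i x)) = 0" by (simp add: tr_zero)
  qed simp
  finally show ?thesis by simp
qed

end

subsection \<open>The Jordan decomposition\<close>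

locale alg_closed_endomorphisms = fin_dim_endomorphisms scale Basis
  for scale :: "'a::{alg_closed_field,field_char_0} \<Rightarrow> 'b::ab_group_add \<Rightarrow> 'b" and Basis
begin

text \<open>The explicit bound \<open>N\<close> separates the sum from the degree, so that splitting
  off a linear factor is a step from \<open>Suc N\<close> to \<open>N\<close>.\<close>

definition poly_apply :: "nat \<Rightarrow> 'a poly \<Rightarrow> ('b \<Rightarrow> 'b) \<Rightarrow> 'b \<Rightarrow> 'b" where
  "poly_apply N p A v = (\<Sum>i\<le>N. scale (coeff p i) ((A ^^ i) v))"

lemma poly_apply_linear_factor:
  assumes A: "lin A" and "degree q \<le> N"
  shows "poly_apply (Suc N) ([:- a, 1:] * q) A v = poly_apply N q A (shift A a v)"
proof -
  have q: "coeff q (Suc N) = 0" using assms by (simp add: coeff_eq_0)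
  have cf: "coeff ([:- a, 1:] * q) i = (case i of 0 \<Rightarrow> 0 | Suc j \<Rightarrow> coeff q j) - a * coeff q i" for i
    by (simp add: coeff_pCons split: nat.splits)
  have "poly_apply (Suc N) ([:- a, 1:] * q) A v =
     (\<Sum>i\<le>Suc N. scale (case i of 0 \<Rightarrow> 0 | Suc j \<Rightarrow> coeff q j) ((A ^^ i) v)) -
     (\<Sum>i\<le>Suc N. scale (a * coeff q i) ((A ^^ i) v))"
    unfolding poly_apply_def cf by (simp only: scale_left_diff_distrib sum_subtractf)
  also have "(\<Sum>i\<le>Suc N. scale (case i of 0 \<Rightarrow> 0 | Suc j \<Rightarrow> coeff q j) ((A ^^ i) v)) =
     (\<Sum>i\<le>N. scale (coeff q i) ((A ^^ Suc i) v))"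
    by (subst sum.atMost_Suc_shift) simp
  also have "(\<Sum>i\<le>Suc N. scale (a * coeff q i) ((A ^^ i) v)) = (\<Sum>i\<le>N. scale (a * coeff q i) ((A ^^ i) v))"
    using q by simp
  also have "(\<Sum>i\<le>N. scale (coeff q i) ((A ^^ Suc i) v)) - \<dots> = poly_apply N q A (shift A a v)"
    unfolding poly_apply_def sum_subtractf[symmetric]
    by (rule sum.cong)
       (simp_all add: shift_def lin_diff[OF lin_funpow[OF A]] lin_scale[OF lin_funpow[OF A]]
          funpow_swap1 scale_right_diff_distrib mult.commute)
  finally show ?thesis .
qed

text \<open>There is one more power than basis vectors. A repetition among the vectors A^i v is
  treated apart, because it shrinks the set they form; it gives the polynomial X^j - X^i
  directly.\<close>

lemma annihilating_poly: "\<exists>p. p \<noteq> 0 \<and> poly_apply (degree p) p A v = 0"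
proof (cases "inj_on (\<lambda>i. (A ^^ i) v) {..card Basis}")
  case False
  then obtain i j where ij: "i < j" "(A ^^ i) v = (A ^^ j) v"
    unfolding inj_on_def by (metis linorder_neqE_nat)
  let ?p = "monom 1 j - monom 1 i :: 'a poly"
  have c: "coeff ?p k = (if k = j then 1 else 0) - (if k = i then 1 else 0)" for k by auto
  have "coeff ?p j = 1" using ij by simp
  moreover have "degree ?p \<le> j" using ij by (intro degree_le) auto
  ultimately have d: "degree ?p = j" "?p \<noteq> 0"
    by (metis le_degree antisym zero_neq_one, metis coeff_0 zero_neq_one)
  have "poly_apply j ?p A v = (\<Sum>k\<le>j. (if k = j then (A ^^ j) v else 0) - (if k = i then (A ^^ i) v else 0))"
    unfolding poly_apply_def c by (rule sum.cong) auto
  also have "\<dots> = 0" using ij by (simp add: sum_subtractf)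
  finally show ?thesis using d by metis
next
  case True
  let ?f = "\<lambda>i. (A ^^ i) v" and ?N = "card Basis"
  have "card (?f ` {..?N}) = Suc ?N" using True by (simp add: card_image)
  then have "dependent (?f ` {..?N})"
    by (intro dependent_biggerset_general) (use dim_subset_UNIV[of "?f ` {..?N}"] in \<open>simp add: dimension_def\<close>)
  then obtain u where u: "(\<Sum>w\<in>?f ` {..?N}. scale (u w) w) = 0" "\<exists>w\<in>?f ` {..?N}. u w \<noteq> 0"
    using dependent_finite[of "?f ` {..?N}"] by auto
  have s: "(\<Sum>i\<le>?N. scale (u (?f i)) (?f i)) = 0" using u(1) by (simp add: sum.reindex[OF True])
  let ?p = "Abs_poly (\<lambda>i. if i \<le> ?N then u (?f i) else 0)"
  have c: "coeff ?p = (\<lambda>i. if i \<le> ?N then u (?f i) else 0)"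
    by (rule coeff_Abs_poly[of ?N]) auto
  obtain i where "i \<le> ?N" "u (?f i) \<noteq> 0" using u(2) by auto
  then have "coeff ?p i \<noteq> 0" by (simp only: c) simp
  then have "?p \<noteq> 0" by (metis coeff_0)
  moreover have "degree ?p \<le> ?N" using c by (intro degree_le) auto
  then have "poly_apply (degree ?p) ?p A v = (\<Sum>i\<le>?N. scale (coeff ?p i) (?f i))"
    unfolding poly_apply_def by (intro sum.mono_neutral_left) (auto simp: coeff_eq_0)
  ultimately show ?thesis using s by (intro exI[of _ ?p]) (simp add: c)
qed

text \<open>Over an algebraically closed field an annihilating polynomial of a vector splits, and
  its linear factors are peeled off one at a time; \<open>fact\<close> is the peeling step.\<close>

lemma span_gen_eigenspaces:
  assumes A: "lin A"
  shows "span (\<Union>a. gen_eigenspace A a) = UNIV"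
proof -
  let ?S = "span (\<Union>a. gen_eigenspace A a)"
  have fact: "w \<in> ?S" if "shift A a w \<in> ?S" for a w
  proof -
    have "\<exists>t r. shift A a w = (\<Sum>x\<in>t. scale (r x) x) \<and> finite t \<and> t \<subseteq> (\<Union>a. gen_eigenspace A a)"
      using that by (simp only: span_explicit mem_Collect_eq)
    then obtain t r where t: "finite t" "t \<subseteq> (\<Union>a. gen_eigenspace A a)" "shift A a w = (\<Sum>x\<in>t. scale (r x) x)"
      by (elim exE conjE) (rule that)
    \<comment> \<open>Summands for b \<noteq> a have a preimage under A - a. Those for b = a are
      kept as \<open>y\<close>: they leave a remainder of \<open>w\<close> whose image under A - a
      is in the generalized eigenspace of \<open>a\<close>, so the remainder is there as
      well.\<close>
    have "\<exists>u\<in>?S. \<exists>y\<in>gen_eigenspace A a. shift A a u + y = x" if x: "x \<in> t" for x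
    proof -
      obtain b where b: "x \<in> gen_eigenspace A b" using t(2) x by blast
      show ?thesis
      proof (cases "a = b")
        case True
        then show ?thesis using b A span_zero by (intro bexI[of _ 0] bexI[of _ x]) (auto simp: lin_0[OF lin_shift])
      next
        case False
        obtain u where "u \<in> gen_eigenspace A b" "shift A a u = x"
          using shift_surj_gen_eigenspace[OF A False b] by auto
        then show ?thesis using subspace_0[OF subspace_gen_eigenspace[OF A]]
          by (intro bexI[of _ u] bexI[of _ 0]) (auto intro: span_base)
      qed
    qed
    then obtain u y where uy: "\<And>x. x \<in> t \<Longrightarrow> u x \<in> ?S" "\<And>x. x \<in> t \<Longrightarrow> y x \<in> gen_eigenspace A a"
      "\<And>x. x \<in> t \<Longrightarrow> shift A a (u x) + y x = x" by metis
    let ?u = "\<Sum>x\<in>t. scale (r x) (u x)" and ?y = "\<Sum>x\<in>t. scale (r x) (y x)"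
    have "shift A a ?u + ?y = (\<Sum>x\<in>t. scale (r x) (shift A a (u x) + y x))"
      by (simp add: lin_sum[OF lin_shift[OF A]] lin_scale[OF lin_shift[OF A]] sum.distrib scale_right_distrib)
    also have "\<dots> = shift A a w" using t uy by simp
    finally have "shift A a (w - ?u) = ?y" by (simp add: lin_diff[OF lin_shift[OF A]] algebra_simps)
    moreover have "?y \<in> gen_eigenspace A a"
      by (intro subspace_sum subspace_gen_eigenspace A subspace_scale uy)
    ultimately obtain n where "(shift A a ^^ n) (shift A a (w - ?u)) = 0" by (auto simp: gen_eigenspace_def)
    then have "w - ?u \<in> gen_eigenspace A a" by (auto simp: gen_eigenspace_def funpow_swap1 intro!: exI[of _ "Suc n"])
    then have "w - ?u \<in> ?S" by (auto intro: span_base)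
    moreover have "?u \<in> ?S" by (intro span_sum span_scale uy)
    ultimately have "w - ?u + ?u \<in> ?S" by (rule span_add)
    then show ?thesis by simp
  qed
  have "p \<noteq> 0 \<Longrightarrow> degree p = N \<Longrightarrow> poly_apply N p A v = 0 \<Longrightarrow> v \<in> ?S" for N p v
  proof (induction N arbitrary: p v)
    case 0
    then obtain c where "p = [:c:]" "c \<noteq> 0" by (metis degree_eq_zeroE pCons_0_0)
    then have "v = 0" using 0 by (simp add: poly_apply_def)
    then show ?case by (simp add: span_zero)
  next
    case (Suc N)
    then obtain a where "poly p a = 0" using alg_closed_imp_poly_has_root[of p] by auto
    then obtain q where q: "p = [:- a, 1:] * q" using poly_eq_0_iff_dvd by (metis dvdE)
    then have q0: "q \<noteq> 0" using Suc.prems by auto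
    have "degree p = Suc (degree q)" unfolding q using q0 by (subst degree_mult_eq) auto
    then have d: "degree q = N" using Suc.prems by simp
    have "poly_apply N q A (shift A a v) = 0"
      using poly_apply_linear_factor[OF A, of q N a v] d Suc.prems(3) q by simp
    from Suc.IH[OF q0 d this] show ?case by (rule fact)
  qed
  then show ?thesis using annihilating_poly[of A] by blast
qed

lemma direct_sum_of_gen_eigenspaces:
  assumes "lin A"
  shows "\<exists>K. direct_sum_of K (gen_eigenspace A) \<and> (\<forall>a. a \<notin> K \<longrightarrow> gen_eigenspace A a = {0})"
proof -
  have "\<exists>K\<subseteq>UNIV. direct_sum_of K (gen_eigenspace A) \<and> (\<forall>a\<in>UNIV - K. gen_eigenspace A a = {0})"
  proof (rule direct_sum_of_finite)
    show "\<forall>i\<in>K. c i = 0"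
      if "finite K" "K \<subseteq> UNIV" "\<And>i. i \<in> K \<Longrightarrow> c i \<in> gen_eigenspace A i" "sum c K = 0" for K c
      by (rule gen_eigenspace_independent[OF assms]) (use that in auto)
  qed (simp_all add: subspace_gen_eigenspace span_gen_eigenspaces assms)
  then show ?thesis by blast
qed

text \<open>A finite set containing all eigenvalues; the choice may also contain scalars with zero
  generalized eigenspace.\<close>

definition spectrum :: "('b \<Rightarrow> 'b) \<Rightarrow> 'a set" where
  "spectrum A = (SOME K. direct_sum_of K (gen_eigenspace A) \<and> (\<forall>a. a \<notin> K \<longrightarrow> gen_eigenspace A a = {0}))"

lemma spectrum:
  assumes "lin A"
  shows direct_sum_spectrum: "direct_sum_of (spectrum A) (gen_eigenspace A)"
    and gen_eigenspace_not_spectrum: "a \<notin> spectrum A \<Longrightarrow> gen_eigenspace A a = {0}"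
  using someI_ex[OF direct_sum_of_gen_eigenspaces[OF assms]] unfolding spectrum_def by auto

text \<open>For the identity \<open>f\<close> this is the semisimple part of \<open>A\<close>.\<close>

definition spectral_map :: "('a \<Rightarrow> 'a) \<Rightarrow> ('b \<Rightarrow> 'b) \<Rightarrow> 'b \<Rightarrow> 'b" where
  "spectral_map f A = diagonal_map (spectrum A) (gen_eigenspace A) f"

lemma lin_spectral_map: "lin A \<Longrightarrow> lin (spectral_map f A)"
  unfolding spectral_map_def by (intro lin_diagonal_map direct_sum_spectrum)

lemma spectral_map_eq:
  assumes "lin A" "x \<in> gen_eigenspace A a"
  shows "spectral_map f A x = scale (f a) x"
proof (cases "a \<in> spectrum A")
  case True
  then show ?thesis using assms unfolding spectral_map_def by (intro diagonal_map_eq direct_sum_spectrum)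
next
  case False
  then have "x = 0" using assms gen_eigenspace_not_spectrum by auto
  then show ?thesis by (simp add: lin_0[OF lin_spectral_map[OF assms(1)]])
qed

lemma spectral_map_commute:
  assumes "lin A" "lin B" "\<And>x. A (B x) = B (A x)"
  shows "spectral_map f A (B x) = B (spectral_map f A x)"
  unfolding spectral_map_def
  by (rule diagonal_map_commute[OF direct_sum_spectrum]) (use assms gen_eigenspace_commute in auto)

text \<open>On the generalized eigenspace of \<open>a\<close> the difference is A - a, which is
  locally nilpotent there, and these spaces span.\<close>

lemma nilp_minus_spectral_map:
  assumes A: "lin A"
  shows "nilp (\<lambda>x. A x - spectral_map (\<lambda>a. a) A x)"
proof -
  let ?N = "\<lambda>x. A x - spectral_map (\<lambda>a. a) A x"
  have N: "lin ?N" by (intro lin_minus lin_spectral_map A)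
  have sh: "shift ?N 0 = ?N" by (simp add: shift_def fun_eq_iff)
  have *: "(?N ^^ n) x = (shift A a ^^ n) x \<and> (shift A a ^^ n) x \<in> gen_eigenspace A a"
    if x: "x \<in> gen_eigenspace A a" for a x n
  proof (induction n)
    case (Suc n)
    then show ?case using spectral_map_eq[OF A, of "(shift A a ^^ n) x" a "\<lambda>a. a"]
        shift_gen_eigenspace[OF A, of "(shift A a ^^ n) x" a a]
      by (simp add: shift_def[of A a "(shift A a ^^ n) x"])
  qed (simp add: x)
  have "gen_eigenspace A a \<subseteq> gen_eigenspace ?N 0" for a
  proof
    fix x assume x: "x \<in> gen_eigenspace A a"
    then obtain n where "(shift A a ^^ n) x = 0" by (auto simp: gen_eigenspace_def)
    then have "(?N ^^ n) x = 0" using *[OF x] by simp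
    then show "x \<in> gen_eigenspace ?N 0" unfolding gen_eigenspace_def sh by blast
  qed
  then have "(\<Union>a. gen_eigenspace A a) \<subseteq> gen_eigenspace ?N 0" by auto
  then have "span (\<Union>a. gen_eigenspace A a) \<subseteq> gen_eigenspace ?N 0"
    by (rule span_minimal) (rule subspace_gen_eigenspace[OF N])
  then have "gen_eigenspace ?N 0 = UNIV" using span_gen_eigenspaces[OF A] by auto
  then show ?thesis
    unfolding gen_eigenspace_def sh by (intro nilpI N) auto
qed

end

section \<open>Semisimple Lie algebras\<close>

locale fin_dim_lie_algebra = lie_algebra scale bracket + alg_closed_endomorphisms scale Basis
  for scale :: "'k::{alg_closed_field,field_char_0} \<Rightarrow> 'l::ab_group_add \<Rightarrow> 'l" and bracket and Basis
begin

lemma lin_bracket: "lin (bracket x)"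
  and lin_bracket_left: "lin (\<lambda>x. bracket x y)"
  by (simp_all add: lin_iff bracket_add_left bracket_add_right bracket_scale_left bracket_scale_right)

lemma bracket_0 [simp]: "bracket x 0 = 0" "bracket 0 x = 0"
  using lin_0[OF lin_bracket] lin_0[OF lin_bracket_left] by auto

lemma bracket_minus [simp]: "bracket x (- y) = - bracket x y" "bracket (- x) y = - bracket x y"
  using lin_neg[OF lin_bracket] lin_neg[OF lin_bracket_left] by auto

lemma bracket_diff: "bracket x (y - z) = bracket x y - bracket x z"
    "bracket (x - y) z = bracket x z - bracket y z"
  using lin_diff[OF lin_bracket] lin_diff[OF lin_bracket_left] by auto

lemma bracket_sum: "bracket x (sum f S) = (\<Sum>i\<in>S. bracket x (f i))"
    "bracket (sum f S) x = (\<Sum>i\<in>S. bracket (f i) x)"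
  using lin_sum[OF lin_bracket] lin_sum[OF lin_bracket_left] by auto

lemma bracket_anticommute: "bracket y x = - bracket x y"
proof -
  have "bracket (x + y) (x + y) = bracket x y + bracket y x"
    unfolding bracket_add_left bracket_add_right by (simp add: bracket_self)
  then have "bracket y x + bracket x y = 0" by (simp add: bracket_self add.commute)
  then show ?thesis by (simp add: eq_neg_iff_add_eq_0)
qed

lemma bracket_bracket: "bracket (bracket x y) z = bracket x (bracket y z) - bracket y (bracket x z)"
  using jacobi[of x y z] bracket_anticommute[of z x] bracket_anticommute[of z "bracket x y"]
  by (simp add: algebra_simps eq_neg_iff_add_eq_0)

section \<open>Derivations\<close>

definition derivation :: "('l \<Rightarrow> 'l) \<Rightarrow> bool" where
  "derivation D \<longleftrightarrow> lin D \<and> (\<forall>x y. D (bracket x y) = bracket (D x) y + bracket x (D y))"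

lemma derivation_bracket: "derivation (bracket x)"
  by (simp add: derivation_def lin_bracket bracket_bracket algebra_simps)

lemma derivation_diff: "derivation D \<Longrightarrow> derivation E \<Longrightarrow> derivation (\<lambda>x. D x - E x)"
  by (auto simp: derivation_def lin_minus bracket_diff)

subsection \<open>Engel's theorem\<close>

definition subalgebra :: "'l set \<Rightarrow> bool" where
  "subalgebra K \<longleftrightarrow> subspace K \<and> (\<forall>x\<in>K. \<forall>y\<in>K. bracket x y \<in> K)"

lemma maximal_dim_exists:
  assumes "P M0"
  shows "\<exists>M. P M \<and> (\<forall>N. P N \<longrightarrow> dim N \<le> dim M)"
  using ex_has_greatest_nat[of P M0 dim "Suc dimension"] assms dim_subset_UNIV
  by (metis less_Suc_eq_le)

lemma dim_insert_less:
  assumes "subspace M" "x \<notin> M"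
  shows "dim M < dim (span (insert x M))"
proof -
  have "span M \<subset> span (insert x M)"
    using assms span_mono[of M "insert x M"] span_base[of x "insert x M"] span_eq_iff[of M] by blast
  then show ?thesis using dim_psubset dim_span by metis
qed

text \<open>Engel's theorem for \<open>K\<close> acting on V/W, with the quotient expressed by a
  pair of invariant subspaces. This form can be applied to itself: once to K/M for a maximal proper
  subalgebra \<open>M\<close>, once to \<open>M\<close> acting on V/W.\<close>

lemma engel:
  assumes "subalgebra K" "\<And>x. x \<in> K \<Longrightarrow> nilp (bracket x)"
    and "subspace V" "subspace W" "W \<subset> V"
    and "\<And>x v. x \<in> K \<Longrightarrow> v \<in> V \<Longrightarrow> bracket x v \<in> V" "\<And>x v. x \<in> K \<Longrightarrow> v \<in> W \<Longrightarrow> bracket x v \<in> W"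
  shows "\<exists>v\<in>V - W. \<forall>x\<in>K. bracket x v \<in> W"
  using assms
proof (induction "dim K" arbitrary: K V W rule: less_induct)
  case less
  note sub = less.prems(1)[unfolded subalgebra_def]
  show ?case
  proof (cases "K = {0}")
    case True
    then show ?thesis using less.prems subspace_0 by auto
  next
    case False
    define P where "P M \<longleftrightarrow> subalgebra M \<and> M \<subset> K" for M
    have "P {0}" using False sub by (auto simp: P_def subalgebra_def subspace_0)
    from maximal_dim_exists[of P, OF this] obtain M where
      M: "P M" and max: "\<And>N. P N \<Longrightarrow> dim N \<le> dim M" by blast
    have Msub: "subspace M" "subalgebra M" "M \<subset> K" "\<And>x y. x \<in> M \<Longrightarrow> y \<in> M \<Longrightarrow> bracket x y \<in> M"
      using M by (auto simp: P_def subalgebra_def)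
    have d: "dim M < dim K" using Msub sub dim_psubset[of M K] by (metis span_eq_iff)
    have nM: "\<And>x. x \<in> M \<Longrightarrow> nilp (bracket x)" using less.prems(2) Msub by blast
    \<comment> \<open>The induction hypothesis for \<open>M\<close> acting on K/M yields an element
      normalizing \<open>M\<close>; by maximality, \<open>M\<close> and this element span
      \<open>K\<close>.\<close>
    have "\<exists>x\<in>K - M. \<forall>m\<in>M. bracket m x \<in> M"
      by (rule less.hyps[OF d Msub(2) nM]) (use Msub sub in auto)
    then obtain x where x: "x \<in> K" "x \<notin> M" "\<And>m. m \<in> M \<Longrightarrow> bracket m x \<in> M" by auto
    have xM: "bracket x m \<in> M" if "m \<in> M" for m
      using x(3)[OF that] bracket_anticommute[of x m] subspace_neg[OF Msub(1)] by simp
    let ?M = "span (insert x M)"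
    have dec: "\<exists>c m. m \<in> M \<and> y = m + scale c x" if y: "y \<in> ?M" for y
    proof -
      obtain c where "y - scale c x \<in> M"
        using y Msub(1) by (metis span_breakdown_eq span_eq_iff)
      then show ?thesis by (intro exI[of _ c] exI[of _ "y - scale c x"]) simp
    qed
    have "M \<subseteq> ?M" using span_superset[of "insert x M"] by auto
    have "subalgebra ?M" unfolding subalgebra_def
    proof (intro conjI ballI)
      fix y z assume "y \<in> ?M" "z \<in> ?M"
      then obtain c m c' m' where *: "m \<in> M" "y = m + scale c x" "m' \<in> M" "z = m' + scale c' x"
        using dec by metis
      have "bracket y z = bracket m m' + scale c' (bracket m x) + scale c (bracket x m')"
        unfolding * by (simp add: bracket_add_left bracket_add_right bracket_scale_left bracket_scale_right
            bracket_self algebra_simps)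
      also have "\<dots> \<in> M" using * Msub x xM by (intro subspace_add subspace_scale) auto
      finally show "bracket y z \<in> ?M" using \<open>M \<subseteq> ?M\<close> by blast
    qed simp
    moreover have "?M \<subseteq> K" using x Msub sub by (intro span_minimal) auto
    ultimately have "?M = K" using max[of ?M] dim_insert_less[OF Msub(1) x(2)]
      by (auto simp: P_def)
    \<comment> \<open>The vectors killed by \<open>M\<close> modulo \<open>W\<close> are stable
      under \<open>x\<close>, since \<open>x\<close> normalizes \<open>M\<close>. So the last power
      of \<open>x\<close> that keeps \<open>v\<close> outside \<open>W\<close> gives a vector killed
      by all of \<open>K\<close> modulo \<open>W\<close>.\<close>
    have "\<exists>v\<in>V - W. \<forall>m\<in>M. bracket m v \<in> W"
      by (rule less.hyps[OF d Msub(2) nM]) (use Msub less.prems in blast)+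
    then obtain v where v: "v \<in> V" "v \<notin> W" "\<And>m. m \<in> M \<Longrightarrow> bracket m v \<in> W" by auto
    let ?v = "\<lambda>n. (bracket x ^^ n) v"
    have vn: "?v n \<in> V" for n by (induction n) (use v x less.prems in auto)
    have Mv: "bracket m (?v n) \<in> W" if "m \<in> M" for m n using that
    proof (induction n arbitrary: m)
      case (Suc n)
      have "bracket m (?v (Suc n)) = bracket (bracket m x) (?v n) + bracket x (bracket m (?v n))"
        by (simp add: bracket_bracket)
      also have "\<dots> \<in> W" using Suc x less.prems by (intro subspace_add) auto
      finally show ?case .
    qed (use v in simp)
    obtain k where k: "?v k = 0" using less.prems(2)[OF x(1)] by (auto simp: nilp_def)
    define n where "n = (LEAST n. ?v n \<in> W)"
    have n: "?v n \<in> W" unfolding n_def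
      by (rule LeastI[of _ k]) (use k less.prems in \<open>simp add: subspace_0\<close>)
    then obtain p where p: "n = Suc p" using v(2) by (cases n) auto
    have "?v p \<notin> W" using not_less_Least[of p "\<lambda>n. ?v n \<in> W"] p n_def by auto
    moreover have "bracket y (?v p) \<in> W" if y: "y \<in> K" for y
    proof -
      obtain c m where "m \<in> M" "y = m + scale c x" using dec[of y] y \<open>?M = K\<close> by blast
      then show ?thesis using Mv[of m p] n p less.prems(4)
        by (simp add: bracket_add_left bracket_scale_left subspace_add subspace_scale)
    qed
    ultimately show ?thesis using vn[of p] by auto
  qed
qed

text \<open>Take an \<open>I\<close>-stable proper subspace \<open>W\<close> of largest dimension.
  Engel's theorem on I/W gives a vector that together with \<open>W\<close> spans a stable space,
  hence \<open>I\<close>; so all brackets fall into \<open>W\<close>.\<close>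

lemma nilpotent_not_perfect:
  assumes I: "subalgebra I" "\<And>x. x \<in> I \<Longrightarrow> nilp (bracket x)" "I \<noteq> {0}"
  shows "span {bracket x y |x y. x \<in> I \<and> y \<in> I} \<noteq> I"
proof -
  note sub = I(1)[unfolded subalgebra_def]
  define P where "P W \<longleftrightarrow> subspace W \<and> W \<subset> I \<and> (\<forall>x\<in>I. \<forall>w\<in>W. bracket x w \<in> W)" for W
  have "P {0}" using sub I(3) by (auto simp: P_def subspace_0)
  from maximal_dim_exists[of P, OF this] obtain W where
    W: "P W" and max: "\<And>N. P N \<Longrightarrow> dim N \<le> dim W" by blast
  have Wsub: "subspace W" "W \<subset> I" "\<And>x w. x \<in> I \<Longrightarrow> w \<in> W \<Longrightarrow> bracket x w \<in> W"
    using W by (auto simp: P_def)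
  have "\<exists>v\<in>I - W. \<forall>x\<in>I. bracket x v \<in> W"
    by (rule engel[OF I(1,2)]) (use Wsub sub in auto)
  then obtain v where v: "v \<in> I" "v \<notin> W" "\<And>x. x \<in> I \<Longrightarrow> bracket x v \<in> W" by auto
  let ?W = "span (insert v W)"
  have br: "bracket x y \<in> W" if x: "x \<in> I" and y: "y \<in> ?W" for x y
  proof -
    obtain c where "y - scale c v \<in> W"
      using y Wsub(1) by (metis span_breakdown_eq span_eq_iff)
    then have "bracket x (y - scale c v) + scale c (bracket x v) \<in> W"
      using Wsub x v by (intro subspace_add subspace_scale) auto
    then show ?thesis by (simp add: bracket_diff bracket_scale_right)
  qed
  have "W \<subseteq> ?W" using span_superset[of "insert v W"] by auto
  moreover have "?W \<subseteq> I" using v Wsub sub by (intro span_minimal) auto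
  ultimately have "?W = I"
    using max[of ?W] dim_insert_less[OF Wsub(1) v(2)] br by (auto simp: P_def)
  then have "span {bracket x y |x y. x \<in> I \<and> y \<in> I} \<subseteq> W"
    using br Wsub(1) by (intro span_minimal) auto
  then show ?thesis using Wsub by auto
qed

subsection \<open>The Killing form and Cartan's criterion\<close>

definition killing :: "'l \<Rightarrow> 'l \<Rightarrow> 'k" where
  "killing x y = tr (\<lambda>z. bracket x (bracket y z))"

lemma killing_add: "killing (x + y) z = killing x z + killing y z"
    "killing z (x + y) = killing z x + killing z y"
  by (simp_all add: killing_def bracket_add_left bracket_add_right tr_add)

lemma killing_diff: "killing (x - y) z = killing x z - killing y z"
    "killing z (x - y) = killing z x - killing z y"
  by (simp_all add: killing_def bracket_diff tr_diff)

lemma killing_scale: "killing (scale c x) z = c * killing x z"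
    "killing z (scale c x) = c * killing z x"
  by (simp_all add: killing_def bracket_scale_left bracket_scale_right tr_scale)

lemma killing_0 [simp]: "killing 0 z = 0" "killing z 0 = 0"
  by (simp_all add: killing_def tr_zero)

lemma killing_sum: "killing (sum f S) z = (\<Sum>i\<in>S. killing (f i) z)"
    "killing z (sum f S) = (\<Sum>i\<in>S. killing z (f i))"
  by (induction S rule: infinite_finite_induct) (simp_all add: killing_add)

lemma killing_commute: "killing x y = killing y x"
  unfolding killing_def by (rule tr_comm[OF lin_bracket lin_bracket])

lemma killing_bracket: "killing (bracket x y) z = killing x (bracket y z)"
  using tr_comm[OF lin_bracket[of y] lin_comp[OF lin_bracket[of x] lin_bracket[of z]]]
  by (simp add: killing_def bracket_bracket bracket_diff tr_diff)

lemma killing_automorphism: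
  assumes f: "lin f" "bij f" "\<And>x y. f (bracket x y) = bracket (f x) (f y)"
  shows "killing (f x) (f y) = killing x y"
proof -
  define f' where "f' = inv_into UNIV f"
  have inv: "f' (f z) = z" "f (f' z) = z" for z
    using f(2) by (simp_all add: f'_def bij_is_inj bij_is_surj surj_f_inv_f)
  have li: "lin (f')" unfolding lin_iff
    by (metis inv lin_add[OF f(1)] lin_scale[OF f(1)])
  have "killing (f x) (f y) = tr (\<lambda>z. f (bracket x (bracket y (f' z))))"
    unfolding killing_def by (rule tr_cong) (simp add: f(3) inv)
  also have "\<dots> = tr (\<lambda>z. bracket x (bracket y (f' (f z))))"
    by (rule tr_comm[OF f(1) lin_comp[OF lin_bracket lin_comp[OF lin_bracket li]]])
  finally show ?thesis by (simp add: inv killing_def)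
qed

text \<open>The shifts satisfy the Leibniz rule (D - a - b)[x, y] = [(D - a)x, y] + [x, (D - b)y].
  Among p + q factors, at least p hit \<open>x\<close> or at least q hit \<open>y\<close>.\<close>

lemma gen_eigenspace_derivation:
  assumes D: "derivation D" and x: "x \<in> gen_eigenspace D a" and y: "y \<in> gen_eigenspace D b"
  shows "bracket x y \<in> gen_eigenspace D (a + b)"
proof -
  have L: "lin D" using D by (simp add: derivation_def)
  have sh: "shift D (a + b) (bracket x y) = bracket (shift D a x) y + bracket x (shift D b y)" for x y
    using D by (simp add: derivation_def shift_def bracket_diff bracket_scale_left bracket_scale_right
        scale_left_distrib algebra_simps)
  have "(shift D (a + b) ^^ (p + q)) (bracket x y) = 0"
    if "(shift D a ^^ p) x = 0" "(shift D b ^^ q) y = 0" for p q x y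
    using that
  proof (induction "p + q" arbitrary: p q x y)
    case 0
    then show ?case by simp
  next
    case (Suc n)
    note Lf = lin_funpow[OF lin_shift[OF L]]
    show ?case
    proof (cases "p = 0 \<or> q = 0")
      case True
      then have "bracket x y = 0" using Suc.prems by auto
      then show ?thesis by (simp add: lin_0[OF Lf])
    next
      case False
      then obtain p' q' where pq: "p = Suc p'" "q = Suc q'" by (metis nat.exhaust)
      have 1: "(shift D (a + b) ^^ n) (bracket (shift D a x) y) = 0"
        using Suc.hyps(1)[of p' q "shift D a x" y] Suc.hyps(2) Suc.prems pq by (simp add: funpow_swap1)
      have 2: "(shift D (a + b) ^^ n) (bracket x (shift D b y)) = 0"
        using Suc.hyps(1)[of p q' x "shift D b y"] Suc.hyps(2) Suc.prems pq by (simp add: funpow_swap1)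
      have "(shift D (a + b) ^^ Suc n) (bracket x y) = 0"
        using 1 2 by (simp only: funpow_Suc_right comp_apply sh lin_add[OF Lf]) simp
      then show ?thesis using Suc.hyps(2) by simp
    qed
  qed
  then show ?thesis using x y unfolding gen_eigenspace_def by blast
qed

lemma bracket_eqI:
  assumes ds: "direct_sum_of K V" and "lin D" "lin E" "lin F"
    and "\<And>i j x y. i \<in> K \<Longrightarrow> j \<in> K \<Longrightarrow> x \<in> V i \<Longrightarrow> y \<in> V j \<Longrightarrow> D (bracket x y) = bracket (E x) y + bracket x (F y)"
  shows "D (bracket x y) = bracket (E x) y + bracket x (F y)"
proof -
  have *: "D (bracket x y) = bracket (E x) y + bracket x (F y)" if "j \<in> K" "y \<in> V j" for j x y
    by (rule direct_sum_eqI[OF ds lin_comp[OF assms(2) lin_bracket_left]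
          lin_plus[OF lin_comp[OF lin_bracket_left assms(3)] lin_bracket_left]])
       (rule assms(5)[OF _ that(1) _ that(2)])
  show ?thesis
    by (rule direct_sum_eqI[OF ds lin_comp[OF assms(2) lin_bracket]
          lin_plus[OF lin_bracket lin_comp[OF lin_bracket assms(4)]]]) (rule *)
qed

text \<open>Eigenvalues add under the bracket, so an additive function of them is again a
  derivation. The identity gives the semisimple part; a functional over the rationals gives the test
  map of Cartan's criterion.\<close>

lemma derivation_spectral_map:
  assumes D: "derivation D" and f: "\<And>a b. f (a + b) = f a + f b"
  shows "derivation (spectral_map f D)"
proof -
  have L: "lin D" using D by (simp add: derivation_def)
  have "spectral_map f D (bracket x y) = bracket (spectral_map f D x) y + bracket x (spectral_map f D y)" for x y
    by (rule bracket_eqI[OF direct_sum_spectrum[OF L]])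
       (use D in \<open>simp_all add: lin_spectral_map[OF L] spectral_map_eq[OF L gen_eigenspace_derivation[OF D]]
          spectral_map_eq[OF L] f bracket_scale_left bracket_scale_right scale_left_distrib\<close>)
  then show ?thesis using lin_spectral_map[OF L] by (simp add: derivation_def)
qed

text \<open>The field is regarded as a vector space over the rationals. Such functionals do in
  Cartan's criterion what conjugation does over the complex numbers: they turn a trace into a sum of
  squares.\<close>

lemma rational_functional_exists:
  fixes a :: 'k
  assumes "a \<noteq> 0"
  shows "\<exists>g :: 'k \<Rightarrow> rat. (\<forall>x y. g (x + y) = g x + g y) \<and> (\<forall>q x. g (of_rat q * x) = q * g x) \<and> g a = 1"
proof -
  interpret q: vector_space_pair "\<lambda>(q::rat) (x::'k). of_rat q * x" "(*) :: rat \<Rightarrow> rat \<Rightarrow> rat"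
    by unfold_locales (auto simp: algebra_simps of_rat_add of_rat_mult)
  have "q.vs1.independent {a}" using assms by simp
  from q.linear_independent_extend[OF this, of "\<lambda>_. 1"]
  obtain g where "Vector_Spaces.linear (\<lambda>(q::rat) (x::'k). of_rat q * x) (*) g" "g a = 1" by auto
  then show ?thesis by (intro exI[of _ g]) (auto simp: Vector_Spaces.linear_iff)
qed

lemma rational_functional_sum:
  assumes "\<And>x y. g (x + y) = g x + (g y :: rat)" "\<And>q x. g (of_rat q * x) = q * g x"
  shows "g (\<Sum>i\<in>S. of_rat (q i) * h i) = (\<Sum>i\<in>S. q i * g (h i))"
proof -
  have "g 0 = 0" using assms(2)[of 0 0] by simp
  then show ?thesis using assms by (induction S rule: infinite_finite_induct) auto
qed

lemma funpow_comp_commute: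
  assumes "\<And>x. f (g x) = g (f x)"
  shows "((\<lambda>x. f (g x)) ^^ n) x = (f ^^ n) ((g ^^ n) x)"
proof (induction n)
  case (Suc n)
  then show ?case using funpow_commute[of g f n "(g ^^ n) x"] funpow_commute[of f g n] assms by simp
qed simp

lemma tr_commuting_nilp:
  assumes "lin A" "lin B" "nilp B" "\<And>x. A (B x) = B (A x)"
  shows "tr (\<lambda>x. A (B x)) = 0"
proof (rule tr_nilp)
  show "lin (\<lambda>x. A (B x))" by (rule lin_comp[OF assms(1,2)])
  show "nilp (\<lambda>x. A (B x))" using assms(3) unfolding nilp_def
    by (simp add: funpow_comp_commute[of A B, OF assms(4)]) (metis lin_0[OF lin_funpow[OF assms(1)]])
qed

text \<open>Cartan's criterion. For a nonzero eigenvalue \<open>a\<close> choose a rational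
  functional \<open>g\<close> with g(a) = 1 and let \<psi> act by g(b) on the generalized eigenspace
  of \<open>b\<close>. The trace of \<psi> composed with ad x vanishes, and applying
  \<open>g\<close> to it yields the sum of g(b)^2 times dimensions, so the space at \<open>a\<close>
  has dimension 0.\<close>

lemma nilp_of_killing_zero:
  assumes S: "\<And>y z. y \<in> S \<Longrightarrow> killing z y = 0"
    and x: "x \<in> span {bracket y z |y z. y \<in> S \<and> z \<in> S}"
  shows "nilp (bracket x)"
proof -
  let ?D = "bracket x"
  have L: "lin ?D" by (rule lin_bracket)
  have "gen_eigenspace ?D a = {0}" if "a \<noteq> 0" for a :: 'k
  proof (rule ccontr)
    assume ne: "gen_eigenspace ?D a \<noteq> {0}"
    then have a: "a \<in> spectrum ?D" using gen_eigenspace_not_spectrum[OF L] by blast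
    obtain g :: "'k \<Rightarrow> rat" where g: "\<And>x y. g (x + y) = g x + g y" "\<And>q x. g (of_rat q * x) = q * g x" "g a = 1"
      using rational_functional_exists[OF \<open>a \<noteq> 0\<close>] by blast
    define f where "f x = (of_rat (g x) :: 'k)" for x
    define \<psi> where "\<psi> = spectral_map f ?D"
    have der: "derivation \<psi>" unfolding \<psi>_def
      by (rule derivation_spectral_map[OF derivation_bracket]) (simp add: f_def g of_rat_add)
    then have L\<psi>: "lin \<psi>" by (simp add: derivation_def)
    \<comment> \<open>As \<psi> is a derivation, for w = [y, z] cyclicity reduces this trace to
      \<open>killing (\<psi> y) z\<close>, which is zero because \<open>z\<close> is in
      \<open>S\<close>.\<close>
    have "tr (\<lambda>z. \<psi> (bracket w z)) = 0" if "w \<in> span {bracket y z |y z. y \<in> S \<and> z \<in> S}" for w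
      using that
    proof (induction rule: span_induct_alt)
      case base
      then show ?case by (simp add: lin_0[OF L\<psi>] tr_zero)
    next
      case (step c w w')
      then obtain y z where yz: "y \<in> S" "z \<in> S" "w = bracket y z" by auto
      have "tr (\<lambda>u. \<psi> (bracket w u)) =
          tr (\<lambda>u. \<psi> (bracket y (bracket z u))) - tr (\<lambda>u. \<psi> (bracket z (bracket y u)))"
        by (simp add: yz bracket_bracket lin_diff[OF L\<psi>] tr_diff)
      also have "tr (\<lambda>u. \<psi> (bracket y (bracket z u))) =
          killing (\<psi> y) z + tr (\<lambda>u. bracket y (\<psi> (bracket z u)))"
        using der unfolding killing_def tr_add[symmetric] by (simp add: derivation_def)
      also have "tr (\<lambda>u. bracket y (\<psi> (bracket z u))) = tr (\<lambda>u. \<psi> (bracket z (bracket y u)))"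
        by (rule tr_comm[OF lin_bracket lin_comp[OF L\<psi> lin_bracket]])
      finally have "tr (\<lambda>u. \<psi> (bracket w u)) = 0" using S yz by simp
      then show ?case using step
        by (simp add: bracket_add_left bracket_scale_left lin_add[OF L\<psi>] lin_scale[OF L\<psi>] tr_add tr_scale)
    qed
    from this[OF x] have "0 = tr (\<lambda>z. \<psi> (?D z))" ..
    also have "\<dots> = tr (\<lambda>z. \<psi> (spectral_map (\<lambda>a. a) ?D z)) + tr (\<lambda>z. \<psi> (?D z - spectral_map (\<lambda>a. a) ?D z))"
      unfolding tr_add[symmetric] by (simp add: lin_diff[OF L\<psi>])
    \<comment> \<open>The nilpotent part commutes with \<psi>, so it contributes nothing; only the
      semisimple part, diagonal together with \<psi>, remains.\<close>
    also have "tr (\<lambda>z. \<psi> (?D z - spectral_map (\<lambda>a. a) ?D z)) = 0"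
    proof (rule tr_commuting_nilp[OF L\<psi> _ nilp_minus_spectral_map[OF L]])
      show "lin (\<lambda>z. ?D z - spectral_map (\<lambda>a. a) ?D z)" by (intro lin_minus L lin_spectral_map)
      have c: "\<psi> (?D z) = ?D (\<psi> z)" for z
        unfolding \<psi>_def by (rule spectral_map_commute[OF L L]) simp
      have "spectral_map (\<lambda>a. a) ?D (\<psi> z) = \<psi> (spectral_map (\<lambda>a. a) ?D z)" for z
        by (rule spectral_map_commute[OF L L\<psi>]) (simp add: c)
      then show "\<psi> (?D z - spectral_map (\<lambda>a. a) ?D z) = ?D (\<psi> z) - spectral_map (\<lambda>a. a) ?D (\<psi> z)" for z
        by (simp add: lin_diff[OF L\<psi>] c)
    qed
    also have "tr (\<lambda>z. \<psi> (spectral_map (\<lambda>a. a) ?D z)) = tr (spectral_map (\<lambda>a. f a * a) ?D)"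
    proof (rule tr_cong)
      show "\<psi> (spectral_map (\<lambda>a. a) ?D z) = spectral_map (\<lambda>a. f a * a) ?D z" for z
        unfolding \<psi>_def
        by (rule direct_sum_eqI[OF direct_sum_spectrum[OF L]])
           (auto simp: spectral_map_eq[OF L] lin_scale[OF lin_spectral_map[OF L]] mult.commute
              intro: lin_spectral_map[OF L] lin_comp[OF lin_spectral_map[OF L] lin_spectral_map[OF L]])
    qed
    also have "\<dots> = (\<Sum>b\<in>spectrum ?D. f b * b * of_nat (dim (gen_eigenspace ?D b)))"
      unfolding spectral_map_def by (rule tr_diagonal_map[OF direct_sum_spectrum[OF L]])
    \<comment> \<open>Written as a rational combination of the eigenvalues, so that \<open>g\<close>
      can be applied termwise.\<close>
    also have "\<dots> = (\<Sum>b\<in>spectrum ?D. of_rat (g b * of_nat (dim (gen_eigenspace ?D b))) * b)"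
      by (rule sum.cong) (auto simp: f_def of_rat_mult)
    finally have "g 0 = g (\<Sum>b\<in>spectrum ?D. of_rat (g b * of_nat (dim (gen_eigenspace ?D b))) * b)" by simp
    moreover have "g 0 = 0" using g(2)[of 0 0] by simp
    ultimately have "(\<Sum>b\<in>spectrum ?D. g b * of_nat (dim (gen_eigenspace ?D b)) * g b) = 0"
      using rational_functional_sum[OF g(1,2), of "\<lambda>b. g b * of_nat (dim (gen_eigenspace ?D b))" "\<lambda>b. b" "spectrum ?D"]
      by simp
    then have "\<forall>b\<in>spectrum ?D. g b * of_nat (dim (gen_eigenspace ?D b)) * g b = 0"
      using direct_sum_ofD(1)[OF direct_sum_spectrum[OF L]]
      by (subst (asm) sum_nonneg_eq_0_iff) (auto simp: mult.commute[of _ "of_nat _"] mult.assoc)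
    then have "dim (gen_eigenspace ?D a) = 0" using a g(3) by auto
    then show False using ne subspace_0[OF subspace_gen_eigenspace[OF L]] by auto
  qed
  then have "(\<Union>a. gen_eigenspace ?D a) \<subseteq> gen_eigenspace ?D 0"
    using subspace_0[OF subspace_gen_eigenspace[OF L]] by (metis UN_least empty_subsetI insert_subset order_refl)
  then have "span (\<Union>a. gen_eigenspace ?D a) \<subseteq> gen_eigenspace ?D 0"
    by (rule span_minimal) (rule subspace_gen_eigenspace[OF L])
  then have "UNIV \<subseteq> gen_eigenspace ?D 0" using span_gen_eigenspaces[OF L] by simp
  moreover have "shift ?D 0 = ?D" by (simp add: shift_def fun_eq_iff)
  ultimately show ?thesis by (intro nilpI L) (auto simp: gen_eigenspace_def)
qed

lemma lie_ideal_derived: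
  assumes "lie_ideal I"
  shows "lie_ideal (span {bracket x y |x y. x \<in> I \<and> y \<in> I})"
proof -
  let ?J = "span {bracket x y |x y. x \<in> I \<and> y \<in> I}"
  have "bracket z w \<in> ?J" if "w \<in> ?J" for z w using that
  proof (induction rule: span_induct_alt)
    case (step c w w')
    then obtain x y where xy: "x \<in> I" "y \<in> I" "w = bracket x y" by auto
    have "bracket z w = bracket (bracket z x) y + bracket x (bracket z y)"
      by (simp add: xy bracket_bracket)
    also have "\<dots> \<in> ?J" using xy assms by (intro span_add span_base) (auto simp: lie_ideal_def)
    finally show ?case using step by (simp add: bracket_add_right bracket_scale_right span_add span_scale)
  qed (simp add: span_zero)
  then show ?thesis by (simp add: lie_ideal_def)
qed

text \<open>A nonzero ideal of least dimension inside the radical equals its derived ideal, as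
  otherwise it would be solvable. By Cartan's criterion its elements are ad-nilpotent, and a nonzero
  algebra of such elements is not perfect.\<close>

lemma killing_nondegenerate:
  assumes ss: semisimple and x: "\<And>y. killing x y = 0"
  shows "x = 0"
proof (rule ccontr)
  assume "x \<noteq> 0"
  define S where "S = {x. \<forall>y. killing x y = 0}"
  have S: "lie_ideal S" unfolding lie_ideal_def
  proof (intro conjI allI ballI)
    show "subspace S" by (rule subspaceI) (auto simp: S_def killing_add killing_scale)
    show "bracket z y \<in> S" if "y \<in> S" for z y
      using that killing_bracket bracket_anticommute[of z y]
      by (simp add: S_def) (metis killing_bracket killing_commute)
  qed
  have "S \<noteq> {0}" using x \<open>x \<noteq> 0\<close> by (auto simp: S_def)
  define P where "P n \<longleftrightarrow> (\<exists>I. lie_ideal I \<and> I \<subseteq> S \<and> I \<noteq> {0} \<and> dim I = n)" for n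
  have "\<exists>n. P n" using S \<open>S \<noteq> {0}\<close> unfolding P_def by blast
  then obtain I where I: "lie_ideal I" "I \<subseteq> S" "I \<noteq> {0}" "dim I = (LEAST n. P n)"
    using LeastI_ex[of P] unfolding P_def by blast
  have Isub: "subspace I" "subalgebra I" using I(1) by (auto simp: lie_ideal_def subalgebra_def)
  let ?J = "span {bracket x y |x y. x \<in> I \<and> y \<in> I}"
  have J: "lie_ideal ?J" using I(1) by (rule lie_ideal_derived)
  have JI: "?J \<subseteq> I" using Isub by (intro span_minimal) (auto simp: subalgebra_def)
  have "?J \<noteq> {0}"
  proof
    assume "?J = {0}"
    then have "derived_series I 1 = {0}" by simp
    then have "solvable I" unfolding solvable_def by blast
    then show False using ss I by (auto simp: semisimple_def)
  qed
  then have "P (dim ?J)" using J JI I(2) unfolding P_def by blast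
  then have "dim I \<le> dim ?J" unfolding I(4) by (rule Least_le)
  then have JI': "?J = I" using JI Isub by (intro subspace_dim_equal) auto
  have "nilp (bracket y)" if "y \<in> I" for y
    by (rule nilp_of_killing_zero[of I]) (use that JI' I(2) killing_commute S_def in auto)
  then show False using nilpotent_not_perfect[OF Isub(2) _ I(3)] JI' by blast
qed

subsection \<open>Derivations are inner\<close>

lemma center_zero:
  assumes semisimple "\<And>y. bracket x y = 0"
  shows "x = 0"
  by (rule killing_nondegenerate[OF assms(1)]) (simp add: killing_def assms(2) tr_zero)

text \<open>Nondegeneracy gives \<open>z\<close> for which E = D - ad z satisfies tr(E ad x) = 0 for
  all \<open>x\<close>. But \<open>killing (E x) y\<close> equals tr(E ad [x, y]), so
  \<open>E\<close> vanishes.\<close>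

lemma derivation_inner:
  assumes ss: semisimple and D: "derivation D"
  shows "\<exists>z. D = bracket z"
proof -
  have L: "lin D" using D by (simp add: derivation_def)
  \<comment> \<open>The Killing form as an endomorphism: the coordinates of \<open>F z\<close> are
    the values of the form of \<open>z\<close> on the basis. Injectivity of \<open>F\<close> then
    gives surjectivity by dimension.\<close>
  define F where "F z = (\<Sum>b\<in>Basis. scale (killing z b) b)" for z
  have LF: "lin F" by (simp add: lin_iff F_def killing_add killing_scale scale_left_distrib sum.distrib scale_sum_right)
  have coord: "c b = d b" if "b \<in> Basis" "(\<Sum>b\<in>Basis. scale (c b) b) = (\<Sum>b\<in>Basis. scale (d b) b)" for c d b
  proof -
    have "(\<Sum>b\<in>Basis. scale (c b - d b) b) = 0"
      using that by (simp add: scale_left_diff_distrib sum_subtractf)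
    then show ?thesis using independentD[OF independent_Basis finite_Basis order_refl] that by fastforce
  qed
  have kb: "x = y" if "\<And>b. b \<in> Basis \<Longrightarrow> killing x b = killing y b" for x y
  proof -
    have "killing (x - y) w = 0" for w
    proof -
      have "w \<in> span Basis" by (simp add: span_Basis)
      then show ?thesis
        by (induction rule: span_induct_alt) (auto simp: killing_add killing_scale killing_diff that)
    qed
    then have "x - y = 0" by (rule killing_nondegenerate[OF ss])
    then show ?thesis by simp
  qed
  have "inj F" by (intro injI kb) (auto simp: F_def intro: coord)
  then have "surj F" using linear_inj_imp_surj[of F] LF by auto
  then obtain z where z: "F z = (\<Sum>b\<in>Basis. scale (tr (\<lambda>w. D (bracket b w))) b)" by (metis surjD)
  define E where "E x = D x - bracket z x" for x
  have E: "derivation E" unfolding E_def using D derivation_bracket by (intro derivation_diff)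
  then have LE: "lin E" by (simp add: derivation_def)
  have kE: "tr (\<lambda>w. E (bracket x w)) = 0" for x
  proof -
    have "x \<in> span Basis" by (simp add: span_Basis)
    then show ?thesis
    proof (induction rule: span_induct_alt)
      case (step c b y)
      have "killing z b = tr (\<lambda>w. D (bracket b w))"
        using coord[OF step(1)] z by (simp add: F_def)
      then have "tr (\<lambda>w. E (bracket b w)) = 0" by (simp add: E_def tr_diff killing_def)
      then show ?case using step
        by (simp add: bracket_add_left bracket_scale_left lin_add[OF LE] lin_scale[OF LE] tr_add tr_scale)
    qed (simp add: lin_0[OF LE] tr_zero)
  qed
  have "E x = 0" for x
  proof (rule killing_nondegenerate[OF ss])
    fix y
    have "killing (E x) y = tr (\<lambda>w. E (bracket x (bracket y w))) - tr (\<lambda>w. bracket x (E (bracket y w)))"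
      using E unfolding killing_def tr_diff[symmetric] by (simp add: derivation_def)
    also have "tr (\<lambda>w. bracket x (E (bracket y w))) = tr (\<lambda>w. E (bracket y (bracket x w)))"
      by (rule tr_comm[OF lin_bracket lin_comp[OF LE lin_bracket]])
    also have "tr (\<lambda>w. E (bracket x (bracket y w))) - \<dots> = tr (\<lambda>w. E (bracket (bracket x y) w))"
      by (simp add: bracket_bracket lin_diff[OF LE] tr_diff)
    finally show "killing (E x) y = 0" by (simp add: kE)
  qed
  then show ?thesis by (intro exI[of _ z]) (auto simp: E_def fun_eq_iff)
qed

end

section \<open>Tori\<close>

subsection \<open>Lattices\<close>

text \<open>
  A generating set of least size has no relation: otherwise a relation with smallest sum of absolute
  values of its coefficients could be made smaller by a Euclidean step, or would involve a single
  generator, which would then vanish.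
\<close>

lemma lattice_basis:
  fixes sc :: "int \<Rightarrow> 'v::ab_group_add \<Rightarrow> 'v"
  assumes "Modules.module sc" and tf: "\<And>k v. sc k v = 0 \<Longrightarrow> k = 0 \<or> v = 0" and "finite W"
  shows "\<exists>B. finite B \<and> \<not> module.dependent sc B \<and> module.span sc B = module.span sc W"
proof -
  interpret Modules.module sc by fact
  define P where "P n \<longleftrightarrow> (\<exists>B. finite B \<and> span B = span W \<and> card B = n)" for n
  define n where "n = (LEAST n. P n)"
  have "P (card W)" using assms(3) by (auto simp: P_def)
  then have Pn: "P n" unfolding n_def by (rule LeastI)
  have least: "n \<le> card B" if "finite B" "span B = span W" for B
    unfolding n_def by (rule Least_le) (use that in \<open>auto simp: P_def\<close>)
  have key: "\<forall>b\<in>B. e b = 0"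
    if "finite B" "span B = span W" "card B = n" "(\<Sum>b\<in>B. sc (e b) b) = 0" for B e
    using that
  proof (induction "\<Sum>b\<in>B. nat \<bar>e b\<bar>" arbitrary: B e rule: less_induct)
    case less
    show ?case
    proof (rule ccontr)
      assume "\<not> ?thesis"
      then obtain b0 where b0: "b0 \<in> B" "e b0 \<noteq> 0" by auto
      show False
      proof (cases "\<exists>b1\<in>B. b1 \<noteq> b0 \<and> e b1 \<noteq> 0")
        case True
        then obtain b b' where b: "b \<in> B" "b' \<in> B" "b \<noteq> b'" "e b \<noteq> 0" "e b' \<noteq> 0" "\<bar>e b'\<bar> \<le> \<bar>e b\<bar>"
          using b0 by (metis linear)
        define R where "R = B - {b, b'}"
        have B: "B = insert b (insert b' R)" "b \<notin> R" "b' \<notin> R" "finite R"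
          using b less.prems(1) by (auto simp: R_def)
        \<comment> \<open>With this sign, e(b) - s e(b') has absolute value |e(b)| - |e(b')|.
          Replacing b' by b' + s b compensates for the change in the relation and keeps the
          span.\<close>
        define s where "s = sgn (e b) * sgn (e b')"
        define b2 where "b2 = b' + sc s b"
        let ?B = "insert b2 (insert b R)"
        have b'2: "b' = b2 - sc s b" by (simp add: b2_def)
        have bs: "b \<in> span ?B" "b2 \<in> span ?B" by (auto intro: span_base)
        have "b' \<in> span ?B" unfolding b'2 by (intro span_diff span_scale bs)
        then have 1: "B \<subseteq> span ?B" unfolding B(1) using bs by (auto intro: span_base)
        have "b \<in> span B" "b' \<in> span B" using b by (auto intro: span_base)
        then have "b2 \<in> span B" unfolding b2_def by (intro span_add span_scale)
        then have 2: "?B \<subseteq> span B" using B(1) by (auto intro: span_base)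
        have sp: "span ?B = span W" using 1 2 less.prems(2) span_eq by metis
        have "n \<le> card ?B" using B(4) sp by (intro least) auto
        moreover have "card B = Suc (Suc (card R))" using B b(3) by (subst B(1)) auto
        ultimately have cd: "card ?B = n" "b2 \<notin> insert b R"
          using less.prems(3) B card_insert_if[of "insert b R" b2] by (auto split: if_splits)
        define e' where "e' v = (if v = b2 then e b' else if v = b then e b - s * e b' else e v)" for v
        have e'R: "e' v = e v" if "v \<in> R" for v using that cd(2) B(2) by (auto simp: e'_def)
        have e'b: "e' b = e b - s * e b'" "e' b2 = e b'" using cd(2) by (auto simp: e'_def)
        have "(\<Sum>v\<in>?B. sc (e' v) v) = sc (e b') b2 + (sc (e b - s * e b') b + (\<Sum>v\<in>R. sc (e v) v))"
          using cd(2) B e'R e'b by simp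
        also have "\<dots> = (\<Sum>v\<in>B. sc (e v) v)"
          using B b(3) by (simp add: b2_def scale_right_distrib scale_left_diff_distrib mult.commute add_ac)
        finally have s0: "(\<Sum>v\<in>?B. sc (e' v) v) = 0" using less.prems(4) by simp
        have "\<bar>e b - s * e b'\<bar> < \<bar>e b\<bar>"
          using b by (auto simp: s_def sgn_if abs_if split: if_splits)
        then have "(\<Sum>v\<in>?B. nat \<bar>e' v\<bar>) < (\<Sum>v\<in>B. nat \<bar>e v\<bar>)"
          using cd(2) B b(3) e'R e'b by simp
        from less.hyps[OF this _ sp cd(1) s0] have "e' b2 = 0" using B(4) by blast
        then show False using e'b b by simp
      next
        case False
        have "(\<Sum>b\<in>B. sc (e b) b) = (\<Sum>b\<in>B. if b = b0 then sc (e b0) b0 else 0)"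
          by (rule sum.cong) (use False in auto)
        then have "b0 = 0" using less.prems tf[of "e b0" b0] b0 by simp
        have "span (B - {0}) = span W"
        proof -
          have "B \<subseteq> span (B - {0})"
            by (metis Diff_iff insertI1 singletonD span_base span_zero subsetI)
          then show ?thesis using less.prems(2) span_mono[of "B - {0}" B] span_minimal subspace_span
            by (metis Diff_subset antisym)
        qed
        then have "n \<le> card (B - {0})" using less.prems by (intro least) auto
        then show False using b0 \<open>b0 = 0\<close> less.prems by (metis card_Diff1_less leD)
      qed
    qed
  qed
  obtain B where B: "finite B" "span B = span W" "card B = n" using Pn by (auto simp: P_def)
  then have "\<not> dependent B" using key[OF B] by (auto simp: dependent_finite)
  then show ?thesis using B by blast
qed

subsection \<open>Characters of the split torus\<close>

definition tchar :: "nat \<Rightarrow> (nat \<Rightarrow> int) \<Rightarrow> (nat \<Rightarrow> 'k::field) \<Rightarrow> 'k" where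
  "tchar n m t = (\<Prod>i<n. t i powi m i)"

abbreviation torus_points :: "nat \<Rightarrow> (nat \<Rightarrow> 'k::field) set" where
  "torus_points n \<equiv> carrier (mult_torus n)"

definition exponents :: "nat \<Rightarrow> (nat \<Rightarrow> int) set" where
  "exponents n = {m. \<forall>i\<ge>n. m i = 0}"

lemma torus_points_iff: "t \<in> torus_points n \<longleftrightarrow> (\<forall>i<n. t i \<noteq> 0) \<and> (\<forall>i\<ge>n. t i = 1)"
  by (simp add: mult_torus_def)

lemma torus_points_mult: "s \<in> torus_points n \<Longrightarrow> t \<in> torus_points n \<Longrightarrow> (\<lambda>i. s i * t i) \<in> torus_points n"
  and torus_points_inverse: "t \<in> torus_points n \<Longrightarrow> (\<lambda>i. inverse (t i)) \<in> torus_points n"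
  and torus_points_one: "(\<lambda>i. 1) \<in> torus_points n"
  by (auto simp: torus_points_iff)

lemma mult_mult_torus: "s \<otimes>\<^bsub>mult_torus n\<^esub> t = (\<lambda>i. s i * t i)"
  and one_mult_torus: "\<one>\<^bsub>mult_torus n\<^esub> = (\<lambda>i. 1)"
  by (simp_all add: mult_torus_def)

lemma group_mult_torus: "group (mult_torus n)"
proof (rule groupI)
  fix x :: "nat \<Rightarrow> 'a" assume x: "x \<in> torus_points n"
  show "\<exists>y\<in>torus_points n. y \<otimes>\<^bsub>mult_torus n\<^esub> x = \<one>\<^bsub>mult_torus n\<^esub>"
    by (rule bexI[OF _ torus_points_inverse[OF x]])
       (use x in \<open>auto simp: mult_mult_torus one_mult_torus torus_points_iff fun_eq_iff not_less\<close>,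
        metis left_inverse linorder_not_less mult_1 inverse_1)
qed (auto simp: mult_mult_torus one_mult_torus torus_points_mult torus_points_one mult.assoc)

lemma tchar_mult: "tchar n m (\<lambda>i. s i * t i) = tchar n m s * tchar n m t"
  by (simp add: tchar_def power_int_mult_distrib prod.distrib)

lemma tchar_one [simp]: "tchar n m (\<lambda>i. 1) = 1"
  by (simp add: tchar_def)

lemma tchar_add:
  "t \<in> torus_points n \<Longrightarrow> tchar n (m + m') t = tchar n m t * tchar n m' t"
  unfolding tchar_def prod.distrib[symmetric] by (rule prod.cong) (auto simp: torus_points_iff power_int_add)

lemma tchar_0 [simp]: "tchar n 0 t = 1" "tchar n (\<lambda>i. 0) t = 1"
  by (simp_all add: tchar_def)

lemma tchar_nonzero: "t \<in> torus_points n \<Longrightarrow> tchar n m t \<noteq> 0"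
  by (simp add: tchar_def torus_points_iff)

lemma tchar_sum:
  assumes t: "t \<in> torus_points n"
  shows "tchar n (\<lambda>i. \<Sum>j\<in>S. c j * m j i) t = (\<Prod>j\<in>S. tchar n (m j) t powi c j)"
proof -
  have pw: "tchar n (\<lambda>i. c * m i) t = tchar n m t powi c" for c m
  proof -
    have "(\<Prod>i\<in>I. f i) powi c = (\<Prod>i\<in>I. f i powi c)" for I :: "nat set" and f :: "nat \<Rightarrow> 'a"
      by (induction I rule: infinite_finite_induct) (simp_all add: power_int_mult_distrib)
    then show ?thesis unfolding tchar_def by (simp add: power_int_mult mult.commute[of c])
  qed
  show ?thesis
  proof (induction S rule: infinite_finite_induct)
    case (insert x F)
    have "(\<lambda>i. \<Sum>j\<in>insert x F. c j * m j i) = (\<lambda>i. c x * m x i) + (\<lambda>i. \<Sum>j\<in>F. c j * m j i)"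
      using insert by (simp add: fun_eq_iff)
    then show ?case using insert by (simp add: tchar_add[OF t] pw)
  qed simp_all
qed

lemma power_int_2_inj:
  assumes "(2 :: 'k::field_char_0) powi a = 2 powi b"
  shows "a = b"
proof -
  have nat: "k = 0" if "(2::'k) ^ k = 1" for k
  proof -
    have "of_nat (2 ^ k) = (of_nat 1 :: 'k)" using that by simp
    then have "(2::nat) ^ k = 1" by (simp only: of_nat_eq_iff)
    then show ?thesis by simp
  qed
  have "(2::'k) powi (a - b) = 1" using assms by (simp add: power_int_diff)
  then have "a - b = 0"
  proof (cases "a - b" rule: int_cases2)
    case (nonneg k)
    then show ?thesis using \<open>2 powi (a - b) = 1\<close> nat[of k] by simp
  next
    case (nonpos k)
    then show ?thesis using \<open>2 powi (a - b) = 1\<close> nat[of k] by (simp add: power_int_minus)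
  qed
  then show ?thesis by simp
qed

lemma tchar_distinct:
  assumes "m \<in> exponents n" "m' \<in> exponents n" "m \<noteq> m'"
  shows "\<exists>t\<in>torus_points n. tchar n m t \<noteq> (tchar n m' t :: 'k::field_char_0)"
proof -
  obtain i where i: "m i \<noteq> m' i" using assms by auto
  then have "i < n" using assms by (auto simp: exponents_def not_less[symmetric])
  \<comment> \<open>In characteristic 0 the scalar 2 has infinite multiplicative order, so its
    powers reveal the exponent.\<close>
  let ?t = "\<lambda>j. if j = i then 2 else 1 :: 'k"
  have *: "tchar n m ?t = 2 powi m i" for m
  proof -
    have "tchar n m ?t = (\<Prod>j<n. if j = i then 2 powi m i else 1)"
      unfolding tchar_def by (rule prod.cong) auto
    then show ?thesis using \<open>i < n\<close> by simp
  qed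
  have "?t \<in> torus_points n" using \<open>i < n\<close> by (auto simp: torus_points_iff)
  then show ?thesis using i * power_int_2_inj by metis
qed

lemma mult_torus_regular_cases:
  "(\<lambda>t. c) \<in> mult_torus_regular n"
  "i < n \<Longrightarrow> (\<lambda>t. t i) \<in> mult_torus_regular n"
  "i < n \<Longrightarrow> (\<lambda>t. inverse (t i)) \<in> mult_torus_regular n"
  "r \<in> mult_torus_regular n \<Longrightarrow> s \<in> mult_torus_regular n \<Longrightarrow> (\<lambda>t. r t + s t) \<in> mult_torus_regular n"
  "r \<in> mult_torus_regular n \<Longrightarrow> s \<in> mult_torus_regular n \<Longrightarrow> (\<lambda>t. r t * s t) \<in> mult_torus_regular n"
  unfolding mult_torus_regular_def by (auto intro: function_algebra.intros)

lemma function_algebra_power: "r \<in> function_algebra S \<Longrightarrow> (\<lambda>t. r t ^ k) \<in> function_algebra S"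
proof (induction k)
  case (Suc k)
  then show ?case using function_algebra.mult[of r S "\<lambda>t. r t ^ k"] by simp
qed (simp add: function_algebra.const)

lemma function_algebra_prod:
  "(\<And>i. i \<in> I \<Longrightarrow> r i \<in> function_algebra S) \<Longrightarrow> (\<lambda>t. \<Prod>i\<in>I. r i t) \<in> function_algebra S"
  by (induction I rule: infinite_finite_induct)
     (auto simp: function_algebra.const intro: function_algebra.mult)

lemma function_algebra_sum:
  "(\<And>i. i \<in> I \<Longrightarrow> r i \<in> function_algebra S) \<Longrightarrow> (\<lambda>t. \<Sum>i\<in>I. r i t) \<in> function_algebra S"
  by (induction I rule: infinite_finite_induct)
     (auto simp: function_algebra.const intro: function_algebra.add)

lemma tchar_regular: "tchar n m \<in> mult_torus_regular n"
proof -
  have "(\<lambda>t. t i powi m i) \<in> mult_torus_regular n" if "i < n" for i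
  proof (cases "m i \<ge> 0")
    case True
    then show ?thesis using mult_torus_regular_cases(2)[OF that] function_algebra_power
      unfolding mult_torus_regular_def power_int_def by auto
  next
    case False
    then show ?thesis using mult_torus_regular_cases(3)[OF that] function_algebra_power
      unfolding mult_torus_regular_def power_int_def by auto
  qed
  then show ?thesis unfolding tchar_def[abs_def] mult_torus_regular_def
    by (intro function_algebra_prod) auto
qed

lemma mult_torus_regular_induct [consumes 1, case_names const coord inverse add mult]:
  assumes "r \<in> mult_torus_regular n"
    and "\<And>c. P (\<lambda>t. c)" "\<And>i. i < n \<Longrightarrow> P (\<lambda>t. t i)" "\<And>i. i < n \<Longrightarrow> P (\<lambda>t. inverse (t i))"
    and "\<And>r s. P r \<Longrightarrow> P s \<Longrightarrow> P (\<lambda>t. r t + s t)" "\<And>r s. P r \<Longrightarrow> P s \<Longrightarrow> P (\<lambda>t. r t * s t)"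
  shows "P r"
  using assms(1) unfolding mult_torus_regular_def
  by (induction rule: function_algebra.induct) (use assms(2-) in auto)

text \<open>Extension by zero turns equality of functions on the torus into equality of functions.\<close>

definition on_torus :: "nat \<Rightarrow> ((nat \<Rightarrow> 'k) \<Rightarrow> 'b) \<Rightarrow> (nat \<Rightarrow> 'k::field) \<Rightarrow> 'b::zero" where
  "on_torus n f t = (if t \<in> torus_points n then f t else 0)"

context endomorphisms
begin

text \<open>Dedekind's lemma: a character is an eigenvector of all translations, with itself as eigenvalue.\<close>

lemma characters_independent:
  fixes chr :: "'c \<Rightarrow> (nat \<Rightarrow> 'k::field) \<Rightarrow> 'a"
  assumes "finite M"
    and mult: "\<And>m s t. m \<in> M \<Longrightarrow> s \<in> torus_points n \<Longrightarrow> t \<in> torus_points n \<Longrightarrow> chr m (\<lambda>i. s i * t i) = chr m s * chr m t"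
    and one: "\<And>m. m \<in> M \<Longrightarrow> chr m (\<lambda>i. 1) = 1"
    and dist: "\<And>m m'. m \<in> M \<Longrightarrow> m' \<in> M \<Longrightarrow> m \<noteq> m' \<Longrightarrow> \<exists>t\<in>torus_points n. chr m t \<noteq> chr m' t"
    and zero: "\<And>t. t \<in> torus_points n \<Longrightarrow> (\<Sum>m\<in>M. scale (chr m t) (v m)) = 0"
  shows "\<forall>m\<in>M. v m = 0"
proof -
  interpret f: endomorphisms "\<lambda>c f t. scale c (f t) :: 'b" 
    by unfold_locales (auto simp: fun_eq_iff scale_right_distrib scale_left_distrib)
  define w where "w m = on_torus n (\<lambda>t. scale (chr m t) (v m))" for m
  have unit: "(\<lambda>i. s i * t i) \<in> torus_points n \<longleftrightarrow> t \<in> torus_points n" if "s \<in> torus_points n" for s t :: "nat \<Rightarrow> 'k"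
    using that by (auto simp: torus_points_iff)
  have "\<forall>m\<in>M. w m = 0"
  proof (rule f.eigenvector_sum_zero[of M "torus_points n" "\<lambda>s f t. f (\<lambda>i. s i * t i)" w chr])
    show "f.lin (\<lambda>f t. f (\<lambda>i. s i * t i))" for s by (simp add: f.lin_iff fun_eq_iff)
    show "(\<lambda>t. w m (\<lambda>i. s i * t i)) = (\<lambda>t. scale (chr m s) (w m t))"
      if "m \<in> M" "s \<in> torus_points n" for m s
      using that unit[OF that(2)] mult by (auto simp: w_def on_torus_def fun_eq_iff)
    show "sum w M = 0"
    proof
      fix t
      have "sum w M t = (\<Sum>m\<in>M. w m t)" by (induction M rule: infinite_finite_induct) auto
      also have "\<dots> = 0"
        using zero[of t] by (cases "t \<in> torus_points n") (simp_all add: w_def on_torus_def)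
      finally show "sum w M t = 0 t" by simp
    qed
  qed (use assms in auto)
  moreover have "w m (\<lambda>i. 1) = v m" if "m \<in> M" for m
    unfolding w_def on_torus_def using one[OF that] torus_points_one by auto
  ultimately show ?thesis by (metis zero_fun_apply)
qed

end

subsection \<open>Laurent polynomials and their derivatives at the identity\<close>

text \<open>Laurent polynomials as restrictions to the torus: values at other points are
  unconstrained.\<close>

definition laurent :: "nat \<Rightarrow> ((nat \<Rightarrow> 'k::field) \<Rightarrow> 'k) set" where
  "laurent n = {f. \<exists>M c. finite M \<and> M \<subseteq> exponents n \<and>
     (\<forall>t\<in>torus_points n. f t = (\<Sum>m\<in>M. c m * tchar n m t))}"

lemma laurentI:
  assumes "finite M" "M \<subseteq> exponents n" "\<And>t. t \<in> torus_points n \<Longrightarrow> f t = (\<Sum>m\<in>M. c m * tchar n m t)"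
  shows "f \<in> laurent n"
  using assms unfolding laurent_def by blast

lemma laurent_cong:
  assumes "f \<in> laurent n" "\<And>t. t \<in> torus_points n \<Longrightarrow> g t = f t"
  shows "g \<in> laurent n"
  using assms by (simp add: laurent_def)

lemma laurent_char: "m \<in> exponents n \<Longrightarrow> (\<lambda>t. c * tchar n m t) \<in> laurent n"
  by (rule laurentI[of "{m}" _ _ "\<lambda>_. c"]) auto

lemma laurent_add:
  assumes "f \<in> laurent n" "g \<in> laurent n"
  shows "(\<lambda>t. f t + g t) \<in> laurent n"
proof -
  obtain M c where M: "finite M" "M \<subseteq> exponents n" "\<And>t. t \<in> torus_points n \<Longrightarrow> f t = (\<Sum>m\<in>M. c m * tchar n m t)"
    using assms(1) unfolding laurent_def by blast
  obtain N d where N: "finite N" "N \<subseteq> exponents n" "\<And>t. t \<in> torus_points n \<Longrightarrow> g t = (\<Sum>m\<in>N. d m * tchar n m t)"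
    using assms(2) unfolding laurent_def by blast
  show ?thesis
  proof (rule laurentI[of "M \<union> N" _ _ "\<lambda>m. (if m \<in> M then c m else 0) + (if m \<in> N then d m else 0)"])
    fix t :: "nat \<Rightarrow> 'a" assume t: "t \<in> torus_points n"
    have "(\<Sum>m\<in>M \<union> N. (if m \<in> M then c m else 0) * tchar n m t) = f t"
      unfolding M(3)[OF t] using M(1) N(1) by (intro sum.mono_neutral_cong_right) auto
    moreover have "(\<Sum>m\<in>M \<union> N. (if m \<in> N then d m else 0) * tchar n m t) = g t"
      unfolding N(3)[OF t] using M(1) N(1) by (intro sum.mono_neutral_cong_right) auto
    ultimately show "f t + g t = (\<Sum>m\<in>M \<union> N. ((if m \<in> M then c m else 0) + (if m \<in> N then d m else 0)) * tchar n m t)"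
      by (simp only: distrib_right sum.distrib)
  qed (use M N in auto)
qed

lemma laurent_sum:
  "(\<And>i. i \<in> I \<Longrightarrow> f i \<in> laurent n) \<Longrightarrow> (\<lambda>t. \<Sum>i\<in>I. f i t) \<in> laurent n"
proof (induction I rule: infinite_finite_induct)
  case (insert i I)
  then show ?case using laurent_add[of "f i" n "\<lambda>t. \<Sum>i\<in>I. f i t"] by simp
qed (use laurentI[of "{}" n "\<lambda>t. 0"] in auto)

lemma exponents_add: "m \<in> exponents n \<Longrightarrow> m' \<in> exponents n \<Longrightarrow> m + m' \<in> exponents n"
  by (simp add: exponents_def)

lemma laurent_mult:
  assumes "f \<in> laurent n" "g \<in> laurent n"
  shows "(\<lambda>t. f t * g t) \<in> laurent n"
proof -
  obtain M c where M: "finite M" "M \<subseteq> exponents n" "\<And>t. t \<in> torus_points n \<Longrightarrow> f t = (\<Sum>m\<in>M. c m * tchar n m t)"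
    using assms(1) unfolding laurent_def by blast
  obtain N d where N: "finite N" "N \<subseteq> exponents n" "\<And>t. t \<in> torus_points n \<Longrightarrow> g t = (\<Sum>m\<in>N. d m * tchar n m t)"
    using assms(2) unfolding laurent_def by blast
  have "(\<lambda>t. \<Sum>m\<in>M. \<Sum>m'\<in>N. (c m * d m') * tchar n (m + m') t) \<in> laurent n"
    using M(2) N(2) by (intro laurent_sum laurent_char exponents_add) auto
  then show ?thesis
    by (rule laurent_cong) (auto simp: M(3) N(3) tchar_add sum_product mult_ac)
qed

lemma mult_torus_regular_laurent: "f \<in> mult_torus_regular n \<Longrightarrow> f \<in> laurent n"
proof (induction rule: mult_torus_regular_induct)
  case (const c)
  show ?case using laurent_char[of 0 n c] by (simp add: exponents_def)
next
  case (coord i)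
  let ?m = "\<lambda>j. if j = i then 1 else 0 :: int"
  have *: "(\<lambda>t. 1 * tchar n ?m t) \<in> laurent n"
    using coord by (intro laurent_char) (auto simp: exponents_def)
  show ?case
    by (rule laurent_cong[OF *])
       (use coord in \<open>simp add: tchar_def if_distrib[of "\<lambda>k. _ powi k"] cong: if_cong\<close>)
next
  case (inverse i)
  let ?m = "\<lambda>j. if j = i then - 1 else 0 :: int"
  have *: "(\<lambda>t. 1 * tchar n ?m t) \<in> laurent n"
    using inverse by (intro laurent_char) (auto simp: exponents_def)
  show ?case
    by (rule laurent_cong[OF *])
       (use inverse in \<open>simp add: tchar_def if_distrib[of "\<lambda>k. _ powi k"] power_int_minus cong: if_cong\<close>)
next
  case (add r s)
  then show ?case by (rule laurent_add)
next
  case (mult r s)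
  then show ?case by (rule laurent_mult)
qed

lemma sum_fun_apply: "(\<Sum>i\<in>I. f i) x = (\<Sum>i\<in>I. f i x)"
  by (induction I rule: infinite_finite_induct) simp_all

lemma vector_space_field: "vector_space ((*) :: 'k::field \<Rightarrow> _)"
  by (rule vector_space.intro) (simp_all add: distrib_left distrib_right)

lemma endomorphisms_field: "endomorphisms ((*) :: 'k::field \<Rightarrow> _)"
  by (rule endomorphisms.intro) (rule vector_space_field)

text \<open>\<open>L\<close> is the differential at the identity in direction \<open>\<gamma>\<close>.\<close>

lemma torus_derivative_exists:
  fixes \<gamma> :: "nat \<Rightarrow> 'k::field_char_0"
  shows "\<exists>L :: ((nat \<Rightarrow> 'k) \<Rightarrow> 'k) \<Rightarrow> 'k. (\<forall>f g. L (\<lambda>t. f t + g t) = L f + L g) \<and> (\<forall>c f. L (\<lambda>t. c * f t) = c * L f) \<and>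
     (\<forall>m\<in>exponents n. L (on_torus n (tchar n m)) = (\<Sum>j<n. \<gamma> j * of_int (m j)))"
proof -
  have v1: "vector_space (\<lambda>c (f :: (nat \<Rightarrow> 'k) \<Rightarrow> 'k) t. c * f t)"
    by (rule vector_space.intro) (simp_all add: fun_eq_iff distrib_left distrib_right)
  interpret p: vector_space_pair "\<lambda>c (f :: (nat \<Rightarrow> 'k) \<Rightarrow> 'k) t. c * f t" "(*) :: 'k \<Rightarrow> _"
    by (rule vector_space_pair.intro[OF v1 vector_space_field])
  define E :: "(nat \<Rightarrow> int) \<Rightarrow> (nat \<Rightarrow> 'k) \<Rightarrow> 'k" where "E m = on_torus n (tchar n m)" for m
  have E: "E m t = (if t \<in> torus_points n then tchar n m t else 0)" for m t by (simp add: E_def on_torus_def)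
  have inj: "inj_on E (exponents n)"
  proof (rule inj_onI)
    fix m m' assume *: "m \<in> exponents n" "m' \<in> exponents n" "E m = E m'"
    have "tchar n m t = (tchar n m' t :: 'k)" if "t \<in> torus_points n" for t
      using fun_cong[OF *(3), of t] that by (simp add: E)
    then show "m = m'" using tchar_distinct[OF *(1,2)] by blast
  qed
  \<comment> \<open>By Dedekind's lemma the characters, extended by zero, are independent, so the
    values of \<open>L\<close> on them can be prescribed. On the remaining functions
    \<open>L\<close> is whatever the linear extension gives.\<close>
  have "p.vs1.independent (E ` exponents n)"
    unfolding p.vs1.independent_explicit_finite_subsets
  proof (intro allI impI)
    fix S u assume S: "S \<subseteq> E ` exponents n" "finite S" "(\<Sum>v\<in>S. (\<lambda>t. u v * v t)) = 0"
    obtain M where M: "M \<subseteq> exponents n" "finite M" "S = E ` M" using finite_subset_image[OF S(2,1)] by blast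
    have inj': "inj_on E M" using inj M inj_on_subset by blast
    have "(\<Sum>m\<in>M. tchar n m t * u (E m)) = 0" if t: "t \<in> torus_points n" for t
    proof -
      have "(\<Sum>v\<in>S. (\<lambda>t. u v * v t)) t = 0" using S(3) by simp
      then show ?thesis
        unfolding sum_fun_apply M(3) sum.reindex[OF inj'] using t by (simp add: E mult.commute)
    qed
    then have *: "\<forall>m\<in>M. u (E m) = 0"
    proof (rule endomorphisms.characters_independent[OF endomorphisms_field M(2), of n "tchar n", rotated -1])
      show "\<exists>t\<in>torus_points n. tchar n m t \<noteq> (tchar n m' t :: 'k)" if "m \<in> M" "m' \<in> M" "m \<noteq> m'" for m m'
        using tchar_distinct[of m n m'] that M(1) by blast
      show "tchar n m (\<lambda>i. s i * t i) = tchar n m s * tchar n m t" for m and s t :: "nat \<Rightarrow> 'k"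
        by (rule tchar_mult)
      show "tchar n m (\<lambda>i. 1) = 1" for m by (rule tchar_one)
    qed
    then show "\<forall>v\<in>S. u v = 0" by (simp add: M(3))
  qed
  from p.linear_independent_extend[OF this, of "\<lambda>b. \<Sum>j<n. \<gamma> j * of_int (inv_into (exponents n) E b j)"]
  obtain L where L: "Vector_Spaces.linear (\<lambda>c (f :: (nat \<Rightarrow> 'k) \<Rightarrow> 'k) t. c * f t) (*) L"
    "\<And>m. m \<in> exponents n \<Longrightarrow> L (E m) = (\<Sum>j<n. \<gamma> j * of_int (m j))"
    using inj by (auto simp: inv_into_f_f)
  have "L (\<lambda>t. f t + g t) = L f + L g" for f g
    using L(1) unfolding Vector_Spaces.linear_iff plus_fun_def by blast
  moreover have "L (\<lambda>t. c * f t) = c * L f" for c f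
    using L(1) unfolding Vector_Spaces.linear_iff by blast
  ultimately show ?thesis using L(2) unfolding E_def by blast
qed

text \<open>Exponents add under multiplication and every character is 1 at the identity, so the
  product rule holds for characters; bilinearity carries it to Laurent polynomials.\<close>

lemma torus_derivative_mult:
  fixes L :: "((nat \<Rightarrow> 'k::field_char_0) \<Rightarrow> 'k) \<Rightarrow> 'k"
  assumes add: "\<And>f g. L (\<lambda>t. f t + g t) = L f + L g" and scale: "\<And>c f. L (\<lambda>t. c * f t) = c * L f"
    and chr: "\<And>m. m \<in> exponents n \<Longrightarrow> L (on_torus n (tchar n m)) = (\<Sum>j<n. \<gamma> j * of_int (m j))"
    and f: "f \<in> laurent n" and g: "g \<in> laurent n"
  shows "L (on_torus n (\<lambda>t. f t * g t)) = f (\<lambda>i. 1) * L (on_torus n g) + L (on_torus n f) * g (\<lambda>i. 1)"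
proof -
  have "L (\<lambda>t. 0) = 0" using scale[of 0 "\<lambda>t. 0"] by simp
  then have sum: "L (\<lambda>t. \<Sum>i\<in>I. h i t) = (\<Sum>i\<in>I. L (h i))" for I :: "(nat \<Rightarrow> int) set" and h
    by (induction I rule: infinite_finite_induct) (simp_all add: add)
  obtain M c where M: "finite M" "M \<subseteq> exponents n" "\<And>t. t \<in> torus_points n \<Longrightarrow> f t = (\<Sum>m\<in>M. c m * tchar n m t)"
    using f unfolding laurent_def by blast
  obtain N d where N: "finite N" "N \<subseteq> exponents n" "\<And>t. t \<in> torus_points n \<Longrightarrow> g t = (\<Sum>m\<in>N. d m * tchar n m t)"
    using g unfolding laurent_def by blast
  let ?E = "\<lambda>m. on_torus n (tchar n m)"
  define l where "l m = (\<Sum>j<n. \<gamma> j * of_int (m j))" for m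
  have f1: "f (\<lambda>i. 1) = (\<Sum>m\<in>M. c m)" "g (\<lambda>i. 1) = (\<Sum>m\<in>N. d m)"
    using M(3)[OF torus_points_one] N(3)[OF torus_points_one] by simp_all
  have "on_torus n f = (\<lambda>t. \<Sum>m\<in>M. c m * ?E m t)" "on_torus n g = (\<lambda>t. \<Sum>m\<in>N. d m * ?E m t)"
    using M(3) N(3) by (auto simp: on_torus_def fun_eq_iff)
  then have Lf: "L (on_torus n f) = (\<Sum>m\<in>M. c m * l m)" "L (on_torus n g) = (\<Sum>m\<in>N. d m * l m)"
    using M(2) N(2) by (auto simp: sum scale intro!: sum.cong simp: chr l_def subset_iff)
  have "on_torus n (\<lambda>t. f t * g t) = (\<lambda>t. \<Sum>m\<in>M. \<Sum>m'\<in>N. (c m * d m') * ?E (m + m') t)"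
    using M(3) N(3) by (auto simp: on_torus_def fun_eq_iff tchar_add sum_product mult_ac)
  then have "L (on_torus n (\<lambda>t. f t * g t)) = (\<Sum>m\<in>M. \<Sum>m'\<in>N. (c m * d m') * L (?E (m + m')))"
    by (simp add: sum scale)
  also have "\<dots> = (\<Sum>m\<in>M. \<Sum>m'\<in>N. (c m * d m') * (l m + l m'))"
  proof (intro sum.cong refl)
    fix m m' assume "m \<in> M" "m' \<in> N"
    then have "L (?E (m + m')) = (\<Sum>j<n. \<gamma> j * of_int ((m + m') j))"
      using M(2) N(2) by (intro chr exponents_add) auto
    also have "\<dots> = l m + l m'" by (simp add: l_def distrib_left sum.distrib)
    finally show "c m * d m' * L (?E (m + m')) = c m * d m' * (l m + l m')" by (rule arg_cong)
  qed
  also have "\<dots> = f (\<lambda>i. 1) * L (on_torus n g) + L (on_torus n f) * g (\<lambda>i. 1)"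
    unfolding f1 Lf sum_product sum.distrib[symmetric] by (intro sum.cong refl) (simp add: algebra_simps)
  finally show ?thesis .
qed

subsection \<open>Tori in the general linear group\<close>

context endomorphisms
begin

section \<open>Linear functionals and the coordinate ring of the general linear group\<close>

abbreviation functional :: "('b \<Rightarrow> 'a) \<Rightarrow> bool" where
  "functional \<equiv> Vector_Spaces.linear scale (*)"

lemma functional_iff:
  "functional \<xi> \<longleftrightarrow> (\<forall>x y. \<xi> (x + y) = \<xi> x + \<xi> y) \<and> (\<forall>c x. \<xi> (scale c x) = c * \<xi> x)"
  using vector_space_axioms by (simp add: Vector_Spaces.linear_iff vector_space_field)

lemma functional_0: "functional \<xi> \<Longrightarrow> \<xi> 0 = 0"
  unfolding functional_iff by (metis add_cancel_right_left)

lemma functional_sum: "functional \<xi> \<Longrightarrow> \<xi> (sum f S) = (\<Sum>i\<in>S. \<xi> (f i))"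
  by (induction S rule: infinite_finite_induct) (auto simp: functional_0, auto simp: functional_iff)

lemma functional_diff: "functional \<xi> \<Longrightarrow> \<xi> (x - y) = \<xi> x - \<xi> y"
  unfolding functional_iff by (metis add_diff_cancel diff_add_cancel)

lemma functional_exists:
  assumes "subspace W" "x \<notin> W"
  shows "\<exists>\<xi>. functional \<xi> \<and> (\<forall>w\<in>W. \<xi> w = 0) \<and> \<xi> x = 1"
proof -
  interpret p: vector_space_pair scale "(*) :: 'a \<Rightarrow> _"
    by (rule vector_space_pair.intro[OF vector_space_axioms vector_space_field])
  obtain B where B: "B \<subseteq> W" "independent B" "W \<subseteq> span B"
    by (rule maximal_independent_subset)
  then have W: "span B = W" using assms(1) by (simp add: span_subspace)
  then have "independent (insert x B)" using B assms(2) by (simp add: independent_insertI)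
  from p.linear_independent_extend[OF this, of "\<lambda>b. if b = x then 1 else 0"]
  obtain \<xi> where \<xi>: "functional \<xi>" "\<And>b. b \<in> insert x B \<Longrightarrow> \<xi> b = (if b = x then 1 else 0)" by blast
  have "\<xi> w = 0" if "w \<in> W" for w
  proof -
    have "w \<in> span B" using W that by simp
    then show ?thesis
    proof (induction rule: span_induct_alt)
      case (step c b y)
      then have "\<xi> b = 0" using \<xi>(2)[of b] B(1) assms(2) by auto
      then show ?case using step \<xi>(1) by (simp add: functional_iff)
    qed (rule functional_0[OF \<xi>(1)])
  qed
  then show ?thesis using \<xi> by auto
qed

lemma functional_eq_0:
  assumes "subspace W" "\<And>\<xi>. functional \<xi> \<Longrightarrow> (\<forall>w\<in>W. \<xi> w = 0) \<Longrightarrow> \<xi> x = 0"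
  shows "x \<in> W"
  using functional_exists[OF assms(1), of x] assms(2) by force

lemma functional_ext: "(\<And>\<xi>. functional \<xi> \<Longrightarrow> \<xi> x = \<xi> y) \<Longrightarrow> x = y"
  using functional_eq_0[OF subspace_single_0, of "x - y"] functional_diff by fastforce

lemma GL_regular_cases:
  "(\<lambda>f. c) \<in> GL_regular scale"
  "functional \<xi> \<Longrightarrow> (\<lambda>f. \<xi> (f x)) \<in> GL_regular scale"
  "functional \<xi> \<Longrightarrow> (\<lambda>f. \<xi> (inv_into UNIV f x)) \<in> GL_regular scale"
  "p \<in> GL_regular scale \<Longrightarrow> q \<in> GL_regular scale \<Longrightarrow> (\<lambda>f. p f + q f) \<in> GL_regular scale"
  "p \<in> GL_regular scale \<Longrightarrow> q \<in> GL_regular scale \<Longrightarrow> (\<lambda>f. p f * q f) \<in> GL_regular scale"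
  unfolding GL_regular_def by (blast intro: function_algebra.intros)+

lemma GL_regular_diff:
  assumes "p \<in> GL_regular scale" "q \<in> GL_regular scale"
  shows "(\<lambda>f. p f - q f) \<in> GL_regular scale"
  using GL_regular_cases(4)[OF assms(1) GL_regular_cases(5)[OF GL_regular_cases(1)[of "- 1"] assms(2)]] by simp

lemma GL_regular_induct [consumes 1, case_names const coef inverse add mult]:
  assumes "p \<in> GL_regular scale"
    and "\<And>c. P (\<lambda>f. c)" "\<And>\<xi> x. functional \<xi> \<Longrightarrow> P (\<lambda>f. \<xi> (f x))"
    and "\<And>\<xi> x. functional \<xi> \<Longrightarrow> P (\<lambda>f. \<xi> (inv_into UNIV f x))"
    and "\<And>p q. P p \<Longrightarrow> P q \<Longrightarrow> P (\<lambda>f. p f + q f)" "\<And>p q. P p \<Longrightarrow> P q \<Longrightarrow> P (\<lambda>f. p f * q f)"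
  shows "P p"
  using assms(1) unfolding GL_regular_def
  by (induction rule: function_algebra.induct) (use assms(2-) in auto)

lemma carrier_GL: "f \<in> carrier (GL scale) \<longleftrightarrow> lin f \<and> bij f"
  and mult_GL: "f \<otimes>\<^bsub>GL scale\<^esub> g = f \<circ> g"
  and one_GL: "\<one>\<^bsub>GL scale\<^esub> = id"
  by (simp_all add: GL_def)

lemma group_GL: "group (GL scale)"
proof (rule groupI)
  fix f assume "f \<in> carrier (GL scale)"
  then have f: "lin f" "bij f" by (simp_all add: carrier_GL)
  let ?g = "inv_into UNIV f"
  have g: "f (?g x) = x" "?g (f x) = x" for x
    using f(2) by (simp_all add: bij_is_inj bij_is_surj surj_f_inv_f)
  have "lin ?g" unfolding lin_iff by (metis g lin_add[OF f(1)] lin_scale[OF f(1)])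
  then show "\<exists>g\<in>carrier (GL scale). g \<otimes>\<^bsub>GL scale\<^esub> f = \<one>\<^bsub>GL scale\<^esub>"
    using f(2) g by (intro bexI[of _ ?g]) (auto simp: carrier_GL mult_GL one_GL bij_imp_bij_inv)
qed (auto simp: carrier_GL mult_GL one_GL bij_comp bij_id lin_compose comp_assoc lin_iff)

text \<open>A representation of the split torus with regular matrix coefficients is a closed
  embedding once the coordinates of the torus, and their inverses, are restrictions of regular
  functions on the general linear group. For closedness, the torus point is reconstructed from any
  \<open>f\<close> satisfying the equations of the image.\<close>

lemma torusI:
  assumes lin: "\<And>t. t \<in> torus_points n \<Longrightarrow> lin (\<phi> t)"
    and mult: "\<And>s t. s \<in> torus_points n \<Longrightarrow> t \<in> torus_points n \<Longrightarrow> \<phi> (\<lambda>i. s i * t i) = \<phi> s \<circ> \<phi> t"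
    and one: "\<phi> (\<lambda>i. 1) = id"
    and coef: "\<And>\<xi> x. functional \<xi> \<Longrightarrow> \<exists>s\<in>mult_torus_regular n. \<forall>t\<in>torus_points n. \<xi> (\<phi> t x) = s t"
    and coord: "\<And>i. i < n \<Longrightarrow> \<exists>p\<in>GL_regular scale. \<forall>t\<in>torus_points n. p (\<phi> t) = t i"
    and coord_inv: "\<And>i. i < n \<Longrightarrow> \<exists>p\<in>GL_regular scale. \<forall>t\<in>torus_points n. p (\<phi> t) = inverse (t i)"
  shows "torus_of_dim scale n (\<phi> ` torus_points n)"
proof -
  let ?T = "\<phi> ` torus_points n" and ?M = "mult_torus n :: (nat \<Rightarrow> 'a) monoid"
  let ?inv = "\<lambda>t i. inverse (t i :: 'a)"
  have cancel: "(\<lambda>i. t i * inverse (t i)) = (\<lambda>i. 1)" "(\<lambda>i. inverse (t i) * t i) = (\<lambda>i. 1)"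
    if "t \<in> torus_points n" for t :: "nat \<Rightarrow> 'a"
    using that by (auto simp: torus_points_iff fun_eq_iff) (metis inverse_1 leI left_inverse mult_1 right_inverse)+
  have inv1: "\<phi> t \<circ> \<phi> (?inv t) = id" "\<phi> (?inv t) \<circ> \<phi> t = id" if "t \<in> torus_points n" for t
    using mult[OF that torus_points_inverse[OF that]] mult[OF torus_points_inverse[OF that] that] cancel[OF that] one
    by simp_all
  have bij: "bij (\<phi> t)" if "t \<in> torus_points n" for t
    using o_bij[OF inv1(2,1)[OF that]] .
  have inv: "inv_into UNIV (\<phi> t) = \<phi> (?inv t)" if "t \<in> torus_points n" for t
    using inv_unique_comp[OF inv1[OF that]] .
  have GL: "\<phi> t \<in> carrier (GL scale)" if "t \<in> torus_points n" for t
    using lin bij that by (simp add: carrier_GL)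
  have hom: "\<phi> \<in> hom ?M (GL scale)"
    by (rule homI) (simp_all add: GL mult_GL mult_mult_torus mult)
  have sub: "subgroup ?T (GL scale)"
    using group_hom.img_is_subgroup[of ?M "GL scale" \<phi>] hom group_mult_torus group_GL
    by (auto simp: group_hom_def group_hom_axioms_def)
  have reg_inv: "(\<lambda>t. s (?inv t)) \<in> mult_torus_regular n" if "s \<in> mult_torus_regular n" for s :: "(nat \<Rightarrow> 'a) \<Rightarrow> 'a"
    using that by (induction rule: mult_torus_regular_induct) (simp_all add: mult_torus_regular_cases)
  have pull: "\<exists>s\<in>mult_torus_regular n. \<forall>t\<in>torus_points n. p (\<phi> t) = s t" if "p \<in> GL_regular scale" for p
    using that
  proof (induction rule: GL_regular_induct)
    case (const c)
    show ?case by (rule bexI[OF _ mult_torus_regular_cases(1)[of c]]) simp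
  next
    case (coef \<xi> x)
    then show ?case by (rule assms(4))
  next
    case (inverse \<xi> x)
    then obtain s where "s \<in> mult_torus_regular n" "\<forall>t\<in>torus_points n. \<xi> (\<phi> t x) = s t" using coef by blast
    then show ?case
      by (intro bexI[OF _ reg_inv[of s]]) (auto simp: inv torus_points_inverse)
  next
    case (add p q)
    then obtain s u where "s \<in> mult_torus_regular n" "\<forall>t\<in>torus_points n. p (\<phi> t) = s t"
      "u \<in> mult_torus_regular n" "\<forall>t\<in>torus_points n. q (\<phi> t) = u t" by blast
    then show ?case by (intro bexI[OF _ mult_torus_regular_cases(4)[of s n u]]) auto
  next
    case (mult p q)
    then obtain s u where "s \<in> mult_torus_regular n" "\<forall>t\<in>torus_points n. p (\<phi> t) = s t"
      "u \<in> mult_torus_regular n" "\<forall>t\<in>torus_points n. q (\<phi> t) = u t" by blast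
    then show ?case by (intro bexI[OF _ mult_torus_regular_cases(5)[of s n u]]) auto
  qed
  obtain p where p: "\<And>i. i < n \<Longrightarrow> p i \<in> GL_regular scale" "\<And>i t. i < n \<Longrightarrow> t \<in> torus_points n \<Longrightarrow> p i (\<phi> t) = t i"
    using coord by metis
  obtain q where q: "\<And>i. i < n \<Longrightarrow> q i \<in> GL_regular scale" "\<And>i t. i < n \<Longrightarrow> t \<in> torus_points n \<Longrightarrow> q i (\<phi> t) = inverse (t i)"
    using coord_inv by metis
  \<comment> \<open>The candidate torus point of \<open>f\<close>, read off by the functions
    \<open>p i\<close>; it will be shown that f = \<phi>(\<open>pt f\<close>) whenever
    \<open>f\<close> satisfies all equations in \<open>I\<close>.\<close>
  define pt where "pt f i = (if i < n then p i f else 1)" for f i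
  define I where "I = {r \<in> GL_regular scale. \<forall>f\<in>?T. r f = 0}"
  \<comment> \<open>The additional clause about \<open>f\<close> makes the same regular function
    usable at points not yet known to lie in the image.\<close>
  have push: "\<exists>r\<in>GL_regular scale. (\<forall>t\<in>torus_points n. s t = r (\<phi> t)) \<and> ((\<forall>r\<in>I. r f = 0) \<longrightarrow> r f = s (pt f))"
    if "s \<in> mult_torus_regular n" for s f
    using that
  proof (induction rule: mult_torus_regular_induct)
    case (const c)
    show ?case by (rule bexI[OF _ GL_regular_cases(1)[of c]]) simp
  next
    case (coord i)
    then show ?case by (intro bexI[OF _ p(1)[OF coord]]) (auto simp: p pt_def)
  next
    case (inverse i)
    have "(\<lambda>f. p i f * q i f - 1) \<in> I" unfolding I_def
      using inverse p q by (auto intro!: GL_regular_diff GL_regular_cases simp: torus_points_iff)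
    then have "(\<forall>r\<in>I. r f = 0) \<longrightarrow> p i f * q i f = 1" by auto
    then show ?case using inverse by (intro bexI[OF _ q(1)[OF inverse]]) (auto simp: q pt_def inverse_unique)
  next
    case (add s u)
    then obtain r r' where "r \<in> GL_regular scale" "\<forall>t\<in>torus_points n. s t = r (\<phi> t)" "(\<forall>r\<in>I. r f = 0) \<longrightarrow> r f = s (pt f)"
      "r' \<in> GL_regular scale" "\<forall>t\<in>torus_points n. u t = r' (\<phi> t)" "(\<forall>r\<in>I. r f = 0) \<longrightarrow> r' f = u (pt f)" by blast
    then show ?case by (intro bexI[OF _ GL_regular_cases(4)[of r r']]) auto
  next
    case (mult s u)
    then obtain r r' where "r \<in> GL_regular scale" "\<forall>t\<in>torus_points n. s t = r (\<phi> t)" "(\<forall>r\<in>I. r f = 0) \<longrightarrow> r f = s (pt f)"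
      "r' \<in> GL_regular scale" "\<forall>t\<in>torus_points n. u t = r' (\<phi> t)" "(\<forall>r\<in>I. r f = 0) \<longrightarrow> r' f = u (pt f)" by blast
    then show ?case by (intro bexI[OF _ GL_regular_cases(5)[of r r']]) auto
  qed
  have "?T = {f \<in> carrier (GL scale). \<forall>r\<in>I. r f = 0}"
  proof
    show "?T \<subseteq> {f \<in> carrier (GL scale). \<forall>r\<in>I. r f = 0}" using GL by (auto simp: I_def)
    show "{f \<in> carrier (GL scale). \<forall>r\<in>I. r f = 0} \<subseteq> ?T"
    proof
      fix f assume "f \<in> {f \<in> carrier (GL scale). \<forall>r\<in>I. r f = 0}"
      then have f: "f \<in> carrier (GL scale)" "\<And>r. r \<in> I \<Longrightarrow> r f = 0" by auto
      have "p i f * q i f = 1" if "i < n" for i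
      proof -
        have "(\<lambda>f. p i f * q i f - 1) \<in> I" unfolding I_def
          using that p q by (auto intro!: GL_regular_diff GL_regular_cases simp: torus_points_iff)
        then show ?thesis using f(2) by force
      qed
      then have pt: "pt f \<in> torus_points n" by (force simp: torus_points_iff pt_def)
      have "f x = \<phi> (pt f) x" for x
      proof (rule functional_ext)
        fix \<xi> assume \<xi>: "functional \<xi>"
        obtain s where s: "s \<in> mult_torus_regular n" "\<And>t. t \<in> torus_points n \<Longrightarrow> \<xi> (\<phi> t x) = s t"
          using coef[OF \<xi>] by metis
        obtain r where r: "r \<in> GL_regular scale" "\<And>t. t \<in> torus_points n \<Longrightarrow> s t = r (\<phi> t)" "r f = s (pt f)"
          using push[OF s(1), of f] f(2) by blast
        have "(\<lambda>f. \<xi> (f x) - r f) \<in> I" unfolding I_def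
          using GL_regular_diff[OF GL_regular_cases(2)[OF \<xi>] r(1)] s(2) r(2) by auto
        then have "\<xi> (f x) = r f" using f(2) by force
        then show "\<xi> (f x) = \<xi> (\<phi> (pt f) x)" using s(2)[OF pt] r(3) by simp
      qed
      then show "f \<in> ?T" using pt by (metis ext imageI)
    qed
  qed
  moreover have "I \<subseteq> GL_regular scale" by (auto simp: I_def)
  ultimately have closed: "zariski_closed scale ?T"
    unfolding zariski_closed_def by (intro exI[of _ I] conjI)
  have "inj_on \<phi> (torus_points n)"
  proof (rule inj_onI, rule ext)
    fix s t i assume st: "s \<in> torus_points n" "t \<in> torus_points n" "\<phi> s = \<phi> t"
    show "s i = t i"
    proof (cases "i < n")
      case True
      then show ?thesis using p(2)[OF True] st by metis
    next
      case False
      then show ?thesis using st by (simp add: torus_points_iff)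
    qed
  qed
  then have iso: "\<phi> \<in> iso ?M (GL scale\<lparr>carrier := ?T\<rparr>)"
    using hom by (auto simp: iso_def hom_def bij_betw_def)
  have push': "\<exists>r\<in>GL_regular scale. \<forall>t\<in>torus_points n. s t = r (\<phi> t)" if "s \<in> mult_torus_regular n" for s
    using push[OF that] by blast
  show ?thesis unfolding torus_of_dim_def algebraic_subgroup_def
    using sub closed iso pull push' by blast
qed

end

subsection \<open>The torus of a family of integral weights\<close>

context endomorphisms
begin

lemma direct_sum_of_nonzero:
  assumes ds: "direct_sum_of K V"
  shows "direct_sum_of {i\<in>K. V i \<noteq> {0}} V"
proof (rule direct_sum_ofI)
  let ?K = "{i\<in>K. V i \<noteq> {0}}"
  show "finite ?K" using direct_sum_ofD[OF ds] by simp
  show "subspace (V i)" if "i \<in> ?K" for i using direct_sum_ofD[OF ds] that by simp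
  show "\<exists>c. (\<forall>i\<in>?K. c i \<in> V i) \<and> x = sum c ?K" for x
  proof (intro exI[of _ "\<lambda>i. component K V i x"] conjI)
    have "(\<Sum>i\<in>K. component K V i x) = (\<Sum>i\<in>?K. component K V i x)"
      using direct_sum_ofD[OF ds] component_in[OF ds, of _ x] by (intro sum.mono_neutral_right) auto
    then show "x = (\<Sum>i\<in>?K. component K V i x)" by (simp add: sum_component[OF ds])
  qed (simp add: component_in[OF ds])
  show "\<forall>i\<in>?K. c i = 0" if c: "\<And>i. i \<in> ?K \<Longrightarrow> c i \<in> V i" "sum c ?K = 0" for c
  proof -
    let ?c = "\<lambda>i. if i \<in> ?K then c i else 0"
    have "sum ?c K = sum c ?K"
      using direct_sum_ofD[OF ds] by (intro sum.mono_neutral_cong_right) auto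
    moreover have "\<forall>i\<in>K. ?c i \<in> V i" using c direct_sum_ofD(2)[OF ds] subspace_0 by auto
    moreover have "\<forall>c. (\<forall>i\<in>K. c i \<in> V i) \<and> sum c K = 0 \<longrightarrow> (\<forall>i\<in>K. c i = 0)"
      using ds unfolding direct_sum_of_def by (elim conjE) assumption
    from spec[OF this, of ?c] have "(\<forall>i\<in>K. ?c i \<in> V i) \<and> sum ?c K = 0 \<longrightarrow> (\<forall>i\<in>K. ?c i = 0)" .
    ultimately have "\<forall>i\<in>K. ?c i = 0" using c(2) by argo
    then show ?thesis by (metis (mono_tags, lifting) mem_Collect_eq)
  qed
qed

lemma diagonal_map_compose:
  assumes ds: "direct_sum_of K V"
  shows "diagonal_map K V f (diagonal_map K V g x) = diagonal_map K V (\<lambda>i. f i * g i) x"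
  by (rule direct_sum_eqI[OF ds lin_comp[OF lin_diagonal_map[OF ds] lin_diagonal_map[OF ds]] lin_diagonal_map[OF ds]])
     (simp add: diagonal_map_eq[OF ds] lin_scale[OF lin_diagonal_map[OF ds]] mult.commute)

lemma diagonal_map_1: "direct_sum_of K V \<Longrightarrow> diagonal_map K V (\<lambda>i. 1) = id"
  by (auto simp: diagonal_map_def sum_component fun_eq_iff)

text \<open>The diagonal action of the split torus of rank \<open>r\<close> in which
  \<open>V w\<close> has the character with exponent vector \<open>c w\<close>.\<close>

definition weight_torus :: "nat \<Rightarrow> 'w set \<Rightarrow> ('w \<Rightarrow> 'b set) \<Rightarrow> ('w \<Rightarrow> nat \<Rightarrow> int) \<Rightarrow> (nat \<Rightarrow> 'a) \<Rightarrow> 'b \<Rightarrow> 'b" where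
  "weight_torus r W V c u = diagonal_map W V (\<lambda>w. tchar r (c w) u)"

lemma weight_torus_mult:
  assumes "direct_sum_of W V"
  shows "weight_torus r W V c (\<lambda>i. s i * t i) = weight_torus r W V c s \<circ> weight_torus r W V c t"
  by (simp add: weight_torus_def fun_eq_iff diagonal_map_compose[OF assms] tchar_mult)

lemma weight_torus_one: "direct_sum_of W V \<Longrightarrow> weight_torus r W V c (\<lambda>i. 1) = id"
  by (simp add: weight_torus_def diagonal_map_1)

lemma lin_weight_torus: "direct_sum_of W V \<Longrightarrow> lin (weight_torus r W V c u)"
  unfolding weight_torus_def by (rule lin_diagonal_map)

lemma weight_torus_eq:
  "direct_sum_of W V \<Longrightarrow> w \<in> W \<Longrightarrow> x \<in> V w \<Longrightarrow> weight_torus r W V c u x = scale (tchar r (c w) u) x"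
  unfolding weight_torus_def by (rule diagonal_map_eq)

lemma functional_weight_torus:
  assumes "functional \<xi>"
  shows "\<xi> (weight_torus r W V c u x) = (\<Sum>w\<in>W. \<xi> (component W V w x) * tchar r (c w) u)"
  using assms unfolding weight_torus_def diagonal_map_def functional_sum[OF assms]
  by (simp add: functional_iff mult.commute)

lemma weight_torus_inverse:
  assumes ds: "direct_sum_of W V" and u: "u \<in> torus_points r"
  shows "inv_into UNIV (weight_torus r W V c u) = weight_torus r W V c (\<lambda>i. inverse (u i))"
proof (rule inv_unique_comp)
  have "(\<lambda>i. u i * inverse (u i)) = (\<lambda>i. 1)"
    using u by (auto simp: torus_points_iff fun_eq_iff) (metis inverse_1 leI mult_1 right_inverse)
  moreover have "(\<lambda>i. inverse (u i) * u i) = (\<lambda>i. u i * inverse (u i))" by (simp add: mult.commute)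
  ultimately show "weight_torus r W V c u \<circ> weight_torus r W V c (\<lambda>i. inverse (u i)) = id"
    "weight_torus r W V c (\<lambda>i. inverse (u i)) \<circ> weight_torus r W V c u = id"
    using weight_torus_mult[OF ds] weight_torus_one[OF ds] by metis+
qed

text \<open>
  The matrix \<open>e\<close> witnesses that the exponents of the weights generate the whole character lattice;
  it expresses the coordinates of the torus through matrix coefficients.
\<close>

lemma torus_of_weights:
  assumes ds: "direct_sum_of W V" and nz: "\<And>w. w \<in> W \<Longrightarrow> V w \<noteq> {0}"
    and e: "\<And>i j. i < r \<Longrightarrow> j < r \<Longrightarrow> (\<Sum>w\<in>W. e j w * c w i) = (if i = j then 1 else 0)"
  shows "torus_of_dim scale r (weight_torus r W V c ` torus_points r)"
proof (rule torusI)
  let ?\<tau> = "weight_torus r W V c"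
  show "\<exists>s\<in>mult_torus_regular r. \<forall>t\<in>torus_points r. \<xi> (?\<tau> t x) = s t" if "functional \<xi>" for \<xi> x
  proof (rule bexI)
    show "\<forall>t\<in>torus_points r. \<xi> (?\<tau> t x) = (\<lambda>t. \<Sum>w\<in>W. \<xi> (component W V w x) * tchar r (c w) t) t"
      by (simp add: functional_weight_torus[OF that])
    show "(\<lambda>t. \<Sum>w\<in>W. \<xi> (component W V w x) * tchar r (c w) t) \<in> mult_torus_regular r"
      unfolding mult_torus_regular_def
      by (intro function_algebra_sum function_algebra.mult function_algebra.const
            tchar_regular[unfolded mult_torus_regular_def])
  qed
  have "\<exists>x \<xi>. x \<in> V w \<and> functional \<xi> \<and> \<xi> x = 1" if w: "w \<in> W" for w
  proof -
    obtain x where "x \<in> V w" "x \<noteq> 0"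
      using nz[OF w] subspace_0[OF direct_sum_ofD(2)[OF ds w]] by auto
    then show ?thesis using functional_exists[of "{0}" x] by auto
  qed
  then obtain x \<xi> where x: "\<And>w. w \<in> W \<Longrightarrow> x w \<in> V w" "\<And>w. w \<in> W \<Longrightarrow> functional (\<xi> w)" "\<And>w. w \<in> W \<Longrightarrow> \<xi> w (x w) = 1"
    by metis
  \<comment> \<open>At a vector of weight \<open>w\<close> the matrix coefficient is the character
    itself. Its negative powers come from the coefficients of the inverse map, which keeps the
    functions regular.\<close>
  define p where "p k w = (if k \<ge> 0 then (\<lambda>f. \<xi> w (f (x w)) ^ nat k)
    else (\<lambda>f. \<xi> w (inv_into UNIV f (x w)) ^ nat (- k)))" for k w
  have coefp: "\<xi> w (?\<tau> u (x w)) = tchar r (c w) u" if "w \<in> W" for w u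
    using x[OF that] by (simp add: weight_torus_eq[OF ds that] functional_iff)
  have p: "p k w (?\<tau> u) = tchar r (c w) u powi k" if "w \<in> W" "u \<in> torus_points r" for k w u
  proof -
    have "tchar r (c w) (\<lambda>i. inverse (u i)) * tchar r (c w) u = 1"
    proof -
      have "tchar r (c w) (\<lambda>i. inverse (u i) * u i) = 1"
        unfolding tchar_def by (rule prod.neutral) (use that(2) in \<open>simp add: torus_points_iff\<close>)
      then show ?thesis by (simp add: tchar_mult)
    qed
    then have "tchar r (c w) (\<lambda>i. inverse (u i)) = inverse (tchar r (c w) u)"
      by (metis inverse_unique mult.commute)
    then show ?thesis
      by (simp add: p_def power_int_def weight_torus_inverse[OF ds that(2)] coefp[OF that(1)])
  qed
  have p_reg: "p k w \<in> GL_regular scale" if "w \<in> W" for k w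
    using GL_regular_cases(2,3)[OF x(2)[OF that]] unfolding p_def GL_regular_def
    by (auto intro: function_algebra_power)
  have prod: "(\<lambda>f. \<Prod>w\<in>W. p (k w) w f) \<in> GL_regular scale" for k
    using p_reg unfolding GL_regular_def by (intro function_algebra_prod) auto
  have val: "(\<Prod>w\<in>W. p (k w) w (?\<tau> u)) = tchar r (\<lambda>i. \<Sum>w\<in>W. k w * c w i) u" if "u \<in> torus_points r" for k u
    by (simp add: tchar_sum[OF that] p that)
  have delta: "tchar r (\<lambda>i. \<Sum>w\<in>W. (s * e j w) * c w i) u = u j powi s" if "j < r" for s j and u :: "nat \<Rightarrow> 'a"
  proof -
    have "tchar r (\<lambda>i. \<Sum>w\<in>W. (s * e j w) * c w i) u = (\<Prod>i<r. if i = j then u j powi s else 1)"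
      unfolding tchar_def
      by (rule prod.cong) (use e that in \<open>auto simp: mult.assoc sum_distrib_left[symmetric]\<close>)
    then show ?thesis using that by simp
  qed
  show "\<exists>p\<in>GL_regular scale. \<forall>t\<in>torus_points r. p (?\<tau> t) = t j" if "j < r" for j
    by (rule bexI[OF _ prod[of "\<lambda>w. 1 * e j w"]]) (simp add: val delta[OF that, of 1, simplified])
  show "\<exists>p\<in>GL_regular scale. \<forall>t\<in>torus_points r. p (?\<tau> t) = inverse (t j)" if "j < r" for j
    by (rule bexI[OF _ prod[of "\<lambda>w. (- 1) * e j w"]])
       (use delta[OF that, of "- 1"] in \<open>simp add: val power_int_minus\<close>)
qed (use weight_torus_mult[OF ds] weight_torus_one[OF ds] lin_weight_torus[OF ds] in auto)

end

context alg_closed_endomorphisms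
begin

text \<open>The derivation \<delta> restricts a regular function along the parametrization of the
  torus and differentiates at the identity in direction \<gamma>. The character with exponent
  \<open>c w\<close> contributes the sum of the \<gamma>(j) c(w, j), which is the eigenvalue on
  \<open>V w\<close>.\<close>

lemma lie_of_weight_torus:
  assumes ds: "direct_sum_of W V" and c: "\<And>w. w \<in> W \<Longrightarrow> c w \<in> exponents r"
  shows "diagonal_map W V (\<lambda>w. \<Sum>j<r. \<gamma> j * of_int (c w j)) \<in> lie_of_group scale (weight_torus r W V c ` torus_points r)"
proof -
  let ?\<tau> = "weight_torus r W V c"
  let ?D = "diagonal_map W V (\<lambda>w. \<Sum>j<r. \<gamma> j * of_int (c w j))"
  obtain L :: "((nat \<Rightarrow> 'a) \<Rightarrow> 'a) \<Rightarrow> 'a" where L: "\<And>f g. L (\<lambda>t. f t + g t) = L f + L g" "\<And>c f. L (\<lambda>t. c * f t) = c * L f"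
    "\<And>m. m \<in> exponents r \<Longrightarrow> L (on_torus r (tchar r m)) = (\<Sum>j<r. \<gamma> j * of_int (m j))"
    using torus_derivative_exists[of r \<gamma>] by blast
  have L0: "L (\<lambda>t. 0) = 0" using L(2)[of 0 "\<lambda>t. 0"] by simp
  have Lsum: "L (\<lambda>t. \<Sum>i\<in>I. h i t) = (\<Sum>i\<in>I. L (h i))" for I and h :: "'w \<Rightarrow> (nat \<Rightarrow> 'a) \<Rightarrow> 'a"
    by (induction I rule: infinite_finite_induct) (simp_all add: L0 L(1))
  define \<delta> where "\<delta> p = L (on_torus r (\<lambda>u. p (?\<tau> u)))" for p
  have coef: "(\<lambda>u. \<xi> (?\<tau> u x)) \<in> laurent r" if "functional \<xi>" for \<xi> x
    unfolding functional_weight_torus[OF that] using c by (intro laurent_sum laurent_char)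
  have tinv: "(\<lambda>u. f (\<lambda>i. inverse (u i))) \<in> laurent r" if f: "f \<in> laurent r" for f :: "(nat \<Rightarrow> 'a) \<Rightarrow> 'a"
  proof -
    obtain M d where M: "finite M" "M \<subseteq> exponents r" "\<And>t. t \<in> torus_points r \<Longrightarrow> f t = (\<Sum>m\<in>M. d m * tchar r m t)"
      using f unfolding laurent_def by blast
    have *: "(\<lambda>t. \<Sum>m\<in>M. d m * tchar r (- m) t) \<in> laurent r"
      using M(2) by (intro laurent_sum laurent_char) (auto simp: exponents_def)
    show ?thesis
      by (rule laurent_cong[OF *])
         (auto simp: M(3)[OF torus_points_inverse] tchar_def power_int_inverse power_int_minus)
  qed
  have lau: "(\<lambda>u. p (?\<tau> u)) \<in> laurent r" if "p \<in> GL_regular scale" for p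
    using that
  proof (induction rule: GL_regular_induct)
    case (const c)
    show ?case using laurent_char[of 0 r c] by (simp add: exponents_def)
  next
    case (coef \<xi> x)
    then show ?case by (rule \<open>\<And>\<xi> x. functional \<xi> \<Longrightarrow> (\<lambda>u. \<xi> (?\<tau> u x)) \<in> laurent r\<close>)
  next
    case (inverse \<xi> x)
    show ?case
      by (rule laurent_cong[OF tinv[OF coef[OF inverse, of x]]]) (simp add: weight_torus_inverse[OF ds])
  next
    case (add p q)
    then show ?case by (rule laurent_add)
  next
    case (mult p q)
    then show ?case by (rule laurent_mult)
  qed
  have "point_derivation_id scale \<delta>" unfolding point_derivation_id_def
  proof (intro conjI ballI allI)
    fix p q assume pq: "p \<in> GL_regular scale" "q \<in> GL_regular scale"
    have "on_torus r (\<lambda>u. p (?\<tau> u) + q (?\<tau> u)) = (\<lambda>u. on_torus r (\<lambda>u. p (?\<tau> u)) u + on_torus r (\<lambda>u. q (?\<tau> u)) u)"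
      by (auto simp: on_torus_def)
    then show "\<delta> (\<lambda>f. p f + q f) = \<delta> p + \<delta> q" by (simp only: \<delta>_def L(1))
    show "\<delta> (\<lambda>f. p f * q f) = p id * \<delta> q + \<delta> p * q id"
      using torus_derivative_mult[OF L lau[OF pq(1)] lau[OF pq(2)]]
      by (simp add: \<delta>_def weight_torus_one[OF ds])
  next
    fix a p assume "p \<in> GL_regular scale"
    have "on_torus r (\<lambda>u. a * p (?\<tau> u)) = (\<lambda>u. a * on_torus r (\<lambda>u. p (?\<tau> u)) u)"
      by (auto simp: on_torus_def)
    then show "\<delta> (\<lambda>f. a * p f) = a * \<delta> p" by (simp only: \<delta>_def L(2))
  qed
  moreover have "\<delta> (\<lambda>f. \<xi> (f x)) = \<xi> (?D x)" if "functional \<xi>" for \<xi> x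
  proof -
    have "on_torus r (\<lambda>u. \<xi> (?\<tau> u x)) = (\<lambda>u. \<Sum>w\<in>W. \<xi> (component W V w x) * on_torus r (tchar r (c w)) u)"
      by (auto simp: on_torus_def functional_weight_torus[OF that])
    then have "\<delta> (\<lambda>f. \<xi> (f x)) = (\<Sum>w\<in>W. \<xi> (component W V w x) * (\<Sum>j<r. \<gamma> j * of_int (c w j)))"
      using c by (simp add: \<delta>_def Lsum L(2,3))
    also have "\<dots> = \<xi> (?D x)"
      unfolding diagonal_map_def functional_sum[OF that] using that by (simp add: functional_iff mult.commute)
    finally show ?thesis .
  qed
  moreover have "\<delta> p = 0" if "\<forall>f\<in>?\<tau> ` torus_points r. p f = 0" for p
  proof -
    have "on_torus r (\<lambda>u. p (?\<tau> u)) = (\<lambda>u. 0)" using that by (auto simp: on_torus_def)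
    then show ?thesis by (simp add: \<delta>_def L0)
  qed
  ultimately show ?thesis
    unfolding lie_of_group_def using lin_diagonal_map[OF ds] by blast
qed

subsection \<open>The weight decomposition under a torus\<close>

text \<open>The coefficients of \<phi>(t) x are Laurent polynomials in \<open>t\<close>, so
  \<phi>(t) x is a finite sum of characters with vector coefficients. Comparing \<phi>(s) \<phi>(t)
  x with \<phi>(st) x shows that these are weight vectors, and t = 1 writes \<open>x\<close> as
  their sum.\<close>

lemma torus_decomposition:
  assumes T: "torus_of_dim scale n T"
  obtains \<phi> K where "\<phi> ` torus_points n = T" "\<And>t. t \<in> torus_points n \<Longrightarrow> lin (\<phi> t)"
    "K \<subseteq> exponents n" "direct_sum_of K (\<lambda>m. {x. \<forall>t\<in>torus_points n. \<phi> t x = scale (tchar n m t) x})"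
proof -
  obtain \<phi> where \<phi>: "\<phi> \<in> iso (mult_torus n) (GL scale\<lparr>carrier := T\<rparr>)"
    and reg: "\<forall>r \<in> GL_regular scale. \<exists>s \<in> mult_torus_regular n. \<forall>t \<in> torus_points n. r (\<phi> t) = s t"
    and sub: "subgroup T (GL scale)"
    using T unfolding torus_of_dim_def algebraic_subgroup_def by blast
  have im: "\<phi> ` torus_points n = T" using \<phi> by (simp add: iso_def bij_betw_def)
  have linT: "lin f" if "f \<in> T" for f
    using subgroup.subset[OF sub] that by (auto simp: carrier_GL)
  then have lin: "lin (\<phi> t)" if "t \<in> torus_points n" for t using im that by blast
  have mult: "\<phi> (\<lambda>i. s i * t i) = \<phi> s \<circ> \<phi> t" if "s \<in> torus_points n" "t \<in> torus_points n" for s t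
    using \<phi> that hom_mult[of \<phi> "mult_torus n" "GL scale\<lparr>carrier := T\<rparr>" s t]
    by (simp add: iso_def mult_mult_torus mult_GL)
  have "\<phi> (\<lambda>i. 1) = id"
  proof -
    have "group (GL scale\<lparr>carrier := T\<rparr>)" using subgroup.subgroup_is_group[OF sub group_GL] .
    then have "\<phi> \<one>\<^bsub>mult_torus n\<^esub> = \<one>\<^bsub>GL scale\<lparr>carrier := T\<rparr>\<^esub>"
      using hom_one[OF _ group_mult_torus] \<phi> unfolding iso_def by blast
    then show ?thesis by (simp add: one_mult_torus one_GL)
  qed
  let ?V = "\<lambda>m. {x. \<forall>t\<in>torus_points n. \<phi> t x = scale (tchar n m t) x}"
  have "x \<in> span (\<Union>m\<in>exponents n. ?V m)" for x
  proof -
    have "\<exists>M d. finite M \<and> M \<subseteq> exponents n \<and> (\<forall>t\<in>torus_points n. representation Basis (\<phi> t x) b = (\<Sum>m\<in>M. d m * tchar n m t))" for b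
    proof -
      have "functional (\<lambda>v. representation Basis v b)"
        by (rule linear_representation[OF independent_Basis span_Basis])
      from reg[rule_format, OF GL_regular_cases(2)[OF this, of x]]
      obtain s where "s \<in> mult_torus_regular n" "\<forall>t\<in>torus_points n. representation Basis (\<phi> t x) b = s t" by blast
      then show ?thesis using mult_torus_regular_laurent[of s n] unfolding laurent_def by auto
    qed
    then obtain M d where M: "\<And>b. finite (M b)" "\<And>b. M b \<subseteq> exponents n"
      "\<And>b t. t \<in> torus_points n \<Longrightarrow> representation Basis (\<phi> t x) b = (\<Sum>m\<in>M b. d b m * tchar n m t)" by metis
    define N where "N = (\<Union>b\<in>Basis. M b)"
    have N: "finite N" "N \<subseteq> exponents n" using M finite_Basis by (auto simp: N_def)
    \<comment> \<open>The vector coefficient of the character \<open>m\<close> in \<phi>(t) x,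
      assembled from its coordinates.\<close>
    define v where "v m = (\<Sum>b\<in>Basis. scale (if m \<in> M b then d b m else 0) b)" for m
    have ev: "\<phi> t x = (\<Sum>m\<in>N. scale (tchar n m t) (v m))" if t: "t \<in> torus_points n" for t
    proof -
      have "\<phi> t x = (\<Sum>b\<in>Basis. scale (representation Basis (\<phi> t x) b) b)"
        by (rule sum_representation[OF independent_Basis span_Basis, symmetric])
      also have "\<dots> = (\<Sum>b\<in>Basis. scale (\<Sum>m\<in>N. tchar n m t * (if m \<in> M b then d b m else 0)) b)"
      proof (rule sum.cong[OF refl])
        fix b assume "b \<in> Basis"
        then have "(\<Sum>m\<in>M b. d b m * tchar n m t) = (\<Sum>m\<in>N. tchar n m t * (if m \<in> M b then d b m else 0))"
          using N by (intro sum.mono_neutral_cong_left) (auto simp: N_def)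
        then show "scale (representation Basis (\<phi> t x) b) b = scale (\<Sum>m\<in>N. tchar n m t * (if m \<in> M b then d b m else 0)) b"
          by (simp add: M(3)[OF t])
      qed
      also have "\<dots> = (\<Sum>m\<in>N. scale (tchar n m t) (v m))"
        unfolding v_def scale_sum_left scale_sum_right scale_scale by (rule sum.swap)
      finally show ?thesis .
    qed
    have "v m \<in> ?V m" if m: "m \<in> N" for m
    proof -
      have "\<phi> s (v m) = scale (tchar n m s) (v m)" if s: "s \<in> torus_points n" for s
      proof -
        \<comment> \<open>Dedekind's lemma in the variable \<open>t\<close>, for fixed
          \<open>s\<close>.\<close>
        have "\<forall>m\<in>N. \<phi> s (v m) - scale (tchar n m s) (v m) = 0"
        proof (rule characters_independent[OF N(1), of n "tchar n"])
          show "\<exists>t\<in>torus_points n. tchar n m t \<noteq> (tchar n m' t :: 'a)" if "m \<in> N" "m' \<in> N" "m \<noteq> m'" for m m'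
            using tchar_distinct[of m n m'] that N(2) by blast
          show "(\<Sum>m\<in>N. scale (tchar n m t) (\<phi> s (v m) - scale (tchar n m s) (v m))) = 0"
            if t: "t \<in> torus_points n" for t
          proof -
            have "(\<Sum>m\<in>N. scale (tchar n m t) (\<phi> s (v m))) = \<phi> s (\<phi> t x)"
              by (simp add: ev[OF t] lin_sum[OF lin[OF s]] lin_scale[OF lin[OF s]])
            also have "\<dots> = \<phi> (\<lambda>i. s i * t i) x" by (simp add: mult[OF s t])
            also have "\<dots> = (\<Sum>m\<in>N. scale (tchar n m t) (scale (tchar n m s) (v m)))"
              by (simp add: ev[OF torus_points_mult[OF s t]] tchar_mult mult.commute)
            finally show ?thesis by (simp add: scale_right_diff_distrib sum_subtractf)
          qed
        qed (simp_all add: tchar_mult)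
        then show ?thesis using m by simp
      qed
      then show ?thesis by simp
    qed
    moreover have "x = sum v N" using ev[OF torus_points_one] \<open>\<phi> (\<lambda>i. 1) = id\<close> by simp
    moreover have "sum v N \<in> span (\<Union>m\<in>exponents n. ?V m)"
      by (rule span_sum, rule span_base) (use calculation N in blast)
    ultimately show ?thesis by simp
  qed
  then have "span (\<Union>m\<in>exponents n. ?V m) = UNIV" by blast
  then have "\<exists>K\<subseteq>exponents n. direct_sum_of K ?V \<and> (\<forall>m\<in>exponents n - K. ?V m = {0})"
    by (intro direct_sum_of_eigenspaces[of "torus_points n" \<phi> ?V "tchar n"])
       (use lin tchar_distinct in blast)+
  then show thesis using that im lin by blast
qed

end

section \<open>The weights of a maximal torus of a grading\<close>

locale graded_lie_algebra = fin_dim_lie_algebra scale bracket Basis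
  for scale :: "'k::{alg_closed_field,field_char_0} \<Rightarrow> 'l::ab_group_add \<Rightarrow> 'l" and bracket and Basis +
  fixes G :: "('g, 'm) monoid_scheme" and \<Gamma> :: "'g \<Rightarrow> 'l set" and T :: "('l \<Rightarrow> 'l) set" and H :: "'l set"
  assumes semisimple: semisimple and comm_group_G: "comm_group G" and grading: "grading G \<Gamma>"
    and maximal: "maximal_torus scale (Stab G \<Gamma>) T" and H_eq: "H = lie_subalgebra_of T"
begin

section \<open>The grading as a finite direct sum\<close>

lemma grading_direct_sum: "\<exists>K\<subseteq>carrier G. direct_sum_of K \<Gamma> \<and> (\<forall>g\<in>carrier G - K. \<Gamma> g = {0})"
proof (rule direct_sum_of_finite)
  have dec: "\<exists>!c. (\<forall>g\<in>carrier G. c g \<in> \<Gamma> g) \<and> (\<forall>g. g \<notin> carrier G \<longrightarrow> c g = 0) \<and>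
               finite {g. c g \<noteq> 0} \<and> x = (\<Sum>g | c g \<noteq> 0. c g)" for x
    using grading unfolding grading_def by blast
  show sub: "subspace (\<Gamma> g)" if "g \<in> carrier G" for g
    using grading that unfolding grading_def by blast
  have "x \<in> span (\<Union>g\<in>carrier G. \<Gamma> g)" for x
  proof -
    obtain c where c: "\<forall>g\<in>carrier G. c g \<in> \<Gamma> g" "\<forall>g. g \<notin> carrier G \<longrightarrow> c g = 0" "x = (\<Sum>g | c g \<noteq> 0. c g)"
      using ex1_implies_ex[OF dec[of x]] by blast
    show ?thesis unfolding c(3) by (intro span_sum span_base) (use c in blast)
  qed
  then show "span (\<Union>g\<in>carrier G. \<Gamma> g) = UNIV" by blast
  show "\<forall>i\<in>K. c i = 0"
    if K: "finite K" "K \<subseteq> carrier G" "\<And>i. i \<in> K \<Longrightarrow> c i \<in> \<Gamma> i" "sum c K = 0" for K c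
  proof -
    let ?c = "\<lambda>g. if g \<in> K then c g else 0"
    have 1: "sum c K = (\<Sum>g | ?c g \<noteq> 0. ?c g)"
      using K(1) by (intro sum.mono_neutral_cong_right) auto
    define P where "P c \<longleftrightarrow> (\<forall>g\<in>carrier G. c g \<in> \<Gamma> g) \<and> (\<forall>g. g \<notin> carrier G \<longrightarrow> c g = 0) \<and>
        finite {g. c g \<noteq> 0} \<and> 0 = (\<Sum>g | c g \<noteq> 0. c g)" for c
    have "P ?c" unfolding P_def
    proof (intro conjI)
      show "finite {g. ?c g \<noteq> 0}" by (rule finite_subset[OF _ K(1)]) auto
      show "0 = (\<Sum>g | ?c g \<noteq> 0. ?c g)" using 1 K(4) by simp
    qed (use K(2,3) subspace_0[OF sub] in auto)
    moreover have "P (\<lambda>g. 0)" using subspace_0[OF sub] by (simp add: P_def)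
    moreover have "\<exists>!c. P c" using dec[of 0] by (simp only: P_def)
    then have "c1 = c2" if "P c1" "P c2" for c1 c2 using that by (elim ex1E) metis
    ultimately have c0: "?c = (\<lambda>g. 0)" by (simp only:)
    have "c i = 0" if "i \<in> K" for i using fun_cong[OF c0, of i] that by simp
    then show ?thesis by blast
  qed
qed

definition supp :: "'g set" where
  "supp = (SOME K. K \<subseteq> carrier G \<and> direct_sum_of K \<Gamma> \<and> (\<forall>g\<in>carrier G - K. \<Gamma> g = {0}))"

lemma supp: "supp \<subseteq> carrier G" "direct_sum_of supp \<Gamma>" "g \<in> carrier G \<Longrightarrow> g \<notin> supp \<Longrightarrow> \<Gamma> g = {0}"
  using someI_ex[OF grading_direct_sum] unfolding supp_def[symmetric] by auto

lemma subspace_grading: "g \<in> carrier G \<Longrightarrow> subspace (\<Gamma> g)"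
  using grading unfolding grading_def by blast

lemma grading_bracket:
  "g \<in> carrier G \<Longrightarrow> h \<in> carrier G \<Longrightarrow> x \<in> \<Gamma> g \<Longrightarrow> y \<in> \<Gamma> h \<Longrightarrow> bracket x y \<in> \<Gamma> (g \<otimes>\<^bsub>G\<^esub> h)"
  using grading unfolding grading_def by blast

abbreviation part :: "'g \<Rightarrow> 'l \<Rightarrow> 'l" where
  "part \<equiv> component supp \<Gamma>"

definition graded_map :: "('l \<Rightarrow> 'l) \<Rightarrow> bool" where
  "graded_map A \<longleftrightarrow> lin A \<and> (\<forall>g\<in>carrier G. \<forall>x\<in>\<Gamma> g. A x \<in> \<Gamma> g)"

lemma graded_map_commute: "graded_map A \<Longrightarrow> g \<in> supp \<Longrightarrow> part g (A x) = A (part g x)"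
  using component_commute[OF supp(2)] supp(1) unfolding graded_map_def by blast

lemma graded_mapI:
  assumes "lin A" "\<And>g x. g \<in> supp \<Longrightarrow> part g (A x) = A (part g x)"
  shows "graded_map A"
  unfolding graded_map_def
proof (intro conjI ballI)
  fix g x assume g: "g \<in> carrier G" "x \<in> \<Gamma> g"
  show "A x \<in> \<Gamma> g"
  proof (cases "g \<in> supp")
    case True
    have "part g (A x) = A x" using assms(2)[OF True] component_same[OF supp(2) True g(2) True] by simp
    then show ?thesis using component_in[OF supp(2) True, of "A x"] by simp
  next
    case False
    then have "x = 0" using supp(3) g by blast
    then show ?thesis using assms(1) g subspace_0[OF subspace_grading] by (simp add: lin_0)
  qed
qed (rule assms(1))

lemma T_torus: "\<exists>n. torus_of_dim scale n T" and T_sub: "T \<subseteq> Stab G \<Gamma>"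
  and T_max: "torus_of_dim scale n T' \<Longrightarrow> T \<subseteq> T' \<Longrightarrow> T' \<subseteq> Stab G \<Gamma> \<Longrightarrow> T' = T"
  using maximal unfolding maximal_torus_def by blast+

lemma T_automorphism:
  assumes "\<tau> \<in> T"
  shows "lin \<tau>" "bij \<tau>" "\<tau> (bracket x y) = bracket (\<tau> x) (\<tau> y)" "graded_map \<tau>"
proof -
  have t: "\<tau> \<in> Stab G \<Gamma>" using assms T_sub by blast
  show l: "lin \<tau>" and "bij \<tau>" and "\<tau> (bracket x y) = bracket (\<tau> x) (\<tau> y)"
    using t by (auto simp: Stab_def Aut_def carrier_GL)
  show "graded_map \<tau>" using t l by (auto simp: graded_map_def Stab_def)
qed

text \<open>The weights of \<open>T\<close> and the semisimple part \<open>S\<close> are pairs in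
  Z^n x k. If \<beta>(0), ..., \<beta>(r-1) is a basis of the group they generate, the torus of rank
  \<open>r\<close> acts on the joint weight space of \<open>p\<close> through the coordinates of
  \<open>p\<close>. It contains \<open>T\<close> by the first entries of the basis, and its tangent
  vector with coordinates the second entries is \<open>S\<close>.\<close>

lemma spectral_map_in_lie:
  assumes D: "derivation D" and comm: "\<And>\<tau> x. \<tau> \<in> T \<Longrightarrow> \<tau> (D x) = D (\<tau> x)" and gr: "graded_map D"
  shows "spectral_map (\<lambda>a. a) D \<in> lie_of_group scale T"
proof -
  have LD: "lin D" using D by (simp add: derivation_def)
  define S where "S = spectral_map (\<lambda>a. a) D"
  have S: "derivation S" unfolding S_def by (rule derivation_spectral_map[OF D]) simp
  then have LS: "lin S" by (simp add: derivation_def)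
  have S_comm: "S (\<tau> x) = \<tau> (S x)" if "\<tau> \<in> T" for \<tau> x
    unfolding S_def by (rule spectral_map_commute[OF LD T_automorphism(1)[OF that]]) (simp add: comm[OF that])
  have S_part: "S (part g x) = part g (S x)" if "g \<in> supp" for g x
    unfolding S_def
    by (rule spectral_map_commute[OF LD lin_component[OF supp(2) that]]) (simp add: graded_map_commute[OF gr that])
  obtain n where "torus_of_dim scale n T" using T_torus by blast
  then obtain \<phi> K where \<phi>: "\<phi> ` torus_points n = T" "\<And>t. t \<in> torus_points n \<Longrightarrow> lin (\<phi> t)"
    and K: "K \<subseteq> exponents n" "direct_sum_of K (\<lambda>m. {x. \<forall>t\<in>torus_points n. \<phi> t x = scale (tchar n m t) x})"
    by (rule torus_decomposition) (rule that)
  let ?L = "\<lambda>m. {x. \<forall>t\<in>torus_points n. \<phi> t x = scale (tchar n m t) x}"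
  have \<phi>T: "\<phi> t \<in> T" if "t \<in> torus_points n" for t using \<phi>(1) that by blast
  \<comment> \<open>The torus points and one further index for \<open>S\<close>, so that all
    operators form a single family of commuting diagonalizable maps.\<close>
  define I where "I = Inl ` torus_points n \<union> {Inr () :: (nat \<Rightarrow> 'k) + unit}"
  define A where "A i = (case i of Inl t \<Rightarrow> \<phi> t | Inr _ \<Rightarrow> S)" for i :: "(nat \<Rightarrow> 'k) + unit"
  define ev where "ev p i = (case i of Inl t \<Rightarrow> tchar n (fst p) t | Inr _ \<Rightarrow> snd p)"
    for p :: "(nat \<Rightarrow> int) \<times> 'k" and i :: "(nat \<Rightarrow> 'k) + unit"
  define V where "V p = {x. \<forall>i\<in>I. A i x = scale (ev p i) x}" for p
  have V: "x \<in> V p \<longleftrightarrow> (\<forall>t\<in>torus_points n. \<phi> t x = scale (tchar n (fst p) t) x) \<and> S x = scale (snd p) x" for x p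
    by (auto simp: V_def I_def A_def ev_def)
  define J where "J = exponents n \<times> (UNIV :: 'k set)"
  have "x \<in> span (\<Union>p\<in>J. V p)" for x
  proof -
    have "component (spectrum D) (gen_eigenspace D) a (component K ?L m x) \<in> span (\<Union>p\<in>J. V p)"
      if "m \<in> K" "a \<in> spectrum D" for m a
    proof (intro span_base UN_I[of "(m, a)"])
      let ?P = "component (spectrum D) (gen_eigenspace D) a"
      have "\<phi> t (?P (component K ?L m x)) = scale (tchar n m t) (?P (component K ?L m x))"
        if t: "t \<in> torus_points n" for t
      proof -
        have "?P (\<phi> t (component K ?L m x)) = \<phi> t (?P (component K ?L m x))"
        proof (rule component_commute[OF direct_sum_spectrum[OF LD] \<phi>(2)[OF t] _ \<open>a \<in> spectrum D\<close>])
          show "\<phi> t y \<in> gen_eigenspace D b" if "y \<in> gen_eigenspace D b" for b y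
            by (rule gen_eigenspace_commute[OF \<phi>(2)[OF t] _ that]) (simp add: comm[OF \<phi>T[OF t]])
        qed
        moreover have "component K ?L m x \<in> ?L m" by (rule component_in[OF K(2) \<open>m \<in> K\<close>])
        ultimately show ?thesis
          using t by (simp add: lin_scale[OF lin_component[OF direct_sum_spectrum[OF LD] \<open>a \<in> spectrum D\<close>]])
      qed
      moreover have "S (?P (component K ?L m x)) = scale a (?P (component K ?L m x))"
        unfolding S_def
        by (rule spectral_map_eq[OF LD component_in[OF direct_sum_spectrum[OF LD] \<open>a \<in> spectrum D\<close>]])
      ultimately show "?P (component K ?L m x) \<in> V (m, a)" by (simp add: V)
    qed (use K(1) that in \<open>auto simp: J_def\<close>)
    then have "(\<Sum>m\<in>K. \<Sum>a\<in>spectrum D. component (spectrum D) (gen_eigenspace D) a (component K ?L m x)) \<in> span (\<Union>p\<in>J. V p)"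
      by (intro span_sum)
    then show ?thesis by (simp add: sum_component[OF direct_sum_spectrum[OF LD]] sum_component[OF K(2)])
  qed
  then have gen: "span (\<Union>p\<in>J. V p) = UNIV" by blast
  have "\<exists>W\<subseteq>J. direct_sum_of W V \<and> (\<forall>p\<in>J - W. V p = {0})"
  proof (rule direct_sum_of_eigenspaces[OF _ V_def _ gen])
    show "lin (A i)" if "i \<in> I" for i using that \<phi>(2) LS by (auto simp: I_def A_def)
    show "\<exists>i\<in>I. ev p i \<noteq> ev q i" if pq: "p \<in> J" "q \<in> J" "p \<noteq> q" for p q
    proof (cases "fst p = fst q")
      case True
      then have "ev p (Inr ()) \<noteq> ev q (Inr ())" using pq by (auto simp: ev_def prod_eq_iff)
      then show ?thesis by (auto simp: I_def)
    next
      case False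
      then obtain t where "t \<in> torus_points n" "tchar n (fst p) t \<noteq> (tchar n (fst q) t :: 'k)"
        using tchar_distinct[where 'k='k, of "fst p" n "fst q"] pq unfolding J_def mem_Times_iff by blast
      then show ?thesis by (intro bexI[of _ "Inl t"]) (auto simp: I_def ev_def)
    qed
  qed
  then obtain W0 where W0: "W0 \<subseteq> J" "direct_sum_of W0 V" "\<forall>p\<in>J - W0. V p = {0}" by blast
  define W where "W = {p\<in>W0. V p \<noteq> {0}}"
  have W: "W \<subseteq> J" "direct_sum_of W V" "\<And>p. p \<in> J \<Longrightarrow> p \<notin> W \<Longrightarrow> V p = {0}" "\<And>p. p \<in> W \<Longrightarrow> V p \<noteq> {0}"
    using W0 direct_sum_of_nonzero[OF W0(2)] by (auto simp: W_def)
  have V_bracket: "bracket x y \<in> V (p + q)" if x: "x \<in> V p" and y: "y \<in> V q" for x y p q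
  proof -
    have "\<phi> t (bracket x y) = scale (tchar n (fst (p + q)) t) (bracket x y)" if t: "t \<in> torus_points n" for t
    proof -
      have "\<phi> t (bracket x y) = bracket (\<phi> t x) (\<phi> t y)" by (rule T_automorphism(3)[OF \<phi>T[OF t]])
      then show ?thesis using x y t
        by (simp add: V tchar_add[OF t] bracket_scale_left bracket_scale_right mult.commute)
    qed
    moreover have "S (bracket x y) = scale (snd (p + q)) (bracket x y)"
      using S x y by (simp add: derivation_def V bracket_scale_left bracket_scale_right scale_left_distrib)
    ultimately show ?thesis by (simp add: V)
  qed
  \<comment> \<open>Integer multiples in Z^n x k; characteristic 0 makes this module torsion-free,
    as \<open>lattice_basis\<close> demands.\<close>
  define sc where "sc k p = ((\<lambda>i. k * fst p i), of_int k * snd p)" for k :: int and p :: "(nat \<Rightarrow> int) \<times> 'k"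
  have "Modules.module sc"
    by (rule Modules.module.intro) (auto simp: sc_def prod_eq_iff fun_eq_iff distrib_left distrib_right mult.assoc)
  then interpret z: Modules.module sc .
  have tf: "k = 0 \<or> p = 0" if "sc k p = 0" for k p
  proof -
    have "(\<lambda>i. k * fst p i) = 0" "of_int k * snd p = 0" using that by (auto simp: sc_def zero_prod_def)
    then show ?thesis by (auto simp: prod_eq_iff fun_eq_iff)
  qed
  obtain B where B: "finite B" "z.independent B" "z.span B = z.span W"
    using lattice_basis[OF z.module_axioms tf direct_sum_ofD(1)[OF W(2)]] by blast
  obtain \<beta> where \<beta>: "bij_betw \<beta> {..<card B} B" using ex_bij_betw_nat_finite[OF B(1)] by (auto simp: lessThan_atLeast0)
  define r where "r = card B"
  have \<beta>B: "\<beta> j \<in> B" if "j < r" for j using \<beta> that by (auto simp: r_def bij_betw_def)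
  have \<beta>_inj: "\<beta> i = \<beta> j \<longleftrightarrow> i = j" if "i < r" "j < r" for i j
    using \<beta> that by (auto simp: r_def bij_betw_def inj_on_def)
  \<comment> \<open>Lattice coordinates of the weight \<open>p\<close>, padded with 0 to be an
    exponent vector.\<close>
  define c where "c p j = (if j < r then z.representation B p (\<beta> j) else 0)" for p j
  have Wspan: "p \<in> z.span B" if "p \<in> W" for p
    unfolding B(3) by (rule z.span_base[OF that])
  have sum_c: "(\<Sum>j<r. sc (c p j) (\<beta> j)) = p" if "p \<in> W" for p
  proof -
    have "(\<Sum>j<r. sc (c p j) (\<beta> j)) = (\<Sum>j\<in>{..<card B}. sc (z.representation B p (\<beta> j)) (\<beta> j))"
      by (rule sum.cong) (auto simp: c_def r_def)
    also have "\<dots> = (\<Sum>b\<in>B. sc (z.representation B p b) b)"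
      by (rule sum.reindex_bij_betw[OF \<beta>])
    also have "\<dots> = p" using B Wspan[OF that] by (intro z.sum_representation_eq) auto
    finally show ?thesis .
  qed
  have fst_c: "fst p = (\<lambda>i. \<Sum>j<r. c p j * fst (\<beta> j) i)" and snd_c: "snd p = (\<Sum>j<r. snd (\<beta> j) * of_int (c p j))"
    if "p \<in> W" for p
  proof -
    have "fst p = fst (\<Sum>j<r. sc (c p j) (\<beta> j))" "snd p = snd (\<Sum>j<r. sc (c p j) (\<beta> j))"
      by (simp_all only: sum_c[OF that])
    then show "fst p = (\<lambda>i. \<Sum>j<r. c p j * fst (\<beta> j) i)" "snd p = (\<Sum>j<r. snd (\<beta> j) * of_int (c p j))"
      by (auto simp: fst_sum snd_sum sc_def sum_fun_apply mult.commute)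
  qed
  \<comment> \<open>The basis lies in the group generated by the weights; the coefficients form the
    matrix that \<open>torus_of_weights\<close> asks for.\<close>
  have "\<exists>e. \<beta> j = (\<Sum>p\<in>W. sc (e p) p)" if "j < r" for j
  proof -
    have "\<beta> j \<in> z.span W" unfolding B(3)[symmetric] by (rule z.span_base[OF \<beta>B[OF that]])
    then show ?thesis unfolding z.span_finite[OF direct_sum_ofD(1)[OF W(2)]] by blast
  qed
  then obtain e where e: "\<And>j. j < r \<Longrightarrow> \<beta> j = (\<Sum>p\<in>W. sc (e j p) p)" by metis
  have e_delta: "(\<Sum>p\<in>W. e j p * c p i) = (if i = j then 1 else 0)" if "i < r" "j < r" for i j
  proof -
    have "z.representation B (\<beta> j) (\<beta> i) = (\<Sum>p\<in>W. z.representation B (sc (e j p) p) (\<beta> i))"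
      unfolding e[OF that(2)] by (rule z.representation_sum[THEN fun_cong]) (use B Wspan z.span_scale in auto)
    also have "\<dots> = (\<Sum>p\<in>W. e j p * c p i)"
      by (rule sum.cong) (use B Wspan that in \<open>auto simp: z.representation_scale c_def\<close>)
    finally show ?thesis
      using z.representation_basis[OF B(2) \<beta>B[OF that(2)]] \<beta>_inj[OF that] by auto
  qed
  have c_add: "c (p + q) = c p + c q" if "p \<in> W" "q \<in> W" for p q
    using z.representation_add[OF B(2) Wspan[OF that(2)] Wspan[OF that(1)]] by (intro ext) (simp add: c_def)
  let ?\<tau> = "weight_torus r W V c"
  let ?T = "?\<tau> ` torus_points r"
  note ds = W(2)
  have torus: "torus_of_dim scale r ?T" by (rule torus_of_weights[OF ds W(4) e_delta])
  \<comment> \<open>Lattice coordinates are additive, and the bracket adds weights. If the sum of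
    two weights does not occur, the bracket is zero and both sides vanish.\<close>
  have aut: "?\<tau> u (bracket x y) = bracket (?\<tau> u x) (?\<tau> u y)" if u: "u \<in> torus_points r" for u x y
  proof -
    have *: "?\<tau> u (bracket x y) = bracket (?\<tau> u x) (?\<tau> u y)" if pq: "p \<in> W" "q \<in> W" "x \<in> V p" "y \<in> V q" for p q x y
    proof (cases "p + q \<in> W")
      case True
      then show ?thesis
        using weight_torus_eq[OF ds True V_bracket[OF pq(3,4)]] weight_torus_eq[OF ds pq(1,3)] weight_torus_eq[OF ds pq(2,4)]
        by (simp add: c_add[OF pq(1,2)] tchar_add[OF u] bracket_scale_left bracket_scale_right mult.commute)
    next
      case False
      have "p \<in> J" "q \<in> J" using pq W(1) by blast+
      then have "p + q \<in> J" by (simp add: J_def mem_Times_iff exponents_add)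
      then have "bracket x y = 0" using W(3)[OF _ False] V_bracket[OF pq(3,4)] by auto
      then show ?thesis
        using weight_torus_eq[OF ds pq(1,3)] weight_torus_eq[OF ds pq(2,4)]
        by (simp add: lin_0[OF lin_weight_torus[OF ds]] bracket_scale_left bracket_scale_right)
    qed
    have **: "?\<tau> u (bracket x y) = bracket (?\<tau> u x) (?\<tau> u y)" if "q \<in> W" "y \<in> V q" for q x y
      by (rule direct_sum_eqI[OF ds lin_comp[OF lin_weight_torus[OF ds] lin_bracket_left]
            lin_comp[OF lin_bracket_left lin_weight_torus[OF ds]]]) (rule *[OF _ that(1) _ that(2)])
    show ?thesis
      by (rule direct_sum_eqI[OF ds lin_comp[OF lin_weight_torus[OF ds] lin_bracket]
            lin_comp[OF lin_bracket lin_weight_torus[OF ds]]]) (rule **)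
  qed
  have gr\<tau>: "graded_map (?\<tau> u)" for u
  proof (rule graded_mapI[OF lin_weight_torus[OF ds]])
    fix g x assume g: "g \<in> supp"
    note L = lin_component[OF supp(2) g]
    have "?\<tau> u (part g x) = part g (?\<tau> u x)" unfolding weight_torus_def
    proof (rule diagonal_map_commute[OF ds L])
      fix p x assume "p \<in> W" "x \<in> V p"
      then show "part g x \<in> V p" unfolding V
        using graded_map_commute[OF T_automorphism(4)[OF \<phi>T] g] S_part[OF g] by (metis lin_scale[OF L])
    qed
    then show "part g (?\<tau> u x) = ?\<tau> u (part g x)" by simp
  qed
  have GL: "?T \<subseteq> carrier (GL scale)"
    using torus subgroup.subset unfolding torus_of_dim_def algebraic_subgroup_def by blast
  have "?T \<subseteq> Stab G \<Gamma>"
  proof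
    fix f assume "f \<in> ?T"
    then obtain u where u: "u \<in> torus_points r" "f = ?\<tau> u" by blast
    have "f ` \<Gamma> g = \<Gamma> g" if g: "g \<in> carrier G" for g
    proof
      show "f ` \<Gamma> g \<subseteq> \<Gamma> g" using gr\<tau> g by (auto simp: graded_map_def u(2))
      show "\<Gamma> g \<subseteq> f ` \<Gamma> g"
      proof
        fix x assume x: "x \<in> \<Gamma> g"
        have "bij (?\<tau> u)" using GL u(1) carrier_GL by blast
        then have "x = ?\<tau> u (?\<tau> (\<lambda>i. inverse (u i)) x)"
          unfolding weight_torus_inverse[OF ds u(1), symmetric] by (simp add: bij_is_surj surj_f_inv_f)
        moreover have "?\<tau> (\<lambda>i. inverse (u i)) x \<in> \<Gamma> g" using gr\<tau> g x by (auto simp: graded_map_def)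
        ultimately show "x \<in> f ` \<Gamma> g" unfolding u(2) by blast
      qed
    qed
    then show "f \<in> Stab G \<Gamma>" using GL \<open>f \<in> ?T\<close> aut[OF u(1)] by (auto simp: Stab_def Aut_def u(2))
  qed
  moreover have "T \<subseteq> ?T"
  proof
    fix f assume "f \<in> T"
    then obtain t where t: "t \<in> torus_points n" "f = \<phi> t" using \<phi>(1) by blast
    \<comment> \<open>The point of the larger torus corresponding to \<open>t\<close>: its
      coordinates are the character parts of the basis evaluated at \<open>t\<close>.\<close>
    define u where "u j = (if j < r then tchar n (fst (\<beta> j)) t else 1)" for j
    have u: "u \<in> torus_points r" using tchar_nonzero[OF t(1)] by (auto simp: torus_points_iff u_def)
    have "f x = ?\<tau> u x" for x
    proof (rule direct_sum_eqI[OF ds _ lin_weight_torus[OF ds]])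
      show "lin f" using \<phi>(2) t by simp
      fix p x assume p: "p \<in> W" "x \<in> V p"
      have "tchar n (fst p) t = (\<Prod>j<r. tchar n (fst (\<beta> j)) t powi c p j)"
        by (subst fst_c[OF p(1)]) (rule tchar_sum[OF t(1)])
      also have "\<dots> = tchar r (c p) u" unfolding tchar_def[of r] by (rule prod.cong) (auto simp: u_def)
      finally show "f x = ?\<tau> u x" using p t by (simp add: weight_torus_eq[OF ds p] V)
    qed
    then show "f \<in> ?T" using u by (metis ext imageI)
  qed
  ultimately have T: "?T = T" using T_max[OF torus] by blast
  \<comment> \<open>Differentiating the larger torus in the direction of the second entries of the
    basis recovers the eigenvalue \<open>snd p\<close> on \<open>V p\<close>.\<close>
  have "S x = diagonal_map W V (\<lambda>p. \<Sum>j<r. snd (\<beta> j) * of_int (c p j)) x" for x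
  proof (rule direct_sum_eqI[OF ds LS lin_diagonal_map[OF ds]])
    fix p x assume p: "p \<in> W" "x \<in> V p"
    then show "S x = diagonal_map W V (\<lambda>p. \<Sum>j<r. snd (\<beta> j) * of_int (c p j)) x"
      by (simp add: diagonal_map_eq[OF ds p] V flip: snd_c)
  qed
  then have "S = diagonal_map W V (\<lambda>p. \<Sum>j<r. snd (\<beta> j) * of_int (c p j))" ..
  moreover have "c p \<in> exponents r" for p by (simp add: exponents_def c_def)
  ultimately have "S \<in> lie_of_group scale ?T" using lie_of_weight_torus[OF ds, of c r] by simp
  then show ?thesis by (simp only: T S_def)
qed

end

context graded_lie_algebra
begin

subsection \<open>The centralizer of the torus in the identity component\<close>

text \<open>Characters are taken as functions on \<open>T\<close> itself, which frees the rest of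
  the argument from a parametrization of the torus.\<close>

definition chi_space :: "(('l \<Rightarrow> 'l) \<Rightarrow> 'k) \<Rightarrow> 'l set" where
  "chi_space \<chi> = {x. \<forall>\<tau>\<in>T. \<tau> x = scale (\<chi> \<tau>) x}"

lemma chi_spaceD: "x \<in> chi_space \<chi> \<Longrightarrow> \<tau> \<in> T \<Longrightarrow> \<tau> x = scale (\<chi> \<tau>) x"
  by (simp add: chi_space_def)

text \<open>Characters are normalized to 0 off \<open>T\<close>, so that two different ones already
  differ at a point of \<open>T\<close>.\<close>

lemma span_chi_space: "span (\<Union>\<chi>\<in>{\<chi>. \<forall>\<tau>. \<tau> \<notin> T \<longrightarrow> \<chi> \<tau> = 0}. chi_space \<chi>) = UNIV" (is "span ?U = UNIV")
proof -
  obtain n where "torus_of_dim scale n T" using T_torus by blast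
  then obtain \<phi> K where \<phi>: "\<phi> ` torus_points n = T"
    and K: "K \<subseteq> exponents n" "direct_sum_of K (\<lambda>m. {x. \<forall>t\<in>torus_points n. \<phi> t x = scale (tchar n m t) x})"
    by (rule torus_decomposition) (rule that)
  let ?L = "\<lambda>m. {x. \<forall>t\<in>torus_points n. \<phi> t x = scale (tchar n m t) x}"
  define \<chi> where "\<chi> m \<tau> = (if \<tau> \<in> T then tchar n m (inv_into (torus_points n) \<phi> \<tau>) else 0)" for m \<tau>
  have L: "?L m \<subseteq> ?U" for m
  proof
    fix x assume x: "x \<in> ?L m"
    have "\<tau> x = scale (\<chi> m \<tau>) x" if "\<tau> \<in> T" for \<tau>
    proof -
      have "\<tau> \<in> \<phi> ` torus_points n" using that \<phi> by simp
      then have "inv_into (torus_points n) \<phi> \<tau> \<in> torus_points n" "\<phi> (inv_into (torus_points n) \<phi> \<tau>) = \<tau>"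
        by (rule inv_into_into, rule f_inv_into_f)
      then show ?thesis using x that by (auto simp: \<chi>_def)
    qed
    moreover have "\<forall>\<tau>. \<tau> \<notin> T \<longrightarrow> \<chi> m \<tau> = 0" by (simp add: \<chi>_def)
    ultimately show "x \<in> ?U" unfolding chi_space_def by blast
  qed
  have "(\<Sum>m\<in>K. component K ?L m x) \<in> span ?U" for x
  proof (intro span_sum span_base)
    fix m assume "m \<in> K"
    show "component K ?L m x \<in> ?U" by (rule subsetD[OF L[of m] component_in[OF K(2) \<open>m \<in> K\<close>]])
  qed
  then show ?thesis by (auto simp: sum_component[OF K(2)])
qed

definition chars :: "(('l \<Rightarrow> 'l) \<Rightarrow> 'k) set" where
  "chars = (SOME K. direct_sum_of K chi_space)"

lemma chars: "direct_sum_of chars chi_space"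
proof -
  let ?J = "{\<chi>. \<forall>\<tau>. \<tau> \<notin> T \<longrightarrow> \<chi> \<tau> = (0::'k)}"
  have "\<exists>K\<subseteq>?J. direct_sum_of K chi_space \<and> (\<forall>\<chi>\<in>?J - K. chi_space \<chi> = {0})"
  proof (rule direct_sum_of_eigenspaces[of T "\<lambda>\<tau>. \<tau>" chi_space "\<lambda>\<chi>. \<chi>", OF _ _ _ span_chi_space])
    show "\<exists>\<tau>\<in>T. \<chi> \<tau> \<noteq> \<psi> \<tau>" if ne: "\<chi> \<in> ?J" "\<psi> \<in> ?J" "\<chi> \<noteq> \<psi>" for \<chi> \<psi>
    proof -
      obtain \<tau> where "\<chi> \<tau> \<noteq> \<psi> \<tau>" using ne(3) by auto
      moreover from this have "\<tau> \<in> T" using ne(1,2) by fastforce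
      ultimately show ?thesis by blast
    qed
  qed (simp_all add: T_automorphism chi_space_def)
  then have "\<exists>K. direct_sum_of K chi_space" by blast
  then show ?thesis unfolding chars_def by (rule someI_ex)
qed

lemma subspace_chi_space: "subspace (chi_space \<chi>)"
  unfolding chi_space_def using subspace_eigenspace[of T "\<lambda>\<tau>. \<tau>" \<chi>] T_automorphism(1) by simp

lemma part_eq:
  assumes "g \<in> supp" "k \<in> carrier G" "x \<in> \<Gamma> k"
  shows "part g x = (if g = k then x else 0)"
proof (cases "k \<in> supp")
  case True
  then show ?thesis using component_same[OF supp(2) True assms(3,1)] by simp
next
  case False
  then have "x = 0" using supp(3) assms by blast
  then show ?thesis using lin_0[OF lin_component[OF supp(2) assms(1)]] by simp
qed

lemma part_chi_space: "g \<in> supp \<Longrightarrow> x \<in> chi_space \<chi> \<Longrightarrow> part g x \<in> chi_space \<chi>"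
  unfolding chi_space_def using graded_map_commute[OF T_automorphism(4)] lin_scale[OF lin_component[OF supp(2)]]
  by (auto simp flip: graded_map_commute[OF T_automorphism(4)])

section \<open>Tangent vectors of the torus and its character spaces\<close>

lemma point_derivation:
  assumes "point_derivation_id scale \<delta>" "r \<in> GL_regular scale" "s \<in> GL_regular scale"
  shows point_derivation_add: "\<delta> (\<lambda>f. r f + s f) = \<delta> r + \<delta> s"
    and point_derivation_mult: "\<delta> (\<lambda>f. r f * s f) = r id * \<delta> s + \<delta> r * s id"
    and point_derivation_scale: "\<delta> (\<lambda>f. c * r f) = c * \<delta> r"
  using assms unfolding point_derivation_id_def by simp_all

lemma lie_of_group_derivation:
  assumes "D \<in> lie_of_group scale T"
  obtains \<delta> where "point_derivation_id scale \<delta>" "\<And>\<xi> x. functional \<xi> \<Longrightarrow> \<delta> (\<lambda>f. \<xi> (f x)) = \<xi> (D x)"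
    "\<And>r. r \<in> GL_regular scale \<Longrightarrow> \<forall>f\<in>T. r f = 0 \<Longrightarrow> \<delta> r = 0"
  using assms unfolding lie_of_group_def by blast

text \<open>A functional vanishing on \<open>W\<close> yields a regular function vanishing on
  \<open>T\<close>, which the point derivation must kill; functionals separate points from
  subspaces.\<close>

lemma lie_of_group_invariant:
  assumes D: "D \<in> lie_of_group scale T" and W: "subspace W" "\<And>f. f \<in> T \<Longrightarrow> f x \<in> W"
  shows "D x \<in> W"
proof -
  obtain \<delta> where \<delta>: "\<And>\<xi> x. functional \<xi> \<Longrightarrow> \<delta> (\<lambda>f. \<xi> (f x)) = \<xi> (D x)"
    "\<And>r. r \<in> GL_regular scale \<Longrightarrow> \<forall>f\<in>T. r f = 0 \<Longrightarrow> \<delta> r = 0"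
    using lie_of_group_derivation[OF D] by metis
  show ?thesis
    by (rule functional_eq_0[OF W(1)]) (use \<delta> W(2) GL_regular_cases(2) in metis)
qed

text \<open>Fix \<open>y\<close> in the space and a functional \<eta> with \<eta>(y) = 1. On
  \<open>T\<close> the functions \<xi>(f x) and \<xi>(x) \<eta>(f y) agree, both being \<chi>(f)
  \<xi>(x); differentiating gives the common scalar \<eta>(D y).\<close>

lemma lie_of_group_scalar:
  assumes D: "D \<in> lie_of_group scale T"
  shows "\<exists>c. \<forall>x\<in>chi_space \<chi>. D x = scale c x"
proof (cases "chi_space \<chi> = {0}")
  case True
  have "lin D" using D by (simp add: lie_of_group_def)
  then show ?thesis by (simp add: True lin_0)
next
  case False
  then obtain y where y: "y \<in> chi_space \<chi>" "y \<noteq> 0" using subspace_0[OF subspace_chi_space] by blast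
  obtain \<eta> where \<eta>: "functional \<eta>" "\<eta> y = 1" using functional_exists[of "{0}" y] y(2) by auto
  obtain \<delta> where \<delta>: "point_derivation_id scale \<delta>" "\<And>\<xi> x. functional \<xi> \<Longrightarrow> \<delta> (\<lambda>f. \<xi> (f x)) = \<xi> (D x)"
    "\<And>r. r \<in> GL_regular scale \<Longrightarrow> \<forall>f\<in>T. r f = 0 \<Longrightarrow> \<delta> r = 0"
    using lie_of_group_derivation[OF D] by metis
  have "D x = scale (\<eta> (D y)) x" if x: "x \<in> chi_space \<chi>" for x
  proof (rule functional_ext)
    fix \<xi> assume \<xi>: "functional \<xi>"
    let ?r = "\<lambda>f. - \<xi> x * \<eta> (f y)"
    have r: "?r \<in> GL_regular scale"
      by (intro GL_regular_cases \<eta>)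
    have "\<delta> (\<lambda>f. \<xi> (f x) + ?r f) = 0"
    proof (rule \<delta>(3))
      show "(\<lambda>f. \<xi> (f x) + ?r f) \<in> GL_regular scale" by (rule GL_regular_cases(4)[OF GL_regular_cases(2)[OF \<xi>] r])
      show "\<forall>f\<in>T. \<xi> (f x) + ?r f = 0"
      proof
        fix f assume f: "f \<in> T"
        show "\<xi> (f x) + ?r f = 0"
          using \<xi> \<eta> unfolding chi_spaceD[OF x f] chi_spaceD[OF y(1) f] by (simp add: functional_iff)
      qed
    qed
    moreover have "\<delta> (\<lambda>f. \<xi> (f x) + ?r f) = \<xi> (D x) + \<delta> ?r"
      using point_derivation_add[OF \<delta>(1) GL_regular_cases(2)[OF \<xi>] r] \<delta>(2)[OF \<xi>] by simp
    moreover have "\<delta> ?r = - \<xi> x * \<eta> (D y)"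
      using point_derivation_scale[OF \<delta>(1) GL_regular_cases(2)[OF \<eta>(1), of y] r, of "- \<xi> x"]
      by (simp only: \<delta>(2)[OF \<eta>(1)])
    ultimately show "\<xi> (D x) = \<xi> (scale (\<eta> (D y)) x)" using \<xi> by (simp add: functional_iff mult.commute)
  qed
  then show ?thesis by blast
qed

text \<open>The function \<xi>(f x) is constant on \<open>T\<close>, and a point derivation kills
  constants.\<close>

lemma lie_of_group_fixed:
  assumes D: "D \<in> lie_of_group scale T" and x: "\<And>\<tau>. \<tau> \<in> T \<Longrightarrow> \<tau> x = x"
  shows "D x = 0"
proof (rule functional_ext)
  fix \<xi> assume \<xi>: "functional \<xi>"
  obtain \<delta> where \<delta>: "point_derivation_id scale \<delta>" "\<And>\<xi> x. functional \<xi> \<Longrightarrow> \<delta> (\<lambda>f. \<xi> (f x)) = \<xi> (D x)"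
    "\<And>r. r \<in> GL_regular scale \<Longrightarrow> \<forall>f\<in>T. r f = 0 \<Longrightarrow> \<delta> r = 0"
    using lie_of_group_derivation[OF D] by metis
  note one = GL_regular_cases(1)[of 1]
  have 1: "\<delta> (\<lambda>f. 1) = 0" using point_derivation_mult[OF \<delta>(1) one one] by simp
  have c: "\<delta> (\<lambda>f. - \<xi> x) = 0" using point_derivation_scale[OF \<delta>(1) one one, of "- \<xi> x"] 1 by simp
  have "\<delta> (\<lambda>f. \<xi> (f x) + (- \<xi> x)) = 0"
  proof (rule \<delta>(3))
    show "(\<lambda>f. \<xi> (f x) + - \<xi> x) \<in> GL_regular scale"
      by (rule GL_regular_cases(4)[OF GL_regular_cases(2)[OF \<xi>] GL_regular_cases(1)])
    show "\<forall>f\<in>T. \<xi> (f x) + - \<xi> x = 0"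
    proof
      fix f assume "f \<in> T"
      then have "f x = x" by (rule x)
      then show "\<xi> (f x) + - \<xi> x = 0" by simp
    qed
  qed
  moreover have "\<delta> (\<lambda>f. \<xi> (f x) + (- \<xi> x)) = \<delta> (\<lambda>f. \<xi> (f x)) + \<delta> (\<lambda>f. - \<xi> x)"
    by (rule point_derivation_add[OF \<delta>(1) GL_regular_cases(2)[OF \<xi>] GL_regular_cases(1)])
  ultimately show "\<xi> (D x) = \<xi> 0" using c \<delta>(2)[OF \<xi>] functional_0[OF \<xi>] by simp
qed

lemma one_G: "\<one>\<^bsub>G\<^esub> \<in> carrier G"
  using comm_group_G by (simp add: comm_group_def monoid.one_closed group.is_monoid)

lemma group_G: "group G"
  using comm_group_G by (simp add: comm_group_def)

text \<open>The component of \<open>z\<close> in degree g \<noteq> 1 would move every graded piece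
  to a different degree, whereas ad z preserves degrees. So ad of this component is zero, and the
  center is trivial.\<close>

lemma graded_bracket_identity:
  assumes "graded_map (bracket z)"
  shows "z \<in> \<Gamma> \<one>\<^bsub>G\<^esub>"
proof -
  interpret G: group G by (rule group_G)
  have zero: "part g z = 0" if g: "g \<in> supp" "g \<noteq> \<one>\<^bsub>G\<^esub>" for g
  proof (rule center_zero[OF semisimple])
    fix y
    have gG: "g \<in> carrier G" using g supp(1) by blast
    show "bracket (part g z) y = 0"
    proof (rule direct_sum_eqI[OF supp(2) lin_bracket lin_const_0])
      fix k y assume k: "k \<in> supp" "y \<in> \<Gamma> k"
      then have kG: "k \<in> carrier G" using supp(1) by blast
      have in_part: "bracket (part g' z) y \<in> \<Gamma> (g' \<otimes>\<^bsub>G\<^esub> k)" if "g' \<in> supp" for g'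
        using grading_bracket[OF _ kG component_in[OF supp(2) that] k(2)] supp(1) that by blast
      show "bracket (part g z) y = 0"
      proof (cases "g \<otimes>\<^bsub>G\<^esub> k \<in> supp")
        case False
        then show ?thesis using in_part[OF g(1)] supp(3) gG kG by blast
      next
        case True
        have "g \<otimes>\<^bsub>G\<^esub> k \<noteq> k" using g(2) gG kG by simp
        moreover have "bracket z y \<in> \<Gamma> k" using assms k kG by (simp add: graded_map_def)
        ultimately have "0 = part (g \<otimes>\<^bsub>G\<^esub> k) (bracket z y)" using part_eq[OF True kG] by simp
        also have "\<dots> = part (g \<otimes>\<^bsub>G\<^esub> k) (bracket (\<Sum>g'\<in>supp. part g' z) y)" by (simp add: sum_component[OF supp(2)])
        also have "\<dots> = (\<Sum>g'\<in>supp. part (g \<otimes>\<^bsub>G\<^esub> k) (bracket (part g' z) y))"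
          by (simp add: bracket_sum lin_sum[OF lin_component[OF supp(2) True]])
        also have "\<dots> = (\<Sum>g'\<in>supp. if g' = g then bracket (part g z) y else 0)"
        proof (rule sum.cong[OF refl])
          fix g' assume g': "g' \<in> supp"
          then have "g' \<in> carrier G" using supp(1) by blast
          then show "part (g \<otimes>\<^bsub>G\<^esub> k) (bracket (part g' z) y) = (if g' = g then bracket (part g z) y else 0)"
            using part_eq[OF True _ in_part[OF g']] gG kG by auto
        qed
        also have "\<dots> = bracket (part g z) y" using g direct_sum_ofD(1)[OF supp(2)] by simp
        finally show ?thesis by simp
      qed
    qed
  qed
  have "z = (\<Sum>g\<in>supp. part g z)" by (simp add: sum_component[OF supp(2)])
  also have "\<dots> = (\<Sum>g\<in>supp. if g = \<one>\<^bsub>G\<^esub> then part \<one>\<^bsub>G\<^esub> z else 0)"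
    by (rule sum.cong) (use zero in auto)
  also have "\<dots> \<in> \<Gamma> \<one>\<^bsub>G\<^esub>"
    using component_in[OF supp(2)] subspace_0[OF subspace_grading[OF one_G]]
    by (intro subspace_sum[OF subspace_grading[OF one_G]]) auto
  finally show ?thesis .
qed

text \<open>Conjugating ad z by the automorphism gives ad of the image of \<open>z\<close>; ad is
  injective.\<close>

lemma fixed_of_commute:
  assumes "\<tau> \<in> T" "\<And>x. \<tau> (bracket z x) = bracket z (\<tau> x)"
  shows "\<tau> z = z"
proof -
  have "bracket (\<tau> z - z) y = 0" for y
  proof -
    obtain x where "y = \<tau> x" using T_automorphism(2)[OF assms(1)] by (metis bij_pointE)
    then show ?thesis using assms(2)[of x] T_automorphism(3)[OF assms(1)] by (simp add: bracket_diff)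
  qed
  then have "\<tau> z - z = 0" by (rule center_zero[OF semisimple])
  then show ?thesis by simp
qed

text \<open>The subalgebra called \<open>C\<close> in the overview.\<close>

definition cent :: "'l set" where
  "cent = \<Gamma> \<one>\<^bsub>G\<^esub> \<inter> chi_space (\<lambda>\<tau>. 1)"

lemma cent_fixed: "z \<in> cent \<Longrightarrow> \<tau> \<in> T \<Longrightarrow> \<tau> z = z"
  by (simp add: cent_def chi_space_def)

lemma subspace_cent: "subspace cent"
  unfolding cent_def by (intro subspace_inter subspace_grading one_G subspace_chi_space)

lemma H_iff: "h \<in> H \<longleftrightarrow> bracket h \<in> lie_of_group scale T"
  by (simp add: H_eq lie_subalgebra_of_def)

lemma centI:
  assumes "graded_map (bracket z)" "\<And>\<tau> x. \<tau> \<in> T \<Longrightarrow> \<tau> (bracket z x) = bracket z (\<tau> x)"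
  shows "z \<in> cent"
proof -
  have "\<tau> z = z" if "\<tau> \<in> T" for \<tau> by (rule fixed_of_commute[OF that assms(2)[OF that]])
  then show ?thesis using graded_bracket_identity[OF assms(1)] by (simp add: cent_def chi_space_def)
qed

text \<open>Tangent vectors preserve the graded pieces because \<open>T\<close> does. They commute
  with \<open>T\<close> because both act by scalars on the character spaces.\<close>

lemma H_sub_cent: "h \<in> H \<Longrightarrow> h \<in> cent"
proof (rule centI)
  assume "h \<in> H"
  then have h: "bracket h \<in> lie_of_group scale T" by (simp add: H_iff)
  show "graded_map (bracket h)" unfolding graded_map_def
  proof (intro conjI ballI lin_bracket)
    fix g x assume g: "g \<in> carrier G" "x \<in> \<Gamma> g"
    show "bracket h x \<in> \<Gamma> g"
      by (rule lie_of_group_invariant[OF h subspace_grading[OF g(1)]])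
         (use T_automorphism(4) g in \<open>auto simp: graded_map_def\<close>)
  qed
  fix \<tau> x assume \<tau>: "\<tau> \<in> T"
  note L = T_automorphism(1)[OF \<tau>]
  show "\<tau> (bracket h x) = bracket h (\<tau> x)"
  proof (rule direct_sum_eqI[OF chars lin_comp[OF L lin_bracket] lin_comp[OF lin_bracket L]])
    fix \<chi> x assume x: "x \<in> chi_space \<chi>"
    obtain c where "\<forall>x\<in>chi_space \<chi>. bracket h x = scale c x" using lie_of_group_scalar[OF h] by blast
    then have "bracket h x = scale c x" using x by blast
    moreover have "\<tau> x = scale (\<chi> \<tau>) x" using x \<tau> by (simp add: chi_space_def)
    ultimately show "\<tau> (bracket h x) = bracket h (\<tau> x)"
      by (simp add: lin_scale[OF L] bracket_scale_right mult.commute)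
  qed
qed

section \<open>Orthogonality for the Killing form\<close>

lemma killing_chi_space:
  assumes "x \<in> chi_space \<chi>" "y \<in> chi_space \<psi>" "\<tau> \<in> T" "\<chi> \<tau> * \<psi> \<tau> \<noteq> 1"
  shows "killing x y = 0"
proof -
  have "killing x y = killing (\<tau> x) (\<tau> y)"
    using T_automorphism[OF assms(3)] by (intro killing_automorphism[symmetric])
  also have "\<dots> = (\<chi> \<tau> * \<psi> \<tau>) * killing x y"
    unfolding chi_spaceD[OF assms(1,3)] chi_spaceD[OF assms(2,3)] by (simp add: killing_scale)
  finally have "(\<chi> \<tau> * \<psi> \<tau> - 1) * killing x y = 0" by (simp add: left_diff_distrib)
  then show ?thesis using assms(4) by simp
qed

lemma killing_grading:
  assumes x: "x \<in> \<Gamma> g" "g \<in> carrier G" and y: "y \<in> \<Gamma> h" "h \<in> carrier G" and ne: "g \<otimes>\<^bsub>G\<^esub> h \<noteq> \<one>\<^bsub>G\<^esub>"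
  shows "killing x y = 0"
  unfolding killing_def
proof (rule tr_shift_components[OF supp(2) lin_comp[OF lin_bracket lin_bracket]])
  interpret G: group G by (rule group_G)
  fix k z assume k: "k \<in> supp" "z \<in> \<Gamma> k"
  then have kG: "k \<in> carrier G" using supp(1) by blast
  have "bracket x (bracket y z) \<in> \<Gamma> (g \<otimes>\<^bsub>G\<^esub> (h \<otimes>\<^bsub>G\<^esub> k))"
    using x y k kG by (intro grading_bracket) auto
  moreover have "g \<otimes>\<^bsub>G\<^esub> (h \<otimes>\<^bsub>G\<^esub> k) \<noteq> k" using x(2) y(2) kG ne by (simp flip: G.m_assoc)
  ultimately show "part k (bracket x (bracket y z)) = 0"
    using part_eq[OF k(1), of "g \<otimes>\<^bsub>G\<^esub> (h \<otimes>\<^bsub>G\<^esub> k)"] x(2) y(2) kG by simp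
qed

text \<open>Nondegeneracy supplies some partner of \<open>x\<close>. Of its components by character
  and degree, one must pair nontrivially with \<open>x\<close>, and orthogonality forces its
  character and degree to be inverse to those of \<open>x\<close>.\<close>

lemma killing_pairing:
  assumes x: "x \<in> \<Gamma> g" "g \<in> carrier G" "x \<in> chi_space \<chi>" "x \<noteq> 0"
  shows "\<exists>y. y \<in> \<Gamma> (inv\<^bsub>G\<^esub> g) \<and> y \<in> chi_space (\<lambda>\<tau>. inverse (\<chi> \<tau>)) \<and> killing x y \<noteq> 0"
proof -
  interpret G: group G by (rule group_G)
  obtain y where "killing x y \<noteq> 0" using killing_nondegenerate[OF semisimple, of x] x(4) by blast
  then have "killing x (\<Sum>\<psi>\<in>chars. component chars chi_space \<psi> y) \<noteq> 0" by (simp add: sum_component[OF chars])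
  then obtain \<psi> where \<psi>: "\<psi> \<in> chars" "killing x (component chars chi_space \<psi> y) \<noteq> 0"
    unfolding killing_sum by (meson sum.neutral)
  let ?z = "component chars chi_space \<psi> y"
  have z: "?z \<in> chi_space \<psi>" by (rule component_in[OF chars \<psi>(1)])
  have "killing x (\<Sum>h\<in>supp. part h ?z) \<noteq> 0" using \<psi>(2) by (simp add: sum_component[OF supp(2)])
  then obtain h where h: "h \<in> supp" "killing x (part h ?z) \<noteq> 0"
    unfolding killing_sum by (meson sum.neutral)
  have hG: "h \<in> carrier G" using h supp(1) by blast
  have "g \<otimes>\<^bsub>G\<^esub> h = \<one>\<^bsub>G\<^esub>" using killing_grading[OF x(1,2) component_in[OF supp(2) h(1)] hG] h(2) by blast
  then have "h = inv\<^bsub>G\<^esub> g" using x(2) hG by (metis G.inv_equality G.inv_inv)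
  moreover have pz: "part h ?z \<in> chi_space \<psi>" by (rule part_chi_space[OF h(1) z])
  then have "\<chi> \<tau> * \<psi> \<tau> = 1" if "\<tau> \<in> T" for \<tau> using killing_chi_space[OF x(3) pz that] h(2) by blast
  then have "\<psi> \<tau> = inverse (\<chi> \<tau>)" if "\<tau> \<in> T" for \<tau> using that by (metis inverse_unique)
  then have "part h ?z \<in> chi_space (\<lambda>\<tau>. inverse (\<chi> \<tau>))" using pz by (simp add: chi_space_def)
  ultimately show ?thesis using h(2) component_in[OF supp(2) h(1), of ?z] by blast
qed

lemma killing_cent:
  assumes "x \<in> cent" "\<And>y. y \<in> cent \<Longrightarrow> killing x y = 0"
  shows "x = 0"
proof (rule ccontr)
  assume "x \<noteq> 0"
  then obtain y where "y \<in> \<Gamma> (inv\<^bsub>G\<^esub> \<one>\<^bsub>G\<^esub>)" "y \<in> chi_space (\<lambda>\<tau>. inverse 1)" "killing x y \<noteq> 0"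
    using killing_pairing[of x "\<one>\<^bsub>G\<^esub>" "\<lambda>\<tau>. 1"] assms(1) one_G unfolding cent_def by blast
  then show False using assms(2)[of y] group.is_monoid[OF group_G]
    by (simp add: cent_def monoid.inv_one)
qed

text \<open>The semisimple part of ad z is a derivation, hence inner, and it lies in the Lie algebra
  of \<open>T\<close> by maximality.\<close>

lemma cent_jordan:
  assumes z: "z \<in> cent"
  shows "\<exists>s\<in>H. nilp (bracket (z - s))"
proof -
  interpret G: group G by (rule group_G)
  have comm: "\<tau> (bracket z x) = bracket z (\<tau> x)" if "\<tau> \<in> T" for \<tau> x
    using T_automorphism(3)[OF that] cent_fixed[OF z that] by simp
  have gr: "graded_map (bracket z)"
    using grading_bracket[OF one_G] z unfolding graded_map_def cent_def by (fastforce intro: lin_bracket)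
  note der = derivation_spectral_map[OF derivation_bracket[of z], of "\<lambda>a. a"]
  obtain s where s: "spectral_map (\<lambda>a. a) (bracket z) = bracket s"
    using derivation_inner[OF semisimple der] by blast
  have "spectral_map (\<lambda>a. a) (bracket z) \<in> lie_of_group scale T"
    by (rule spectral_map_in_lie[OF derivation_bracket comm gr])
  then have "s \<in> H" by (simp add: H_iff s)
  moreover have "nilp (bracket (z - s))"
    using nilp_minus_spectral_map[OF lin_bracket[of z]] unfolding s bracket_diff(2)[symmetric] by simp
  ultimately show ?thesis by blast
qed

lemma H_commutes_cent:
  assumes "h \<in> H" "z \<in> cent"
  shows "bracket h z = 0"
  by (rule lie_of_group_fixed) (use assms H_iff cent_fixed in auto)

lemma killing_nilp_commute:
  assumes "nilp (bracket z)" "bracket h z = 0"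
  shows "killing h z = 0"
  unfolding killing_def
  by (rule tr_commuting_nilp[OF lin_bracket lin_bracket assms(1)])
     (use bracket_bracket[of h z] assms(2) in \<open>simp add: algebra_simps\<close>)

text \<open>
  The ad-nilpotent elements of the centralizer form the orthogonal complement of \<open>H\<close>, hence a
  linear space.  As \<open>killing z z = 0\<close> for ad-nilpotent \<open>z\<close>, polarization shows that this space
  is totally isotropic, so it lies in the radical of the form on the centralizer, which is zero.
\<close>

lemma cent_eq_H: "cent = H"
proof
  show "H \<subseteq> cent" using H_sub_cent by blast
  define N where "N = {z \<in> cent. \<forall>h\<in>H. killing z h = 0}"
  have nH: "killing h n = 0" "killing n h = 0" if "h \<in> H" "n \<in> cent" "nilp (bracket n)" for h n
    using killing_nilp_commute[OF that(3) H_commutes_cent[OF that(1,2)]] killing_commute[of n h] by auto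
  have dec: "\<exists>s n. s \<in> H \<and> s \<in> cent \<and> n \<in> cent \<and> nilp (bracket n) \<and> z = s + n" if "z \<in> cent" for z
  proof -
    obtain s where s: "s \<in> H" "nilp (bracket (z - s))" using cent_jordan[OF \<open>z \<in> cent\<close>] by blast
    then have "z - s \<in> cent" using that H_sub_cent subspace_diff[OF subspace_cent] by blast
    then show ?thesis using s H_sub_cent by (intro exI[of _ s] exI[of _ "z - s"]) auto
  qed
  have nN: "n \<in> N" if "n \<in> cent" "nilp (bracket n)" for n using nH that by (auto simp: N_def)
  have nilN: "nilp (bracket z)" if z: "z \<in> N" for z
  proof -
    obtain s n where sn: "s \<in> H" "s \<in> cent" "n \<in> cent" "nilp (bracket n)" "z = s + n"
      using dec z unfolding N_def by blast
    have sH: "killing s h = 0" if "h \<in> H" for h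
    proof -
      have "killing z h = 0" using z that by (simp add: N_def)
      then show ?thesis using nH(2)[OF that sn(3,4)] by (simp add: sn(5) killing_add)
    qed
    \<comment> \<open>Orthogonal to \<open>H\<close>, since \<open>z\<close> and \<open>n\<close>
      are, and to the ad-nilpotent elements of \<open>cent\<close>; by \<open>dec\<close> these two
      kinds make up all of \<open>cent\<close>.\<close>
    have "s = 0"
    proof (rule killing_cent[OF sn(2)])
      fix w assume "w \<in> cent"
      then obtain s' n' where "s' \<in> H" "n' \<in> cent" "nilp (bracket n')" "w = s' + n'" using dec by blast
      then show "killing s w = 0" using sH nH(1)[OF sn(1)] by (simp add: killing_add)
    qed
    then show ?thesis using sn by simp
  qed
  have diag: "killing z z = 0" if "z \<in> N" for z
    by (rule killing_nilp_commute[OF nilN[OF that]]) (rule bracket_self)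
  have NN: "killing a b = 0" if "a \<in> N" "b \<in> N" for a b
  proof -
    have "a + b \<in> N" using that subspace_add[OF subspace_cent] by (auto simp: N_def killing_add)
    from diag[OF this] have "2 * killing a b = 0"
      using diag[OF that(1)] diag[OF that(2)] by (simp add: killing_add killing_commute[of b a])
    then show ?thesis by simp
  qed
  show "cent \<subseteq> H"
  proof
    fix z assume "z \<in> cent"
    then obtain s n where sn: "s \<in> H" "n \<in> cent" "nilp (bracket n)" "z = s + n" using dec by blast
    have "n = 0"
    proof (rule killing_cent[OF sn(2)])
      fix w assume "w \<in> cent"
      then obtain s' n' where "s' \<in> H" "n' \<in> cent" "nilp (bracket n')" "w = s' + n'" using dec by blast
      then show "killing n w = 0" using nH(2)[OF _ sn(2,3)] NN[OF nN[OF sn(2,3)] nN] by (simp add: killing_add)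
    qed
    then show "z \<in> H" using sn by simp
  qed
qed

end

subsection \<open>Strings of weights\<close>

context fin_dim_lie_algebra
begin

lemma nilp_last_nonzero:
  assumes "nilp (bracket x)" "v \<noteq> 0"
  shows "\<exists>p. (bracket x ^^ p) v \<noteq> 0 \<and> bracket x ((bracket x ^^ p) v) = 0"
proof -
  define n where "n = (LEAST n. (bracket x ^^ n) v = 0)"
  have n: "(bracket x ^^ n) v = 0" unfolding n_def
    by (rule LeastI_ex) (use assms(1) in \<open>auto simp: nilp_def\<close>)
  then obtain p where p: "n = Suc p" using assms(2) by (cases n) auto
  have "(bracket x ^^ p) v \<noteq> 0" using not_less_Least[of p "\<lambda>n. (bracket x ^^ n) v = 0"] p n_def by auto
  then show ?thesis using n p by auto
qed

text \<open>For a = 2 this is the theory of a highest weight vector for sl2. The case a = 0, where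
  \<alpha>([x, y]) = 0, is deliberately included: it then says c = 0 and serves to rule this case
  out.\<close>

lemma sl2_string:
  assumes xy: "bracket x y = u" and uy: "bracket u y = scale (- a) y"
    and v: "v \<noteq> 0" "bracket x v = 0" "bracket u v = scale c v" and "nilp (bracket y)"
  shows "\<exists>m. (\<forall>i\<le>m. (bracket y ^^ i) v \<noteq> 0) \<and> c = a * of_nat m / 2"
proof -
  let ?w = "\<lambda>i. (bracket y ^^ i) v"
  have u: "bracket u (?w i) = scale (c - of_nat i * a) (?w i)" for i
  proof (induction i)
    case (Suc i)
    have "bracket u (?w (Suc i)) = bracket (bracket u y) (?w i) + bracket y (bracket u (?w i))"
      by (simp add: bracket_bracket)
    also have "\<dots> = scale (- a + (c - of_nat i * a)) (?w (Suc i))"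
      by (simp only: uy Suc bracket_scale_left bracket_scale_right scale_left_distrib funpow.simps comp_apply)
    also have "\<dots> = scale (c - of_nat (Suc i) * a) (?w (Suc i))"
      by (rule arg_cong[of _ _ "\<lambda>k. scale k _"]) (simp add: algebra_simps)
    finally show ?case .
  qed (simp add: v)
  \<comment> \<open>The coefficient is the sum of c - j a over j \<le> i, collected by moving
    \<open>x\<close> past one \<open>y\<close> at a time. At the last nonzero vector of the string
    it must vanish, which determines \<open>c\<close>.\<close>
  have x: "bracket x (?w (Suc i)) = scale (of_nat (Suc i) * (c - a * of_nat i / 2)) (?w i)" for i
  proof (induction i)
    case 0
    then show ?case using bracket_bracket[of x y v] v by (simp add: xy)
  next
    case (Suc i)
    have "bracket x (?w (Suc (Suc i))) = bracket u (?w (Suc i)) + bracket y (bracket x (?w (Suc i)))"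
      using bracket_bracket[of x y "?w (Suc i)"] by (simp add: xy)
    also have "\<dots> = scale (c - of_nat (Suc i) * a) (?w (Suc i)) + scale (of_nat (Suc i) * (c - a * of_nat i / 2)) (?w (Suc i))"
      unfolding u Suc bracket_scale_right by simp
    also have "\<dots> = scale (of_nat (Suc (Suc i)) * (c - a * of_nat (Suc i) / 2)) (?w (Suc i))"
      unfolding scale_left_distrib[symmetric] by (rule arg_cong[of _ _ "\<lambda>k. scale k _"]) (simp add: field_simps)
    finally show ?case .
  qed
  obtain m where m: "?w m \<noteq> 0" "bracket y (?w m) = 0" using nilp_last_nonzero[OF assms(6) v(1)] by blast
  have "?w i \<noteq> 0" if "i \<le> m" for i using m(1) funpow_zero_mono[OF lin_bracket _ that] by blast
  moreover have "scale (of_nat (Suc m) * (c - a * of_nat m / 2)) (?w m) = 0" using x[of m] m(2) by simp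
  then have "c = a * of_nat m / 2" using m(1) by (simp del: of_nat_Suc)
  ultimately show ?thesis by blast
qed

text \<open>Each application of ad x moves a generalized eigenspace of ad h by \<open>c\<close>. In
  characteristic 0 the values a + n c are distinct and must leave the finite spectrum.\<close>

lemma nilp_of_weight:
  assumes "bracket h x = scale c x" "c \<noteq> 0"
  shows "nilp (bracket x)"
proof (rule nilpI[OF lin_bracket])
  fix w
  note L = lin_bracket[of h]
  have x: "x \<in> gen_eigenspace (bracket h) c"
    unfolding gen_eigenspace_def by (rule CollectI, rule exI[of _ 1]) (simp add: shift_def assms)
  have *: "v \<in> gen_eigenspace (bracket x) 0" if v: "v \<in> gen_eigenspace (bracket h) a" for a v
  proof -
    have pow: "(bracket x ^^ n) v \<in> gen_eigenspace (bracket h) (a + of_nat n * c)" for n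
    proof (induction n)
      case (Suc n)
      then show ?case using gen_eigenspace_derivation[OF derivation_bracket x Suc] by (simp add: algebra_simps)
    qed (simp add: v)
    have "inj (\<lambda>n::nat. a + of_nat n * c)" using assms(2) by (auto simp: inj_on_def)
    then have "infinite (range (\<lambda>n::nat. a + of_nat n * c))" by (simp add: range_inj_infinite)
    then obtain n :: nat where "a + of_nat n * c \<notin> spectrum (bracket h)"
      using direct_sum_ofD(1)[OF direct_sum_spectrum[OF L]] by (meson finite_subset image_subsetI)
    then have "(bracket x ^^ n) v = 0" using pow[of n] gen_eigenspace_not_spectrum[OF L] by blast
    moreover have "shift (bracket x) 0 = bracket x" by (simp add: shift_def fun_eq_iff)
    ultimately show ?thesis unfolding gen_eigenspace_def by auto
  qed
  have "span (\<Union>a. gen_eigenspace (bracket h) a) \<subseteq> gen_eigenspace (bracket x) 0"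
    by (rule span_minimal) (use * subspace_gen_eigenspace[OF lin_bracket] in auto)
  then have "w \<in> gen_eigenspace (bracket x) 0" using span_gen_eigenspaces[OF L] by auto
  moreover have "shift (bracket x) 0 = bracket x" by (simp add: shift_def fun_eq_iff)
  ultimately show "\<exists>n. (bracket x ^^ n) w = 0" unfolding gen_eigenspace_def by auto
qed

lemma weight_space_bracket:
  assumes "x \<in> weight_space H \<alpha>" "y \<in> weight_space H \<mu>"
  shows "bracket x y \<in> weight_space H (\<lambda>h. \<alpha> h + \<mu> h)"
  unfolding weight_space_def
proof (intro CollectI ballI)
  fix h assume "h \<in> H"
  then have "bracket h x = scale (\<alpha> h) x" "bracket h y = scale (\<mu> h) y" using assms by (auto simp: weight_space_def)
  then show "bracket h (bracket x y) = scale (\<alpha> h + \<mu> h) (bracket x y)"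
    using bracket_bracket[of h x y]
    by (simp add: bracket_scale_left bracket_scale_right scale_left_distrib algebra_simps)
qed

lemma weight_space_funpow:
  assumes "x \<in> weight_space H \<alpha>" "v \<in> weight_space H \<mu>"
  shows "(bracket x ^^ n) v \<in> weight_space H (\<lambda>h. \<mu> h + of_nat n * \<alpha> h)"
proof (induction n)
  case (Suc n)
  then show ?case using weight_space_bracket[OF assms(1) Suc] by (simp add: algebra_simps)
qed (simp add: assms)

lemma weight_space_cong: "x \<in> weight_space H \<alpha> \<Longrightarrow> (\<And>h. h \<in> H \<Longrightarrow> \<alpha> h = \<mu> h) \<Longrightarrow> x \<in> weight_space H \<mu>"
  by (simp add: weight_space_def)

text \<open>Climb by \<open>x\<close> to a highest vector, then descend by \<open>y\<close> to the
  reflected weight. Only a nonnegative integer is treated; a negative one is covered by exchanging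
  \<open>x\<close> and \<open>y\<close> in \<open>root_coroot\<close>.\<close>

lemma weight_integral:
  assumes x: "x \<in> weight_space H \<alpha>" and y: "y \<in> weight_space H (\<lambda>h. - \<alpha> h)"
    and h: "h \<in> H" "bracket x y = h" "\<alpha> h = 2" and v: "v \<in> weight_space H \<mu>" "v \<noteq> 0"
  shows "\<exists>k::int. \<mu> h = of_int k \<and> (k \<ge> 0 \<longrightarrow> weight_space H (\<lambda>z. \<mu> z - of_int k * \<alpha> z) \<noteq> {0})"
proof -
  have hx: "bracket h x = scale 2 x" and hy: "bracket h y = scale (- 2) y"
    using x y h by (auto simp: weight_space_def)
  obtain p where p: "(bracket x ^^ p) v \<noteq> 0" "bracket x ((bracket x ^^ p) v) = 0"
    using nilp_last_nonzero[OF nilp_of_weight[OF hx] v(2)] by auto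
  let ?v = "(bracket x ^^ p) v"
  have wv: "?v \<in> weight_space H (\<lambda>z. \<mu> z + of_nat p * \<alpha> z)" by (rule weight_space_funpow[OF x v(1)])
  then have "bracket h ?v = scale (\<mu> h + of_nat p * 2) ?v" using h by (simp add: weight_space_def)
  from sl2_string[OF h(2) hy p this nilp_of_weight[OF hy]]
  obtain m where m: "\<forall>i\<le>m. (bracket y ^^ i) ?v \<noteq> 0" "\<mu> h + of_nat p * 2 = of_nat m" by auto
  define k where "k = int m - 2 * int p"
  have "\<mu> h = of_nat m - of_nat p * 2" using m(2) by (simp add: eq_diff_eq)
  then have k: "\<mu> h = of_int k" by (simp add: k_def mult.commute)
  moreover have "weight_space H (\<lambda>z. \<mu> z - of_int k * \<alpha> z) \<noteq> {0}" if "k \<ge> 0"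
  proof -
    \<comment> \<open>After \<open>p\<close> steps up, m - p steps down reach \<mu> + p\<alpha> - (m
      - p)\<alpha> = \<mu> - k\<alpha>. From k \<ge> 0 follows p \<le> m, so the subtraction is not
      truncated.\<close>
    let ?i = "m - p"
    have pm: "p \<le> m" using that by (simp add: k_def)
    have "(bracket y ^^ ?i) ?v \<in> weight_space H (\<lambda>z. (\<mu> z + of_nat p * \<alpha> z) + of_nat ?i * (- \<alpha> z))"
      by (rule weight_space_funpow[OF y wv])
    then have "(bracket y ^^ ?i) ?v \<in> weight_space H (\<lambda>z. \<mu> z - of_int k * \<alpha> z)"
      by (rule weight_space_cong) (simp add: k_def of_nat_diff[OF pm] algebra_simps)
    moreover have "(bracket y ^^ ?i) ?v \<noteq> 0" using m(1) by simp
    ultimately show ?thesis by blast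
  qed
  ultimately show ?thesis by blast
qed

end

subsection \<open>Roots and coroots\<close>

context graded_lie_algebra
begin

lemma subspace_H: "subspace H"
  using subspace_cent cent_eq_H by simp

text \<open>The differential of the character, read off from the action of \<open>H\<close> and set
  to 0 outside \<open>H\<close> to match \<open>dual_group\<close>. It is arbitrary on
  \<open>H\<close> when the character space is zero, which is why \<open>wt_dual\<close> asks for a
  nonzero vector.\<close>

definition wt :: "(('l \<Rightarrow> 'l) \<Rightarrow> 'k) \<Rightarrow> 'l \<Rightarrow> 'k" where
  "wt \<chi> h = (if h \<in> H then SOME c. \<forall>x\<in>chi_space \<chi>. bracket h x = scale c x else 0)"

lemma wt: "h \<in> H \<Longrightarrow> x \<in> chi_space \<chi> \<Longrightarrow> bracket h x = scale (wt \<chi> h) x"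
proof -
  assume h: "h \<in> H" and x: "x \<in> chi_space \<chi>"
  then have "\<exists>c. \<forall>x\<in>chi_space \<chi>. bracket h x = scale c x" using lie_of_group_scalar H_iff by blast
  from bspec[OF someI_ex[OF this] x] show ?thesis using h by (simp add: wt_def)
qed

lemma chi_space_weight: "chi_space \<chi> \<subseteq> weight_space H (wt \<chi>)"
  using wt by (auto simp: weight_space_def)

lemma weight_space_component:
  assumes x: "x \<in> weight_space H \<alpha>" and \<chi>: "\<chi> \<in> chars" "component chars chi_space \<chi> x \<noteq> 0"
    and h: "h \<in> H"
  shows "wt \<chi> h = \<alpha> h"
proof -
  let ?c = "component chars chi_space \<chi>"
  have "?c (bracket h x) = bracket h (?c x)"
    by (rule component_commute[OF chars lin_bracket _ \<chi>(1)])
       (use wt[OF h] subspace_scale[OF subspace_chi_space] in simp)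
  moreover have "bracket h x = scale (\<alpha> h) x" using x h by (simp add: weight_space_def)
  ultimately have "scale (\<alpha> h) (?c x) = scale (wt \<chi> h) (?c x)"
    using wt[OF h component_in[OF chars \<chi>(1)]] by (simp add: lin_scale[OF lin_component[OF chars \<chi>(1)]])
  then show ?thesis using \<chi>(2) by simp
qed

lemma weight_space_nonzero_char:
  assumes "weight_space H \<alpha> \<noteq> {0}"
  shows "\<exists>\<chi>\<in>chars. chi_space \<chi> \<noteq> {0} \<and> (\<forall>h\<in>H. wt \<chi> h = \<alpha> h)"
proof -
  have "0 \<in> weight_space H \<alpha>" by (simp add: weight_space_def)
  then obtain x where x: "x \<in> weight_space H \<alpha>" "x \<noteq> 0" using assms by blast
  then obtain \<chi> where \<chi>: "\<chi> \<in> chars" "component chars chi_space \<chi> x \<noteq> 0"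
    using sum_component[OF chars, of x] by (metis sum.neutral)
  then have "chi_space \<chi> \<noteq> {0}" using component_in[OF chars \<chi>(1), of x] by blast
  then show ?thesis using weight_space_component[OF x(1) \<chi>] \<chi>(1) by blast
qed

abbreviation roots :: "('l \<Rightarrow> 'k) set" where
  "roots \<equiv> nonzero_weights H"

lemma roots_iff:
  "\<alpha> \<in> roots \<longleftrightarrow> \<alpha> \<in> carrier (dual_group scale H) \<and> \<alpha> \<noteq> (\<lambda>h. 0) \<and> weight_space H \<alpha> \<noteq> {0}"
  by (auto simp: nonzero_weights_def dual_group_def)

lemma roots_outside: "\<alpha> \<in> roots \<Longrightarrow> h \<notin> H \<Longrightarrow> \<alpha> h = 0"
  by (simp add: roots_iff dual_group_def)

lemma finite_roots: "finite roots"
proof (rule finite_subset)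
  show "finite (wt ` chars)" using direct_sum_ofD(1)[OF chars] by simp
  show "roots \<subseteq> wt ` chars"
  proof
    fix \<alpha> assume \<alpha>: "\<alpha> \<in> roots"
    then obtain \<chi> where "\<chi> \<in> chars" "\<forall>h\<in>H. wt \<chi> h = \<alpha> h"
      using weight_space_nonzero_char unfolding roots_iff by blast
    moreover have "wt \<chi> h = \<alpha> h" if "h \<notin> H" for h using that roots_outside[OF \<alpha>] by (simp add: wt_def)
    ultimately have "wt \<chi> = \<alpha>" by blast
    then show "\<alpha> \<in> wt ` chars" using \<open>\<chi> \<in> chars\<close> by blast
  qed
qed

lemma wt_dual: 
  assumes "x \<in> chi_space \<chi>" "x \<noteq> 0"
  shows "wt \<chi> \<in> carrier (dual_group scale H)"
proof -
  have "wt \<chi> (h + h') = wt \<chi> h + wt \<chi> h'" if "h \<in> H" "h' \<in> H" for h h'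
  proof -
    have "scale (wt \<chi> (h + h')) x = scale (wt \<chi> h + wt \<chi> h') x"
      using wt[OF subspace_add[OF subspace_H that] assms(1)] wt[OF that(1) assms(1)] wt[OF that(2) assms(1)]
      by (simp add: bracket_add_left scale_left_distrib)
    then show ?thesis using assms(2) by simp
  qed
  moreover have "wt \<chi> (scale c h) = c * wt \<chi> h" if "h \<in> H" for c h
  proof -
    have "scale (wt \<chi> (scale c h)) x = bracket (scale c h) x"
      by (rule wt[OF subspace_scale[OF subspace_H that] assms(1), symmetric])
    also have "\<dots> = scale (c * wt \<chi> h) x"
      by (simp only: bracket_scale_left wt[OF that assms(1)] scale_scale)
    finally show ?thesis using assms(2) by simp
  qed
  ultimately show ?thesis by (simp add: dual_group_def wt_def)
qed

text \<open>Take \<open>x\<close> homogeneous in both degree and character and \<open>y\<close> its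
  partner under the Killing form. Then [x, y] is fixed by \<open>T\<close> and of identity degree,
  so it lies in \<open>cent\<close>, which is \<open>H\<close>. It remains to see that \<alpha> is
  nonzero on it and to rescale \<open>y\<close>.\<close>

lemma root_triple:
  assumes \<alpha>: "\<alpha> \<in> roots"
  shows "\<exists>x y. x \<in> weight_space H \<alpha> \<and> y \<in> weight_space H (\<lambda>h. - \<alpha> h) \<and> bracket x y \<in> H \<and> \<alpha> (bracket x y) = 2"
proof -
  interpret G: group G by (rule group_G)
  obtain \<chi> where \<chi>: "\<chi> \<in> chars" "chi_space \<chi> \<noteq> {0}" "\<And>h. h \<in> H \<Longrightarrow> wt \<chi> h = \<alpha> h"
    using weight_space_nonzero_char \<alpha> unfolding roots_iff by blast
  then obtain x0 where x0: "x0 \<in> chi_space \<chi>" "x0 \<noteq> 0" using subspace_0[OF subspace_chi_space] by blast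
  then obtain g where g: "g \<in> supp" "part g x0 \<noteq> 0" using sum_component[OF supp(2), of x0] by (metis sum.neutral)
  define x where "x = part g x0"
  have gG: "g \<in> carrier G" using g supp(1) by blast
  have x: "x \<in> \<Gamma> g" "x \<in> chi_space \<chi>" "x \<noteq> 0"
    using g x0 component_in[OF supp(2) g(1)] part_chi_space by (auto simp: x_def)
  obtain y where y: "y \<in> \<Gamma> (inv\<^bsub>G\<^esub> g)" "y \<in> chi_space (\<lambda>\<tau>. inverse (\<chi> \<tau>))" "killing x y \<noteq> 0"
    using killing_pairing[OF x(1) gG x(2,3)] by blast
  define u where "u = bracket x y"
  have "u \<in> \<Gamma> \<one>\<^bsub>G\<^esub>" using grading_bracket[OF gG _ x(1) y(1)] gG by (simp add: u_def)
  moreover have "\<tau> u = u" if t: "\<tau> \<in> T" for \<tau>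
  proof -
    have "\<tau> x \<noteq> 0" using x(3) T_automorphism(1,2)[OF t] by (metis bij_is_inj inj_eq lin_0)
    then have "\<chi> \<tau> \<noteq> 0" using chi_spaceD[OF x(2) t] by auto
    then show ?thesis unfolding u_def T_automorphism(3)[OF t] chi_spaceD[OF x(2) t] chi_spaceD[OF y(2) t]
      by (simp add: bracket_scale_left bracket_scale_right)
  qed
  ultimately have "u \<in> cent" by (simp add: cent_def chi_space_def)
  then have uH: "u \<in> H" by (simp add: cent_eq_H)
  have xw: "bracket h x = scale (\<alpha> h) x" if "h \<in> H" for h using wt[OF that x(2)] \<chi>(3)[OF that] by simp
  have ku: "killing h u = \<alpha> h * killing x y" if "h \<in> H" for h
    using killing_bracket[of h x y] by (simp add: u_def xw[OF that] killing_scale)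
  \<comment> \<open>The weight of \<open>y\<close> is forced by invariance of the Killing form,
    since \<open>y\<close> pairs nontrivially with \<open>x\<close>.\<close>
  have yw: "bracket h y = scale (- \<alpha> h) y" if "h \<in> H" for h
  proof -
    let ?c = "wt (\<lambda>\<tau>. inverse (\<chi> \<tau>)) h"
    have b: "bracket h y = scale ?c y" by (rule wt[OF that y(2)])
    have "?c * killing x y = killing x (bracket h y)" by (simp add: b killing_scale)
    also have "\<dots> = killing (bracket x h) y" by (simp add: killing_bracket)
    also have "bracket x h = scale (- \<alpha> h) x" using bracket_anticommute[of x h] xw[OF that] by simp
    finally have "?c * killing x y = - \<alpha> h * killing x y" by (simp only: killing_scale)
    then have "?c = - \<alpha> h" using mult_right_cancel[OF y(3)] by blast
    then show ?thesis using b by (simp only:)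
  qed
  \<comment> \<open>Otherwise \<open>u\<close> commutes with \<open>x\<close> and \<open>y\<close>,
    and \<open>sl2_string\<close> with a = 0 makes \<open>u\<close> act as zero on every character
    space. So u = 0, against \<open>killing h0 u\<close> = \<alpha>(h0) \<open>killing x y\<close>,
    which is nonzero.\<close>
  have "\<alpha> u \<noteq> 0"
  proof
    assume u0: "\<alpha> u = 0"
    obtain h0 where h0: "h0 \<in> H" "\<alpha> h0 \<noteq> 0" using \<alpha> roots_outside[OF \<alpha>] unfolding roots_iff by fastforce
    have nx: "nilp (bracket x)" by (rule nilp_of_weight[OF xw[OF h0(1)] h0(2)])
    have ny: "nilp (bracket y)" by (rule nilp_of_weight[OF yw[OF h0(1)]]) (use h0(2) in simp)
    have ux: "bracket u x = 0" "bracket u y = scale (- 0) y" using xw[OF uH] yw[OF uH] u0 by auto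
    have uv: "wt \<psi> u = 0" if vv: "v \<in> chi_space \<psi>" "v \<noteq> 0" for \<psi> v
    proof -
      obtain p where p: "(bracket x ^^ p) v \<noteq> 0" "bracket x ((bracket x ^^ p) v) = 0"
        using nilp_last_nonzero[OF nx vv(2)] by blast
      have cx: "bracket u (bracket x w) = bracket x (bracket u w)" for w
        using bracket_bracket[of u x w] ux(1) by simp
      have "bracket u ((bracket x ^^ p) v) = (bracket x ^^ p) (bracket u v)"
        using funpow_commute[of "bracket x" "bracket u" p v] cx by simp
      also have "\<dots> = scale (wt \<psi> u) ((bracket x ^^ p) v)"
        by (simp add: wt[OF uH vv(1)] lin_scale[OF lin_funpow[OF lin_bracket]])
      finally show ?thesis using sl2_string[OF u_def[symmetric] ux(2) p _ ny] by force
    qed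
    have "bracket u w = 0" for w
    proof (rule direct_sum_eqI[OF chars lin_bracket lin_const_0])
      fix \<psi> v assume "v \<in> chi_space \<psi>"
      then show "bracket u v = 0" using wt[OF uH, of v \<psi>] uv[of v \<psi>] by (cases "v = 0") auto
    qed
    then have "u = 0" by (rule center_zero[OF semisimple])
    then show False using ku[OF h0(1)] h0(2) y(3) by simp
  qed
  moreover define a where "a = 2 / \<alpha> u"
  moreover have "bracket x (scale a y) = scale a u" by (simp add: bracket_scale_right u_def)
  moreover have "\<alpha> (scale a u) = a * \<alpha> u" using \<alpha> uH by (simp add: roots_iff dual_group_def)
  ultimately have "bracket x (scale a y) \<in> H" "\<alpha> (bracket x (scale a y)) = 2"
    using subspace_scale[OF subspace_H uH] by simp_all
  moreover have "x \<in> weight_space H \<alpha>" using xw by (simp add: weight_space_def)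
  moreover have "scale a y \<in> weight_space H (\<lambda>h. - \<alpha> h)"
    using yw by (simp add: weight_space_def bracket_scale_right mult.commute)
  ultimately show ?thesis by blast
qed

text \<open>The coroot is evaluation at h = [x, y].\<close>

lemma root_coroot:
  assumes \<alpha>: "\<alpha> \<in> roots"
  shows "\<exists>h\<in>H. \<alpha> h = 2 \<and> (\<forall>\<mu>\<in>roots. \<exists>k::int. \<mu> h = of_int k \<and> (\<lambda>z. \<mu> z - of_int k * \<alpha> z) \<in> roots)"
proof -
  obtain x y where x: "x \<in> weight_space H \<alpha>" and y: "y \<in> weight_space H (\<lambda>h. - \<alpha> h)"
    and h: "bracket x y \<in> H" "\<alpha> (bracket x y) = 2"
    using root_triple[OF \<alpha>] by blast
  define h where "h = bracket x y"
  note hH = h(1)[folded h_def] and h2 = h(2)[folded h_def]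
  have "\<exists>k::int. \<mu> h = of_int k \<and> (\<lambda>z. \<mu> z - of_int k * \<alpha> z) \<in> roots" if \<mu>: "\<mu> \<in> roots" for \<mu>
  proof -
    have "0 \<in> weight_space H \<mu>" by (simp add: weight_space_def)
    then obtain v where v: "v \<in> weight_space H \<mu>" "v \<noteq> 0" using \<mu> unfolding roots_iff by blast
    obtain k where k: "\<mu> h = of_int k" "k \<ge> 0 \<longrightarrow> weight_space H (\<lambda>z. \<mu> z - of_int k * \<alpha> z) \<noteq> {0}"
      using weight_integral[OF x y hH h_def[symmetric] h2 v] by blast
    have neg: "\<nu> (- z) = - \<nu> z" if "\<nu> \<in> roots" "z \<in> H" for \<nu> z
    proof -
      have "\<forall>c. \<forall>x\<in>H. \<nu> (scale c x) = c * \<nu> x" using that(1) unfolding roots_iff dual_group_def by simp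
      then have "\<nu> (scale (- 1) z) = (- 1) * \<nu> z" using that(2) by blast
      then show ?thesis by simp
    qed
    \<comment> \<open>The triple with \<open>x\<close> and \<open>y\<close> exchanged belongs to
      -\<alpha> and -h. It turns the integer \<open>k\<close> into -k, so one of the two
      applications of \<open>weight_integral\<close> has a nonnegative integer.\<close>
    have x': "x \<in> weight_space H (\<lambda>h. - (\<lambda>h. - \<alpha> h) h)" using x by simp
    have "bracket y x = - h" using bracket_anticommute[of y x] by (simp add: h_def)
    moreover have "- h \<in> H" by (rule subspace_neg[OF subspace_H hH])
    moreover have "- \<alpha> (- h) = 2" using neg[OF \<alpha> hH] h2 by simp
    ultimately obtain k' where k': "\<mu> (- h) = of_int k'"
      "k' \<ge> 0 \<longrightarrow> weight_space H (\<lambda>z. \<mu> z - of_int k' * (- \<alpha> z)) \<noteq> {0}"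
      using weight_integral[OF y x' _ _ _ v, of "- h"] by auto
    have "of_int k' = (of_int (- k) :: 'k)" using k'(1) k(1) neg[OF \<mu> hH] by simp
    then have "k' = - k" by (simp only: of_int_eq_iff)
    then have w: "weight_space H (\<lambda>z. \<mu> z - of_int k * \<alpha> z) \<noteq> {0}"
      using k(2) k'(2) by (cases "k \<ge> 0") auto
    \<comment> \<open>If \<mu> = k\<alpha>, then evaluation at \<open>h\<close> gives k =
      2k.\<close>
    have "(\<lambda>z. \<mu> z - of_int k * \<alpha> z) \<noteq> (\<lambda>z. 0)"
    proof
      assume e: "(\<lambda>z. \<mu> z - of_int k * \<alpha> z) = (\<lambda>z. 0)"
      then have "\<mu> h = of_int k * \<alpha> h" by (metis eq_iff_diff_eq_0)
      then have "of_int k = (of_int (2 * k) :: 'k)" using k(1) h2 by simp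
      then have "k = 0" by (simp only: of_int_eq_iff)
      then have "\<mu> = (\<lambda>z. 0)" using e by simp
      then show False using \<mu> by (simp add: roots_iff)
    qed
    moreover have "(\<lambda>z. \<mu> z - of_int k * \<alpha> z) \<in> carrier (dual_group scale H)"
      using \<mu> \<alpha> unfolding roots_iff dual_group_def by (auto simp: algebra_simps)
    ultimately show ?thesis using w k(1) unfolding roots_iff by blast
  qed
  then show ?thesis using hH h2 by blast
qed

text \<open>A nontrivial torus has a weight \<open>m\<close> with some exponent m(i) \<noteq> 0.
  Multiplying each weight space by its i-th exponent is a derivation; it is ad of an element of
  \<open>cent\<close>, hence of \<open>H\<close>, on which the differential of this character is
  nonzero.\<close>

lemma roots_nonempty:
  assumes "T \<noteq> {id}"
  shows "roots \<noteq> {}"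
proof -
  obtain n where n: "torus_of_dim scale n T" using T_torus by blast
  then obtain \<phi> K where \<phi>: "\<phi> ` torus_points n = T" "\<And>t. t \<in> torus_points n \<Longrightarrow> lin (\<phi> t)"
    and K: "K \<subseteq> exponents n" "direct_sum_of K (\<lambda>m. {x. \<forall>t\<in>torus_points n. \<phi> t x = scale (tchar n m t) x})"
    by (rule torus_decomposition) (rule that)
  let ?L = "\<lambda>m. {x. \<forall>t\<in>torus_points n. \<phi> t x = scale (tchar n m t) x}"
  define K' where "K' = {m\<in>K. ?L m \<noteq> {0}}"
  have ds: "direct_sum_of K' ?L" unfolding K'_def by (rule direct_sum_of_nonzero[OF K(2)])
  have \<phi>T: "\<phi> t \<in> T" if "t \<in> torus_points n" for t using \<phi>(1) that by blast
  have "\<exists>m\<in>K'. m \<noteq> 0"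
  proof (rule ccontr)
    assume "\<not> ?thesis"
    then have z: "m = 0" if "m \<in> K'" for m using that by blast
    have "\<phi> t x = x" if t: "t \<in> torus_points n" for t x
    proof (rule direct_sum_eqI[OF ds \<phi>(2)[OF t] lin_ident])
      fix m x assume "m \<in> K'" "x \<in> ?L m"
      then show "\<phi> t x = x" using t z[of m] by simp
    qed
    then have "\<phi> t = id" if "t \<in> torus_points n" for t using that by (simp add: fun_eq_iff)
    then have "T = {id}" using \<phi>(1) torus_points_one[of n] by force
    then show False using assms by blast
  qed
  then obtain m where m: "m \<in> K'" "m \<noteq> 0" by blast
  then obtain i where i: "m i \<noteq> 0" by (auto simp: fun_eq_iff)
  define D where "D = diagonal_map K' ?L (\<lambda>m. of_int (m i))"
  have LD: "lin D" unfolding D_def by (rule lin_diagonal_map[OF ds])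
  \<comment> \<open>Stated for all exponents, because the bracket of two weight vectors has weight p
    + q, which may fail to occur in \<open>K'\<close>; its weight space is then zero.\<close>
  have De: "D x = scale (of_int (m i)) x" if mx: "m \<in> exponents n" "x \<in> ?L m" for m x
  proof (cases "m \<in> K'")
    case True
    show ?thesis unfolding D_def by (rule diagonal_map_eq[OF ds, of m x, OF True mx(2)])
  next
    case False
    have "x = 0"
    proof (rule ccontr)
      assume "x \<noteq> 0"
      then obtain m' where m': "m' \<in> K'" "component K' ?L m' x \<noteq> 0"
        using sum_component[OF ds, of x] by (metis (no_types, lifting) sum.neutral)
      have "m' \<in> exponents n" "m' \<noteq> m" using m' K(1) False by (auto simp: K'_def)
      then obtain t where t: "t \<in> torus_points n" "tchar n m' t \<noteq> (tchar n m t :: 'k)"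
        using tchar_distinct[where 'k='k] mx(1) by metis
      have "component K' ?L m' (\<phi> t x) = \<phi> t (component K' ?L m' x)"
      proof (rule component_commute[OF ds \<phi>(2)[OF t(1)] _ m'(1)])
        fix p y assume y: "y \<in> ?L p"
        then have "\<phi> t y = scale (tchar n p t) y" using t(1) by blast
        then show "\<phi> t y \<in> ?L p" using y \<phi>(2) by (simp add: lin_scale mult.commute)
      qed
      moreover have "component K' ?L m' x \<in> ?L m'" by (rule component_in[OF ds m'(1)])
      ultimately have "scale (tchar n m t) (component K' ?L m' x) = scale (tchar n m' t) (component K' ?L m' x)"
        using mx(2) t(1) by (simp add: lin_scale[OF lin_component[OF ds m'(1)]])
      then show False using t(2) m'(2) by simp
    qed
    then show ?thesis using lin_0[OF LD] by simp
  qed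
  have "derivation D" unfolding derivation_def
  proof (intro conjI allI LD)
    fix x y
    show "D (bracket x y) = bracket (D x) y + bracket x (D y)"
    proof (rule bracket_eqI[OF ds LD LD LD])
      fix p q x y assume pq: "p \<in> K'" "q \<in> K'" "x \<in> ?L p" "y \<in> ?L q"
      then have e: "p \<in> exponents n" "q \<in> exponents n" using K(1) by (auto simp: K'_def)
      have "\<phi> t (bracket x y) = scale (tchar n (p + q) t) (bracket x y)" if t: "t \<in> torus_points n" for t
      proof -
        have "\<phi> t x = scale (tchar n p t) x" "\<phi> t y = scale (tchar n q t) y" using pq t by auto
        then show ?thesis using T_automorphism(3)[OF \<phi>T[OF t]]
          by (simp add: tchar_add[OF t] bracket_scale_left bracket_scale_right mult.commute)
      qed
      then have "bracket x y \<in> ?L (p + q)" by blast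
      then show "D (bracket x y) = bracket (D x) y + bracket x (D y)"
        using De[OF exponents_add[OF e]] De[OF e(1) pq(3)] De[OF e(2) pq(4)]
        by (simp add: bracket_scale_left bracket_scale_right scale_left_distrib)
    qed
  qed
  then obtain h where h: "D = bracket h" using derivation_inner[OF semisimple] by blast
  have "h \<in> cent"
  proof (rule centI)
    show "graded_map (bracket h)"
    proof (rule graded_mapI[OF lin_bracket])
      fix g x assume g: "g \<in> supp"
      note L = lin_component[OF supp(2) g]
      have "D (part g x) = part g (D x)" unfolding D_def
      proof (rule diagonal_map_commute[OF ds L])
        fix p x assume x: "x \<in> ?L p"
        have "\<phi> t (part g x) = scale (tchar n p t) (part g x)" if t: "t \<in> torus_points n" for t
        proof -
          have "\<phi> t (part g x) = part g (\<phi> t x)" by (rule graded_map_commute[OF T_automorphism(4)[OF \<phi>T[OF t]] g, symmetric])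
          moreover have "\<phi> t x = scale (tchar n p t) x" using x t by blast
          ultimately show ?thesis by (simp add: lin_scale[OF L])
        qed
        then show "part g x \<in> ?L p" by blast
      qed
      then show "part g (bracket h x) = bracket h (part g x)" by (simp add: h)
    qed
    fix \<tau> x assume "\<tau> \<in> T"
    then obtain t where t: "t \<in> torus_points n" "\<tau> = \<phi> t" using \<phi>(1) by blast
    have "D (\<phi> t x) = \<phi> t (D x)" unfolding D_def
    proof (rule diagonal_map_commute[OF ds \<phi>(2)[OF t(1)]])
      fix p y assume y: "y \<in> ?L p"
      then have "\<phi> t y = scale (tchar n p t) y" using t(1) by blast
      then show "\<phi> t y \<in> ?L p" using y \<phi>(2) by (simp add: lin_scale mult.commute)
    qed
    then show "\<tau> (bracket h x) = bracket h (\<tau> x)" by (simp add: t(2) h)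
  qed
  then have hH: "h \<in> H" by (simp add: cent_eq_H)
  have "?L m \<noteq> {0}" using m(1) unfolding K'_def by blast
  then obtain v where v: "v \<in> ?L m" "v \<noteq> 0"
    using subspace_0[OF direct_sum_ofD(2)[OF ds m(1)]] by blast
  define \<chi> where "\<chi> \<tau> = (if \<tau> \<in> T then tchar n m (inv_into (torus_points n) \<phi> \<tau>) else 0)" for \<tau>
  have "v \<in> chi_space \<chi>" unfolding chi_space_def
  proof (intro CollectI ballI)
    fix \<tau> assume \<tau>: "\<tau> \<in> T"
    then have "\<tau> \<in> \<phi> ` torus_points n" using \<phi>(1) by simp
    then have "inv_into (torus_points n) \<phi> \<tau> \<in> torus_points n" "\<phi> (inv_into (torus_points n) \<phi> \<tau>) = \<tau>"
      by (rule inv_into_into, rule f_inv_into_f)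
    then show "\<tau> v = scale (\<chi> \<tau>) v" using v(1) \<tau> by (auto simp: \<chi>_def)
  qed
  then have "wt \<chi> \<in> carrier (dual_group scale H)" "v \<in> weight_space H (wt \<chi>)" "bracket h v = scale (wt \<chi> h) v"
    using wt_dual v(2) chi_space_weight wt[OF hH] by blast+
  moreover have "bracket h v = scale (of_int (m i)) v"
    using De[of m v] m(1) K(1) v(1) by (auto simp: K'_def h)
  then have "wt \<chi> h \<noteq> 0" using calculation(3) v(2) i by auto
  then have "wt \<chi> \<noteq> (\<lambda>h. 0)" by metis
  ultimately have "wt \<chi> \<in> roots" using v(2) unfolding roots_iff by blast
  then show ?thesis by blast
qed

lemma span_weight_spaces: "span (\<Union>\<mu>\<in>insert (\<lambda>h. 0) roots. weight_space H \<mu>) = UNIV"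
proof -
  let ?U = "\<Union>\<mu>\<in>insert (\<lambda>h. 0) roots. weight_space H \<mu>"
  have "chi_space \<chi> \<subseteq> span ?U" for \<chi>
  proof
    fix x assume x: "x \<in> chi_space \<chi>"
    then have "x \<in> weight_space H (wt \<chi>)" using chi_space_weight by blast
    moreover have "wt \<chi> \<in> insert (\<lambda>h. 0) roots" if "x \<noteq> 0"
      using wt_dual[OF x that] calculation that roots_iff[of "wt \<chi>"] by blast
    ultimately show "x \<in> span ?U"
    proof (cases "x = 0")
      case True
      then show ?thesis by (simp only: span_zero)
    next
      case False
      then show ?thesis
        using \<open>x \<noteq> 0 \<Longrightarrow> wt \<chi> \<in> insert (\<lambda>h. 0) roots\<close> \<open>x \<in> weight_space H (wt \<chi>)\<close>
        by (intro span_base UN_I)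
    qed
  qed
  then have "(\<Sum>\<chi>\<in>chars. component chars chi_space \<chi> x) \<in> span ?U" for x
    using component_in[OF chars] by (intro span_sum) blast
  then show ?thesis by (auto simp: sum_component[OF chars])
qed

end

subsection \<open>Irreducibility\<close>

context graded_lie_algebra
begin

text \<open>
  The roots of one orthogonal part generate an ideal, on which the coroots of the other part act as zero.
\<close>

lemma roots_not_orthogonal:
  assumes simple: simple
    and A: "roots = A1 \<union> A2" "A1 \<noteq> {}" "A2 \<noteq> {}"
    and co: "\<And>\<alpha>. \<alpha> \<in> roots \<Longrightarrow> co \<alpha> \<in> H" "\<And>\<alpha>. \<alpha> \<in> roots \<Longrightarrow> \<alpha> (co \<alpha>) = 2"
    and refl: "\<And>\<alpha>. \<alpha> \<in> roots \<Longrightarrow> (\<lambda>z. - \<alpha> z) \<in> roots"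
    and orth: "\<And>\<alpha> \<beta>. \<alpha> \<in> A1 \<Longrightarrow> \<beta> \<in> A2 \<Longrightarrow> \<beta> (co \<alpha>) = 0" "\<And>\<alpha> \<beta>. \<alpha> \<in> A1 \<Longrightarrow> \<beta> \<in> A2 \<Longrightarrow> \<alpha> (co \<beta>) = 0"
  shows False
proof -
  have A1: "\<alpha> \<in> roots" if "\<alpha> \<in> A1" for \<alpha> using that A(1) by blast
  have A2: "\<alpha> \<in> roots" if "\<alpha> \<in> A2" for \<alpha> using that A(1) by blast
  have neg: "(\<lambda>z. - \<alpha> z) \<in> A1" if "\<alpha> \<in> A1" for \<alpha>
  proof (rule ccontr)
    assume "\<not> ?thesis"
    then have "(\<lambda>z. - \<alpha> z) \<in> A2" using refl[OF A1[OF that]] A(1) by blast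
    then show False using orth(1)[OF that] co(2)[OF A1[OF that]] by force
  qed
  have sum0: "bracket z w = 0 \<or> (\<lambda>h. \<mu> h + \<alpha> h) = (\<lambda>h. 0) \<or> (\<lambda>h. \<mu> h + \<alpha> h) \<in> roots"
    if "z \<in> weight_space H \<mu>" "w \<in> weight_space H \<alpha>" "\<mu> \<in> roots" "\<alpha> \<in> roots" for z w \<mu> \<alpha>
  proof -
    have "bracket z w \<in> weight_space H (\<lambda>h. \<mu> h + \<alpha> h)" by (rule weight_space_bracket[OF that(1,2)])
    moreover have "(\<lambda>h. \<mu> h + \<alpha> h) \<in> carrier (dual_group scale H)"
      using that(3,4) unfolding roots_iff dual_group_def by (auto simp: algebra_simps)
    ultimately show ?thesis using roots_iff[of "\<lambda>h. \<mu> h + \<alpha> h"] by blast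
  qed
  \<comment> \<open>The sum \<mu> + \<alpha> would take the value 2 at both coroots, so it is
    neither zero nor a root of either part.\<close>
  have comm: "bracket z w = 0" if zw: "z \<in> weight_space H \<mu>" "w \<in> weight_space H \<alpha>" "\<mu> \<in> A2" "\<alpha> \<in> A1" for z w \<mu> \<alpha>
  proof -
    let ?\<gamma> = "\<lambda>h. \<mu> h + \<alpha> h"
    have v: "?\<gamma> (co \<alpha>) = 2" "?\<gamma> (co \<mu>) = 2"
      using orth(1)[OF zw(4,3)] orth(2)[OF zw(4,3)] co(2)[OF A1[OF zw(4)]] co(2)[OF A2[OF zw(3)]] by simp_all
    have "?\<gamma> \<noteq> (\<lambda>h. 0)"
    proof
      assume "?\<gamma> = (\<lambda>h. 0)"
      from fun_cong[OF this, of "co \<alpha>"] show False using v(1) by simp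
    qed
    moreover have "?\<gamma> \<notin> A1" using orth(2)[OF _ zw(3), of ?\<gamma>] v by force
    moreover have "?\<gamma> \<notin> A2" using orth(1)[OF zw(4), of ?\<gamma>] v by force
    ultimately show ?thesis using sum0[OF zw(1,2) A2[OF zw(3)] A1[OF zw(4)]] A(1) by blast
  qed
  \<comment> \<open>If the sum were in the other part, both summands would vanish at its coroot,
    where the sum takes the value 2.\<close>
  have sum1: "(\<lambda>h. \<mu> h + \<alpha> h) \<in> A1" if ma: "\<mu> \<in> A1" "\<alpha> \<in> A1" "(\<lambda>h. \<mu> h + \<alpha> h) \<in> roots" for \<mu> \<alpha>
  proof (rule ccontr)
    assume "\<not> ?thesis"
    then have g: "(\<lambda>h. \<mu> h + \<alpha> h) \<in> A2" using ma(3) A(1) by blast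
    show False using co(2)[OF ma(3)] orth(2)[OF ma(1) g] orth(2)[OF ma(2) g] by simp
  qed
  define S where "S = (\<Union>\<alpha>\<in>A1. weight_space H \<alpha>) \<union>
    {bracket x y |x y \<alpha>. \<alpha> \<in> A1 \<and> x \<in> weight_space H \<alpha> \<and> y \<in> weight_space H (\<lambda>h. - \<alpha> h)}"
  have gen: "bracket z w \<in> span S" if z: "z \<in> weight_space H \<mu>" "\<mu> \<in> insert (\<lambda>h. 0) roots" and w: "w \<in> S" for z w \<mu>
  proof -
    have S1: "w \<in> span S" if "w \<in> weight_space H \<alpha>" "\<alpha> \<in> A1" for w \<alpha>
      using that by (intro span_base) (auto simp: S_def)
    have zero_w: "bracket z w \<in> weight_space H \<alpha>" if "\<mu> = (\<lambda>h. 0)" "w \<in> weight_space H \<alpha>" for w \<alpha>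
      using weight_space_bracket[OF z(1) that(2)] that(1) by simp
    consider "\<mu> = (\<lambda>h. 0)" | "\<mu> \<in> A1" | "\<mu> \<in> A2" using z(2) A(1) by blast
    then have case1: "bracket z w \<in> span S" if w: "w \<in> weight_space H \<alpha>" "\<alpha> \<in> A1" for w \<alpha>
    proof cases
      case 1
      then show ?thesis using zero_w S1 w by blast
    next
      case 2
      have b: "bracket z w \<in> weight_space H (\<lambda>h. \<mu> h + \<alpha> h)" by (rule weight_space_bracket[OF z(1) w(1)])
      consider "bracket z w = 0" | "(\<lambda>h. \<mu> h + \<alpha> h) = (\<lambda>h. 0)" | "(\<lambda>h. \<mu> h + \<alpha> h) \<in> roots"
        using sum0[OF z(1) w(1) A1[OF 2] A1[OF w(2)]] by blast
      then show ?thesis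
      proof cases
        case 1
        then show ?thesis by (simp add: span_zero)
      next
        case e: 2
        have "\<alpha> h = - \<mu> h" for h using fun_cong[OF e, of h] by (simp add: eq_neg_iff_add_eq_0 add.commute)
        then have "w \<in> weight_space H (\<lambda>h. - \<mu> h)" using w(1) weight_space_cong by metis
        then show ?thesis using 2 z(1) by (intro span_base) (auto simp: S_def)
      next
        case 3
        then show ?thesis using S1[OF b] sum1[OF 2 w(2)] by blast
      qed
    next
      case 3
      then show ?thesis using comm[OF z(1) w(1) _ w(2)] by (simp add: span_zero)
    qed
    consider \<alpha> where "\<alpha> \<in> A1" "w \<in> weight_space H \<alpha>"
      | x y \<alpha> where "\<alpha> \<in> A1" "x \<in> weight_space H \<alpha>" "y \<in> weight_space H (\<lambda>h. - \<alpha> h)" "w = bracket x y"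
      using w unfolding S_def by blast
    then show ?thesis
    proof cases
      case 1
      then show ?thesis using case1 by blast
    next
      case 2
      have e: "bracket z w = bracket (bracket z x) y + bracket x (bracket z y)" by (simp add: 2 bracket_bracket)
      have S2: "bracket x y \<in> span S" if "x \<in> weight_space H \<alpha>" "y \<in> weight_space H (\<lambda>h. - \<alpha> h)" for x y
        using that 2(1) by (intro span_base) (auto simp: S_def)
      consider "\<mu> = (\<lambda>h. 0)" | "\<mu> \<in> A1" | "\<mu> \<in> A2" using z(2) A(1) by blast
      then show ?thesis
      proof cases
        case 1
        show ?thesis unfolding e by (intro span_add S2 zero_w[OF 1] 2)
      next
        case m: 2
        have "w \<in> weight_space H (\<lambda>h. 0)" using weight_space_bracket[OF 2(2,3)] 2(4) by simp
        then have "bracket z w \<in> weight_space H \<mu>" using weight_space_bracket[OF z(1)] by fastforce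
        then show ?thesis using S1 m by blast
      next
        case 3
        then show ?thesis unfolding e using comm[OF z(1) 2(2) _ 2(1)] comm[OF z(1) 2(3) _ neg[OF 2(1)]]
          by (simp add: span_zero)
      qed
    qed
  qed
  have "lie_ideal (span S)" unfolding lie_ideal_def
  proof (intro conjI allI ballI)
    fix z w assume w: "w \<in> span S"
    have zS: "bracket z w \<in> span S" if "w \<in> S" for w
    proof -
      have "z \<in> span (\<Union>\<mu>\<in>insert (\<lambda>h. 0) roots. weight_space H \<mu>)" using span_weight_spaces by blast
      then show ?thesis
      proof (induction rule: span_induct_alt)
        case base
        show ?case by (simp add: span_zero)
      next
        case (step c x y)
        then show ?case using gen[OF _ _ that] by (auto simp: bracket_add_left bracket_scale_left intro!: span_add span_scale)
      qed
    qed
    show "bracket z w \<in> span S" using w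
    proof (induction rule: span_induct_alt)
      case base
      show ?case by (simp add: span_zero)
    next
      case (step c x y)
      then show ?case using zS by (auto simp: bracket_add_right bracket_scale_right intro!: span_add span_scale)
    qed
  qed simp
  moreover have "span S \<noteq> {0}"
  proof -
    obtain \<alpha> where \<alpha>: "\<alpha> \<in> A1" using A(2) by blast
    have "0 \<in> weight_space H \<alpha>" by (simp add: weight_space_def)
    then obtain x where "x \<in> weight_space H \<alpha>" "x \<noteq> 0" using A1[OF \<alpha>] unfolding roots_iff by blast
    then show ?thesis using \<alpha> span_base[of x S] by (auto simp: S_def)
  qed
  ultimately have S: "span S = UNIV" using simple unfolding simple_def by blast
  \<comment> \<open>Its coroot kills the generators in \<open>S\<close>, hence the whole algebra, so
    it is central and therefore zero, although \<beta> takes the value 2 on it.\<close>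
  obtain \<beta> where \<beta>: "\<beta> \<in> A2" using A(3) by blast
  let ?h = "co \<beta>"
  have hH: "?h \<in> H" by (rule co(1)[OF A2[OF \<beta>]])
  have kill: "bracket ?h w = 0" if "w \<in> S" for w
    using that unfolding S_def
  proof
    assume "w \<in> (\<Union>\<alpha>\<in>A1. weight_space H \<alpha>)"
    then obtain \<alpha> where "\<alpha> \<in> A1" "w \<in> weight_space H \<alpha>" by blast
    then show ?thesis using hH orth(2)[OF _ \<beta>] by (simp add: weight_space_def)
  next
    assume "w \<in> {bracket x y |x y \<alpha>. \<alpha> \<in> A1 \<and> x \<in> weight_space H \<alpha> \<and> y \<in> weight_space H (\<lambda>h. - \<alpha> h)}"
    then obtain x y \<alpha> where "x \<in> weight_space H \<alpha>" "y \<in> weight_space H (\<lambda>h. - \<alpha> h)" "w = bracket x y" by blast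
    then have "w \<in> weight_space H (\<lambda>h. 0)" using weight_space_bracket[of x H \<alpha> y "\<lambda>h. - \<alpha> h"] by simp
    then show ?thesis using hH by (simp add: weight_space_def)
  qed
  have "bracket ?h w = 0" for w
  proof -
    have "w \<in> span S" using S by blast
    then show ?thesis
      by (induction rule: span_induct_alt) (simp_all add: kill bracket_add_right bracket_scale_right)
  qed
  then have "?h = 0" by (rule center_zero[OF semisimple])
  have "\<forall>c. \<forall>x\<in>H. \<beta> (scale c x) = c * \<beta> x" using A2[OF \<beta>] unfolding roots_iff dual_group_def by simp
  then have "\<beta> (scale 0 ?h) = 0 * \<beta> ?h" using hH by blast
  then show False using co(2)[OF A2[OF \<beta>]] \<open>?h = 0\<close> by simp
qed

end

section \<open>The tensor product with the reals\<close>

locale tensor_group = comm_group A for A :: "('a, 'm) monoid_scheme" (structure)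
begin

definition pairs :: "(real \<times> 'a) set" where
  "pairs = UNIV \<times> carrier A"

abbreviation R where "R \<equiv> tensor_relations A"

abbreviation coset where "coset \<equiv> tensor_coset A"

abbreviation V where "V \<equiv> real_tensor A"

lemma pairs_iff [simp]: "(r, a) \<in> pairs \<longleftrightarrow> a \<in> carrier A"
  by (simp add: pairs_def)

lemma frag_pairs:
  "Poly_Mapping.keys p \<subseteq> pairs \<Longrightarrow> Poly_Mapping.keys q \<subseteq> pairs \<Longrightarrow> Poly_Mapping.keys (p - q) \<subseteq> pairs"
  "Poly_Mapping.keys p \<subseteq> pairs \<Longrightarrow> Poly_Mapping.keys q \<subseteq> pairs \<Longrightarrow> Poly_Mapping.keys (p + q) \<subseteq> pairs"
  "a \<in> carrier A \<Longrightarrow> Poly_Mapping.keys (frag_of (r, a)) \<subseteq> pairs"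
  using keys_diff[of p q] keys_add[of p q] by (auto simp: pairs_def)

definition relators :: "((real \<times> 'a) \<Rightarrow>\<^sub>0 int) set" where
  "relators = {frag_of (r + s, a) - frag_of (r, a) - frag_of (s, a) | r s a. a \<in> carrier A} \<union>
      {frag_of (r, a \<otimes> b) - frag_of (r, a) - frag_of (r, b) | r a b. a \<in> carrier A \<and> b \<in> carrier A}"

lemma relators_keys: "h \<in> relators \<Longrightarrow> Poly_Mapping.keys h \<subseteq> pairs"
  unfolding relators_def
  by (elim UnE CollectE exE conjE; simp only:; intro frag_pairs m_closed)

lemma tensor_relations_eq: "tensor_relations A = generate (tensor_free A) relators"
  by (simp only: tensor_relations_def relators_def)

text \<open>Closure under differences, starting from zero, covers both the inverses and the products
  produced by \<open>generate\<close>.\<close>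

lemma relations_induct [consumes 1, case_names zero left right diff]:
  assumes "p \<in> R"
    and "P 0"
    and left: "\<And>r s a. a \<in> carrier A \<Longrightarrow> P (frag_of (r + s, a) - frag_of (r, a) - frag_of (s, a))"
    and right: "\<And>r a b. a \<in> carrier A \<Longrightarrow> b \<in> carrier A \<Longrightarrow> P (frag_of (r, a \<otimes> b) - frag_of (r, a) - frag_of (r, b))"
    and diff: "\<And>p q. P p \<Longrightarrow> P q \<Longrightarrow> P (p - q)"
  shows "P p"
proof -
  have S: "P h" if "h \<in> relators" for h
    using that unfolding relators_def by (elim UnE CollectE exE conjE; simp only: left right)
  have neg: "P (- h)" if "P h" for h using diff[OF \<open>P 0\<close> that] by simp
  have "p \<in> generate (tensor_free A) relators" using assms(1) by (simp only: tensor_relations_eq)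
  then show ?thesis
  proof (induction rule: generate.induct)
    case one
    then show ?case using assms(2) by (simp add: tensor_free_def)
  next
    case (incl h)
    then show ?case using S by blast
  next
    case (inv h)
    then have "inv\<^bsub>tensor_free A\<^esub> h = - h" using relators_keys[of h] by (simp add: tensor_free_def pairs_def)
    then show ?case using S[of h] inv neg by simp
  next
    case (eng h1 h2)
    then have "P (h1 - (- h2))" by (intro diff neg)
    then show ?case by (simp add: tensor_free_def)
  qed
qed

lemma subgroup_relations: "subgroup R (tensor_free A)"
  unfolding tensor_relations_eq
proof (rule group.generate_is_subgroup)
  show "group (tensor_free A)" by (simp add: tensor_free_def)
  show "relators \<subseteq> carrier (tensor_free A)"
    using relators_keys by (auto simp: tensor_free_def pairs_def)
qed

lemma relations_keys: "p \<in> R \<Longrightarrow> Poly_Mapping.keys p \<subseteq> pairs"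
  using subsetD[OF subgroup.subset[OF subgroup_relations], of p] by (simp add: tensor_free_def pairs_def)

lemma relations_0: "0 \<in> R"
  using subgroup.one_closed[OF subgroup_relations] by (simp add: tensor_free_def)

lemma relations_add: "p \<in> R \<Longrightarrow> q \<in> R \<Longrightarrow> p + q \<in> R"
  using subgroup.m_closed[OF subgroup_relations] by (simp add: tensor_free_def)

lemma relations_minus: "p \<in> R \<Longrightarrow> - p \<in> R"
  using subgroup.m_inv_closed[OF subgroup_relations, of p] relations_keys[of p]
  by (simp add: tensor_free_def pairs_def)

lemma relations_diff: "p \<in> R \<Longrightarrow> q \<in> R \<Longrightarrow> p - q \<in> R"
  using relations_add[of p "- q"] relations_minus by simp

lemma relations_left: "a \<in> carrier A \<Longrightarrow> frag_of (r + s, a) - frag_of (r, a) - frag_of (s, a) \<in> R"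
  and relations_right: "a \<in> carrier A \<Longrightarrow> b \<in> carrier A \<Longrightarrow> frag_of (r, a \<otimes> b) - frag_of (r, a) - frag_of (r, b) \<in> R"
  unfolding tensor_relations_def by (rule generate.incl, blast)+

lemma coset: "coset p = {r + p |r. r \<in> R}"
  by (auto simp: tensor_coset_def r_coset_def tensor_free_def)

lemma coset_eqI: "p - q \<in> R \<Longrightarrow> coset p = coset q"
proof -
  have *: "coset p \<subseteq> coset q" if "p - q \<in> R" for p q
  proof
    fix x assume "x \<in> coset p"
    then obtain r where "r \<in> R" "x = r + p" by (auto simp: coset)
    then have "x = (r + (p - q)) + q" "r + (p - q) \<in> R" using relations_add that by auto
    then show "x \<in> coset q" unfolding coset by blast
  qed
  assume pq: "p - q \<in> R"
  then have "q - p \<in> R" using relations_minus[OF pq] by simp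
  then show ?thesis using *[OF pq] * by blast
qed

lemma coset_self: "p \<in> coset p"
  using relations_0 by (force simp: coset)

lemma in_coset: "q \<in> coset p \<Longrightarrow> q - p \<in> R"
  by (auto simp: coset)

lemma carrier_V: "carrier V = coset ` {p. Poly_Mapping.keys p \<subseteq> pairs}"
  by (auto simp: real_tensor_def FactGroup_def RCOSETS_def tensor_coset_def tensor_free_def pairs_def)

lemma coset_closed: "Poly_Mapping.keys p \<subseteq> pairs \<Longrightarrow> coset p \<in> carrier V"
  by (auto simp: carrier_V)

lemma zero_V: "\<zero>\<^bsub>V\<^esub> = coset 0"
  by (auto simp: real_tensor_def FactGroup_def coset)

lemma add_V: "coset p \<oplus>\<^bsub>V\<^esub> coset q = coset (p + q)"
proof -
  have "coset p \<oplus>\<^bsub>V\<^esub> coset q = {x + y |x y. x \<in> coset p \<and> y \<in> coset q}"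
    by (auto simp: real_tensor_def FactGroup_def set_mult_def tensor_free_def)
  also have "\<dots> = coset (p + q)"
  proof (intro equalityI subsetI)
    fix z assume "z \<in> {x + y |x y. x \<in> coset p \<and> y \<in> coset q}"
    then obtain r s where "r \<in> R" "s \<in> R" "z = (r + p) + (s + q)" by (auto simp: coset)
    then have "z = (r + s) + (p + q)" "r + s \<in> R" by (auto simp: add_ac relations_add)
    then show "z \<in> coset (p + q)" by (auto simp: coset)
  next
    fix z assume "z \<in> coset (p + q)"
    then obtain r where "r \<in> R" "z = r + (p + q)" by (auto simp: coset)
    then have "z = (r + p) + q" "r + p \<in> coset p" by (auto simp: add_ac coset)
    then show "z \<in> {x + y |x y. x \<in> coset p \<and> y \<in> coset q}" using coset_self by blast
  qed
  finally show ?thesis .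
qed

definition rescale :: "real \<Rightarrow> ((real \<times> 'a) \<Rightarrow>\<^sub>0 int) \<Rightarrow> ((real \<times> 'a) \<Rightarrow>\<^sub>0 int)" where
  "rescale c = frag_extend (\<lambda>(r, a). frag_of (c * r, a))"

lemma rescale_simps:
  "rescale c (frag_of (r, a)) = frag_of (c * r, a)" "rescale c 0 = 0"
  "rescale c (p + q) = rescale c p + rescale c q" "rescale c (p - q) = rescale c p - rescale c q"
  by (simp_all add: rescale_def frag_extend_add frag_extend_diff)

lemma rescale_relations: "p \<in> R \<Longrightarrow> rescale c p \<in> R"
proof (induction rule: relations_induct)
  case (left r s a)
  then show ?case using relations_left[of a "c * r" "c * s"] by (simp add: rescale_simps distrib_left)
next
  case (right r a b)
  then show ?case using relations_right[of a b "c * r"] by (simp add: rescale_simps)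
qed (simp_all add: rescale_simps relations_0 relations_diff)

lemma pairs_induct [consumes 1, case_names zero diff of]:
  assumes "Poly_Mapping.keys p \<subseteq> pairs" "P 0"
    "\<And>p q. Poly_Mapping.keys p \<subseteq> pairs \<Longrightarrow> Poly_Mapping.keys q \<subseteq> pairs \<Longrightarrow> P p \<Longrightarrow> P q \<Longrightarrow> P (p - q)"
    "\<And>r a. a \<in> carrier A \<Longrightarrow> P (frag_of (r, a))"
  shows "P p"
  by (rule free_Abelian_group_induct[OF assms(1)]) (use assms(2-) in \<open>auto simp: pairs_def\<close>)

lemma rescale_pairs: "Poly_Mapping.keys p \<subseteq> pairs \<Longrightarrow> Poly_Mapping.keys (rescale c p) \<subseteq> pairs"
proof (induction rule: pairs_induct)
  case (diff p q)
  then show ?case unfolding rescale_simps by (intro frag_pairs)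
qed (auto simp: rescale_simps pairs_def)

text \<open>Rescaling preserves the relations, so the union in the definition of scalar
  multiplication runs over one and the same coset.\<close>

lemma smult_V: "c \<odot>\<^bsub>V\<^esub> coset p = coset (rescale c p)"
proof -
  have "coset (rescale c q) = coset (rescale c p)" if "q \<in> coset p" for q
    using rescale_relations[OF in_coset[OF that], of c] by (intro coset_eqI) (simp add: rescale_simps)
  then have "(\<Union>q\<in>coset p. coset (rescale c q)) = (\<Union>q\<in>coset p. coset (rescale c p))"
    by (rule SUP_cong[OF refl])
  also have "\<dots> = coset (rescale c p)" using coset_self[of p] by (metis UN_constant empty_iff)
  finally have "(\<Union>q\<in>coset p. coset (rescale c q)) = coset (rescale c p)" .
  then show ?thesis by (simp add: real_tensor_def rescale_def)
qed

lemma real_field_simps: "carrier real_field = UNIV" "x \<oplus>\<^bsub>real_field\<^esub> y = x + y" "x \<otimes>\<^bsub>real_field\<^esub> y = x * y"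
  "\<one>\<^bsub>real_field\<^esub> = 1"
  by (simp_all add: ring_of_type_algebra_def)

lemma module_V: "Module.module real_field V"
proof (rule moduleI)
  show "cring real_field" by (rule cring_from_type_algebra)
  show "abelian_group V"
  proof (rule abelian_groupI)
    show "\<exists>y\<in>carrier V. y \<oplus>\<^bsub>V\<^esub> x = \<zero>\<^bsub>V\<^esub>" if x: "x \<in> carrier V" for x
    proof -
      obtain p where p: "Poly_Mapping.keys p \<subseteq> pairs" "x = coset p" using x by (auto simp: carrier_V)
      then show ?thesis
        by (intro bexI[of _ "coset (- p)"]) (auto simp: add_V zero_V intro!: coset_closed)
    qed
    show "x \<oplus>\<^bsub>V\<^esub> y \<in> carrier V" if xy: "x \<in> carrier V" "y \<in> carrier V" for x y
    proof -
      obtain p q where "Poly_Mapping.keys p \<subseteq> pairs" "x = coset p" "Poly_Mapping.keys q \<subseteq> pairs" "y = coset q"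
        using xy by (auto simp: carrier_V)
      then show ?thesis by (simp only: add_V coset_closed[OF frag_pairs(2)])
    qed
    show "\<zero>\<^bsub>V\<^esub> \<in> carrier V" unfolding zero_V by (rule coset_closed) simp
  qed (auto simp: carrier_V add_V zero_V add_ac)
  show "(a \<oplus>\<^bsub>real_field\<^esub> b) \<odot>\<^bsub>V\<^esub> x = a \<odot>\<^bsub>V\<^esub> x \<oplus>\<^bsub>V\<^esub> b \<odot>\<^bsub>V\<^esub> x" if x: "x \<in> carrier V" for a b x
  proof -
    obtain p where p: "Poly_Mapping.keys p \<subseteq> pairs" "x = coset p" using x by (auto simp: carrier_V)
    from p(1) have "rescale (a + b) p - (rescale a p + rescale b p) \<in> R"
    proof (induction rule: pairs_induct)
      case (diff p q)
      have "(rescale (a + b) p - (rescale a p + rescale b p)) - (rescale (a + b) q - (rescale a q + rescale b q)) \<in> R"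
        by (rule relations_diff[OF diff(3,4)])
      then show ?case by (simp add: rescale_simps algebra_simps)
    next
      case (of r x)
      then show ?case using relations_left[of x "a * r" "b * r"] by (simp add: rescale_simps algebra_simps)
    qed (simp add: rescale_simps relations_0)
    then show ?thesis by (simp add: p(2) smult_V add_V real_field_simps coset_eqI)
  qed
  show "(a \<otimes>\<^bsub>real_field\<^esub> b) \<odot>\<^bsub>V\<^esub> x = a \<odot>\<^bsub>V\<^esub> (b \<odot>\<^bsub>V\<^esub> x)" if x: "x \<in> carrier V" for a b x
  proof -
    obtain p where p: "Poly_Mapping.keys p \<subseteq> pairs" "x = coset p" using x by (auto simp: carrier_V)
    from p(1) have "rescale (a * b) p = rescale a (rescale b p)"
      by (induction rule: pairs_induct) (simp_all add: rescale_simps mult.assoc)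
    then show ?thesis by (simp add: p(2) smult_V real_field_simps)
  qed
  show "\<one>\<^bsub>real_field\<^esub> \<odot>\<^bsub>V\<^esub> x = x" if x: "x \<in> carrier V" for x
  proof -
    obtain p where p: "Poly_Mapping.keys p \<subseteq> pairs" "x = coset p" using x by (auto simp: carrier_V)
    from p(1) have "rescale 1 p = p"
      by (induction rule: pairs_induct) (simp_all add: rescale_simps)
    then show ?thesis by (simp add: p(2) smult_V real_field_simps)
  qed
qed (auto simp: carrier_V add_V smult_V rescale_simps intro!: imageI rescale_pairs)

section \<open>The canonical map into the tensor product and its universal property\<close>

abbreviation ot where "ot \<equiv> one_tensor A"

lemma ot_closed: "a \<in> carrier A \<Longrightarrow> ot a \<in> carrier V"
  unfolding one_tensor_def by (intro coset_closed frag_pairs)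

lemma ot_mult: "a \<in> carrier A \<Longrightarrow> b \<in> carrier A \<Longrightarrow> ot (a \<otimes> b) = ot a \<oplus>\<^bsub>V\<^esub> ot b"
  unfolding one_tensor_def add_V by (rule coset_eqI) (use relations_right[of a b 1] in \<open>simp add: diff_diff_add\<close>)

lemma ot_one: "ot \<one> = \<zero>\<^bsub>V\<^esub>"
  unfolding one_tensor_def zero_V
  by (rule coset_eqI) (use relations_minus[OF relations_right[of \<one> \<one> 1]] in simp)

lemma ot_pow:
  assumes "a \<in> carrier A" "b \<in> carrier A"
  shows "ot (a \<otimes> b [^] (n::nat)) = ot a \<oplus>\<^bsub>V\<^esub> real n \<odot>\<^bsub>V\<^esub> ot b"
proof -
  interpret V: Module.module real_field V by (rule module_V)
  show ?thesis
  proof (induction n)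
    case 0
    have "0 \<odot>\<^bsub>V\<^esub> ot b = \<zero>\<^bsub>V\<^esub>"
      using V.smult_l_null[OF ot_closed[OF assms(2)]] by (simp add: ring_of_type_algebra_def)
    then show ?case using assms ot_closed V.M.r_zero by simp
  next
    case (Suc n)
    have "ot (a \<otimes> b [^] Suc n) = ot (a \<otimes> b [^] n) \<oplus>\<^bsub>V\<^esub> ot b"
      using ot_mult[of "a \<otimes> b [^] n" b] assms by (simp add: m_assoc)
    also have "\<dots> = ot a \<oplus>\<^bsub>V\<^esub> (real n \<odot>\<^bsub>V\<^esub> ot b \<oplus>\<^bsub>V\<^esub> 1 \<odot>\<^bsub>V\<^esub> ot b)"
      using assms ot_closed V.smult_closed[of "real n" "ot b"] V.smult_one[of "ot b"]
      by (simp add: Suc V.M.a_assoc real_field_simps)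
    also have "real n \<odot>\<^bsub>V\<^esub> ot b \<oplus>\<^bsub>V\<^esub> 1 \<odot>\<^bsub>V\<^esub> ot b = real (Suc n) \<odot>\<^bsub>V\<^esub> ot b"
      using V.smult_l_distr[of "real n" 1 "ot b"] ot_closed[OF assms(2)] by (simp add: real_field_simps add.commute)
    finally show ?case .
  qed
qed

text \<open>Every pure tensor is a real multiple of some 1 \<otimes> a, and a subspace containing
  the images of the generators contains the images of the whole group.\<close>

lemma span_ot:
  assumes W: "submodule W real_field V" and "ot ` B \<subseteq> W" and gen: "carrier A \<subseteq> generate A B" and B: "B \<subseteq> carrier A"
  shows "W = carrier V"
proof
  interpret V: Module.module real_field V by (rule module_V)
  have sub: "subgroup W (add_monoid V)" using W by (simp add: submodule_def)
  show "W \<subseteq> carrier V" using subgroup.subset[OF sub] by simp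
  have ot: "a \<in> carrier A \<and> ot a \<in> W" if "a \<in> generate A B" for a
    using that
  proof (induction rule: generate.induct)
    case one
    then show ?case using subgroup.one_closed[OF sub] by (simp add: ot_one)
  next
    case (incl h)
    then show ?case using assms(2) B by blast
  next
    case (inv h)
    then have h: "h \<in> carrier A" "ot h \<in> W" using assms(2) B by blast+
    have "ot (inv h) \<oplus>\<^bsub>V\<^esub> ot h = \<zero>\<^bsub>V\<^esub>" using ot_mult[of "inv h" h] h ot_one by simp
    then have "ot (inv h) = \<ominus>\<^bsub>V\<^esub> ot h" using h ot_closed by (intro V.M.minus_equality[symmetric]) auto
    then show ?case using subgroup.m_inv_closed[OF sub h(2)] h by (simp add: a_inv_def)
  next
    case (eng h1 h2)
    then show ?case using subgroup.m_closed[OF sub, of "ot h1" "ot h2"] by (simp add: ot_mult)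
  qed
  show "carrier V \<subseteq> W"
  proof
    fix x assume "x \<in> carrier V"
    then obtain p where p: "Poly_Mapping.keys p \<subseteq> pairs" "x = coset p" by (auto simp: carrier_V)
    from p(1) have "coset p \<in> W"
    proof (induction rule: pairs_induct)
      case zero
      then show ?case using subgroup.one_closed[OF sub] by (simp add: zero_V)
    next
      case (diff p q)
      have "coset (- q) \<oplus>\<^bsub>V\<^esub> coset q = \<zero>\<^bsub>V\<^esub>" by (simp add: add_V zero_V)
      then have "\<ominus>\<^bsub>V\<^esub> coset q = coset (- q)"
        using diff(2) by (intro V.M.minus_equality coset_closed) auto
      then have "coset (- q) \<in> W" using subgroup.m_inv_closed[OF sub diff(4)] by (simp add: a_inv_def)
      then have "coset p \<oplus>\<^bsub>V\<^esub> coset (- q) \<in> W" using subgroup.m_closed[OF sub diff(3)] by simp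
      then show ?case by (simp add: add_V)
    next
      case (of r a)
      have "coset (frag_of (r, a)) = r \<odot>\<^bsub>V\<^esub> ot a" by (simp add: one_tensor_def smult_V rescale_simps)
      moreover have "r \<odot>\<^bsub>V\<^esub> ot a \<in> W"
        by (rule submodule.smult_closed[OF W]) (use of gen ot in \<open>auto simp: real_field_simps\<close>)
      ultimately show ?case by simp
    qed
    then show "x \<in> W" by (simp add: p(2))
  qed
qed

text \<open>Universal property: the pure tensor of \<open>r\<close> and \<open>a\<close> goes to r
  v(a). The extension \<open>F\<close> to formal sums vanishes on the relations, so its value at any
  representative of a coset may be used.\<close>

lemma real_functional_exists:
  assumes v: "\<And>a b. a \<in> carrier A \<Longrightarrow> b \<in> carrier A \<Longrightarrow> v (a \<otimes> b) = v a + (v b :: real)"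
  shows "\<exists>f. real_functional V f \<and> (\<forall>a\<in>carrier A. f (ot a) = v a)"
proof -
  define F where "F p = (\<Sum>k\<in>Poly_Mapping.keys p. of_int (Poly_Mapping.lookup p k) * (fst k * v (snd k)))" for p
  have F_sup: "F p = (\<Sum>k\<in>S. of_int (Poly_Mapping.lookup p k) * (fst k * v (snd k)))"
    if "finite S" "Poly_Mapping.keys p \<subseteq> S" for p S
    unfolding F_def using that by (intro sum.mono_neutral_left) (auto simp: in_keys_iff)
  have F_diff: "F (p - q) = F p - F q" for p q
  proof -
    let ?S = "Poly_Mapping.keys p \<union> Poly_Mapping.keys q"
    have "F (p - q) = (\<Sum>k\<in>?S. of_int (Poly_Mapping.lookup (p - q) k) * (fst k * v (snd k)))"
      by (rule F_sup) (auto simp: keys_diff)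
    moreover have "F p = (\<Sum>k\<in>?S. of_int (Poly_Mapping.lookup p k) * (fst k * v (snd k)))" by (rule F_sup) auto
    moreover have "F q = (\<Sum>k\<in>?S. of_int (Poly_Mapping.lookup q k) * (fst k * v (snd k)))" by (rule F_sup) auto
    ultimately show ?thesis by (simp add: lookup_minus left_diff_distrib sum_subtractf)
  qed
  have F_0: "F 0 = 0" by (simp add: F_def)
  have F_neg: "F (- q) = - F q" for q using F_diff[of 0 q] by (simp add: F_0)
  have F_add: "F (p + q) = F p + F q" for p q using F_diff[of p "- q"] by (simp add: F_neg)
  have F_of: "F (frag_of (r, a)) = r * v a" for r a by (simp add: F_def)
  have F_rel: "F p = 0" if "p \<in> R" for p
    using that by (induction rule: relations_induct) (simp_all add: F_0 F_diff F_add F_of v algebra_simps)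
  have F_rescale: "F (rescale c p) = c * F p" if "Poly_Mapping.keys p \<subseteq> pairs" for c p
    using that by (induction rule: pairs_induct) (simp_all add: rescale_simps F_0 F_diff F_of algebra_simps)
  define f where "f C = F (SOME p. p \<in> C)" for C
  have f: "f (coset p) = F p" for p
  proof -
    have "(SOME q. q \<in> coset p) \<in> coset p" using coset_self by (rule someI)
    from F_rel[OF in_coset[OF this]] show ?thesis by (simp add: f_def F_diff)
  qed
  have "real_functional V f" unfolding real_functional_def
    by (auto simp: carrier_V add_V smult_V f F_add F_rescale)
  moreover have "f (ot a) = v a" for a by (simp add: one_tensor_def f F_of)
  ultimately show ?thesis by blast
qed

end

section \<open>The root system\<close>

lemma torus_trivial:
  fixes scale :: "'k::field_char_0 \<Rightarrow> 'l::ab_group_add \<Rightarrow> 'l"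
  assumes "torus_of_dim scale n {id}"
  shows "n = 0"
proof (rule ccontr)
  assume "n \<noteq> 0"
  obtain \<phi> where "\<phi> \<in> iso (mult_torus n :: (nat \<Rightarrow> 'k) monoid) (GL scale\<lparr>carrier := {id}\<rparr>)"
    using assms unfolding torus_of_dim_def by blast
  then have "bij_betw \<phi> (carrier (mult_torus n :: (nat \<Rightarrow> 'k) monoid)) {id}" by (simp add: iso_def)
  then have inj: "inj_on \<phi> (torus_points n)" and im: "\<phi> ` torus_points n = {id}" by (simp_all add: bij_betw_def)
  let ?t = "\<lambda>i::nat. if i = 0 then 2 else 1 :: 'k"
  have t: "?t \<in> torus_points n" using \<open>n \<noteq> 0\<close> by (simp add: torus_points_iff)
  have *: "\<phi> s = id" if "s \<in> torus_points n" for s using imageI[OF that, of \<phi>] im by simp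
  have "\<phi> ?t = \<phi> (\<lambda>i. 1)" using *[OF t] *[OF torus_points_one] by simp
  then have "?t = (\<lambda>i. 1)" using inj_onD[OF inj _ t torus_points_one] by blast
  then have "?t 0 = 1" by (rule fun_cong)
  then show False by simp
qed

lemma torus_id: "torus_of_dim scale n S \<Longrightarrow> id \<in> S"
  using subgroup.one_closed unfolding torus_of_dim_def algebraic_subgroup_def by (fastforce simp: GL_def)

context graded_lie_algebra
begin

text \<open>Every torus contains the identity, so every maximal torus contains \<open>T\<close> and
  equals it by maximality. This makes the definite description in \<open>toral_rank\<close> unique
  here without appeal to conjugacy.\<close>

lemma toral_rank_zero:
  assumes "T = {id}"
  shows "toral_rank G \<Gamma> = 0"
proof -
  have T': "T' = {id}" if T': "maximal_torus scale (Stab G \<Gamma>) T'" for T'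
  proof -
    obtain n where n: "torus_of_dim scale n T'" using T' unfolding maximal_torus_def by blast
    have "T \<subseteq> T'" using torus_id[OF n] assms by simp
    moreover have "T' \<subseteq> Stab G \<Gamma>" using T' unfolding maximal_torus_def by blast
    ultimately show ?thesis using T_max[OF n] assms by simp
  qed
  show ?thesis unfolding toral_rank_def
  proof (rule the_equality)
    obtain n where "torus_of_dim scale n T" using T_torus by blast
    then show "\<exists>T. maximal_torus scale (Stab G \<Gamma>) T \<and> torus_of_dim scale 0 T"
      using maximal torus_trivial assms by blast
    show "n = 0" if "\<exists>T. maximal_torus scale (Stab G \<Gamma>) T \<and> torus_of_dim scale n T" for n
      using that T' torus_trivial by blast
  qed
qed

section \<open>The root lattice\<close>

lemma dual_group_closed:
  "\<mu> \<in> carrier (dual_group scale H) \<Longrightarrow> \<nu> \<in> carrier (dual_group scale H) \<Longrightarrow> (\<lambda>z. \<mu> z + \<nu> z) \<in> carrier (dual_group scale H)"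
  "\<mu> \<in> carrier (dual_group scale H) \<Longrightarrow> (\<lambda>z. - \<mu> z) \<in> carrier (dual_group scale H)"
  "(\<lambda>z. 0) \<in> carrier (dual_group scale H)"
  by (simp_all add: dual_group_def algebra_simps)

lemma dual_group_simps: "\<mu> \<otimes>\<^bsub>dual_group scale H\<^esub> \<nu> = (\<lambda>z. \<mu> z + \<nu> z)" "\<one>\<^bsub>dual_group scale H\<^esub> = (\<lambda>z. 0)"
  by (simp_all add: dual_group_def)

lemma comm_group_dual_group: "comm_group (dual_group scale H)"
proof (rule comm_groupI)
  fix \<mu> assume "\<mu> \<in> carrier (dual_group scale H)"
  then show "\<exists>\<nu>\<in>carrier (dual_group scale H). \<nu> \<otimes>\<^bsub>dual_group scale H\<^esub> \<mu> = \<one>\<^bsub>dual_group scale H\<^esub>"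
    by (intro bexI[of _ "\<lambda>z. - \<mu> z"]) (auto simp: dual_group_simps intro: dual_group_closed)
qed (auto simp: dual_group_simps add_ac intro: dual_group_closed)

definition root_lattice :: "('l \<Rightarrow> 'k) monoid" where
  "root_lattice = subgroup_generated (dual_group scale H) roots"

lemma root_lattice:
  shows comm_group_root_lattice: "comm_group root_lattice"
    and root_lattice_mult: "\<mu> \<otimes>\<^bsub>root_lattice\<^esub> \<nu> = (\<lambda>z. \<mu> z + \<nu> z)"
    and root_lattice_one: "\<one>\<^bsub>root_lattice\<^esub> = (\<lambda>z. 0)"
    and roots_lattice: "roots \<subseteq> carrier root_lattice"
    and root_lattice_generated: "carrier root_lattice \<subseteq> generate root_lattice roots"
proof -
  interpret D: comm_group "dual_group scale H" by (rule comm_group_dual_group)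
  have r: "roots \<subseteq> carrier (dual_group scale H)" by (auto simp: roots_iff)
  show "comm_group root_lattice"
    unfolding root_lattice_def by (rule D.abelian_subgroup_generated) (rule comm_group_dual_group)
  have c: "carrier root_lattice = generate (dual_group scale H) roots"
    unfolding root_lattice_def carrier_subgroup_generated using r by (simp add: Int_absorb1)
  show "\<mu> \<otimes>\<^bsub>root_lattice\<^esub> \<nu> = (\<lambda>z. \<mu> z + \<nu> z)" "\<one>\<^bsub>root_lattice\<^esub> = (\<lambda>z. 0)"
    by (simp_all add: root_lattice_def dual_group_simps)
  show "roots \<subseteq> carrier root_lattice" unfolding c by (auto intro: generate.incl)
  show "carrier root_lattice \<subseteq> generate root_lattice roots"
  proof
    fix \<mu> assume "\<mu> \<in> carrier root_lattice"
    then have "\<mu> \<in> generate (dual_group scale H) roots" by (simp add: c)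
    then show "\<mu> \<in> generate root_lattice roots"
    proof (induction rule: generate.induct)
      case one
      then show ?case using generate.one[of root_lattice roots] by (simp add: root_lattice_def)
    next
      case (incl h)
      then show ?case by (rule generate.incl)
    next
      case (inv h)
      have "inv\<^bsub>root_lattice\<^esub> h = inv\<^bsub>dual_group scale H\<^esub> h"
        unfolding root_lattice_def using inv c by (intro D.inv_subgroup_generated) (auto simp: root_lattice_def intro: generate.incl)
      then show ?case using generate.inv[OF inv, of root_lattice] by simp
    next
      case (eng h1 h2)
      then show ?case using generate.eng[of h1 root_lattice roots h2] by (simp add: root_lattice_def)
    qed
  qed
qed

sublocale tg: tensor_group root_lattice
  by (rule tensor_group.intro) (rule comm_group_root_lattice)

abbreviation root_space where "root_space \<equiv> real_tensor root_lattice"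

section \<open>Integral coroots and reflections\<close>

definition coroot_element :: "('l \<Rightarrow> 'k) \<Rightarrow> 'l" where
  "coroot_element \<alpha> = (SOME h. h \<in> H \<and> \<alpha> h = 2 \<and>
     (\<forall>\<mu>\<in>roots. \<exists>k::int. \<mu> h = of_int k \<and> (\<lambda>z. \<mu> z - of_int k * \<alpha> z) \<in> roots))"

lemma coroot_element:
  assumes "\<alpha> \<in> roots"
  shows "coroot_element \<alpha> \<in> H" "\<alpha> (coroot_element \<alpha>) = 2"
    "\<mu> \<in> roots \<Longrightarrow> \<exists>k::int. \<mu> (coroot_element \<alpha>) = of_int k \<and> (\<lambda>z. \<mu> z - of_int k * \<alpha> z) \<in> roots"
proof -
  have "\<exists>h. h \<in> H \<and> \<alpha> h = 2 \<and> (\<forall>\<mu>\<in>roots. \<exists>k::int. \<mu> h = of_int k \<and> (\<lambda>z. \<mu> z - of_int k * \<alpha> z) \<in> roots)"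
    using root_coroot[OF assms] by blast
  from someI_ex[OF this] show "coroot_element \<alpha> \<in> H" "\<alpha> (coroot_element \<alpha>) = 2"
    "\<mu> \<in> roots \<Longrightarrow> \<exists>k::int. \<mu> (coroot_element \<alpha>) = of_int k \<and> (\<lambda>z. \<mu> z - of_int k * \<alpha> z) \<in> roots"
    unfolding coroot_element_def[symmetric] by blast+
qed

text \<open>Integrality on the whole lattice is what allows values in the field to be read as
  integers and thus as real numbers.\<close>

lemma lattice_integral:
  assumes \<alpha>: "\<alpha> \<in> roots" and "\<mu> \<in> carrier root_lattice"
  shows "\<exists>k::int. \<mu> (coroot_element \<alpha>) = of_int k"
proof -
  have "\<mu> \<in> generate root_lattice roots" using assms(2) root_lattice_generated by blast
  then have "\<mu> \<in> carrier root_lattice \<and> (\<exists>k::int. \<mu> (coroot_element \<alpha>) = of_int k)"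
  proof (induction rule: generate.induct)
    case one
    then show ?case using tg.one_closed by (auto simp: root_lattice_one intro!: exI[of _ 0])
  next
    case (incl h)
    then show ?case using coroot_element(3)[OF \<alpha>] roots_lattice by blast
  next
    case (inv h)
    then have h: "h \<in> carrier root_lattice" using roots_lattice by blast
    obtain k :: int where k: "h (coroot_element \<alpha>) = of_int k" using coroot_element(3)[OF \<alpha> inv] by blast
    have "(\<lambda>z. (inv\<^bsub>root_lattice\<^esub> h) z + h z) = (\<lambda>z. 0)"
      using tg.l_inv[OF h] by (simp add: root_lattice_mult root_lattice_one)
    then have "(inv\<^bsub>root_lattice\<^esub> h) (coroot_element \<alpha>) + of_int k = 0" using k by (metis)
    then have "(inv\<^bsub>root_lattice\<^esub> h) (coroot_element \<alpha>) = of_int (- k)" by (simp add: eq_neg_iff_add_eq_0)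
    then show ?case using tg.inv_closed[OF h] by blast
  next
    case (eng h1 h2)
    then obtain k l :: int where "h1 (coroot_element \<alpha>) = of_int k" "h2 (coroot_element \<alpha>) = of_int l" by blast
    then have "(h1 \<otimes>\<^bsub>root_lattice\<^esub> h2) (coroot_element \<alpha>) = of_int (k + l)" by (simp add: root_lattice_mult)
    then show ?case using eng by blast
  qed
  then show ?thesis by blast
qed

lemma root_lattice_pow: "\<mu> [^]\<^bsub>root_lattice\<^esub> (n::nat) = (\<lambda>z. of_nat n * \<mu> z)"
proof (induction n)
  case 0
  then show ?case by (simp add: root_lattice_one)
next
  case (Suc n)
  then show ?case by (simp add: root_lattice_mult distrib_right add.commute)
qed

text \<open>Evaluation at the coroot element is an integer-valued homomorphism on the lattice; the
  universal property extends it to a real functional. The second clause keeps its values tied to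
  those in the field.\<close>

lemma coroot_exists:
  assumes \<alpha>: "\<alpha> \<in> roots"
  shows "\<exists>f. is_coroot root_space (tg.ot ` roots) (tg.ot \<alpha>) f \<and>
    (\<forall>\<mu>\<in>roots. \<forall>k::int. \<mu> (coroot_element \<alpha>) = of_int k \<longrightarrow> f (tg.ot \<mu>) = of_int k)"
proof -
  let ?h = "coroot_element \<alpha>"
  define n where "n \<mu> = (SOME k::int. \<mu> ?h = of_int k)" for \<mu> :: "'l \<Rightarrow> 'k"
  have n: "n \<mu> = k" if "\<mu> ?h = of_int k" for \<mu> k
  proof -
    have "\<mu> ?h = of_int (n \<mu>)" unfolding n_def using that by (rule someI)
    then have "of_int (n \<mu>) = (of_int k :: 'k)" using that by simp
    then show ?thesis by (simp only: of_int_eq_iff)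
  qed
  have nh: "\<mu> ?h = of_int (n \<mu>)" if "\<mu> \<in> carrier root_lattice" for \<mu>
    using lattice_integral[OF \<alpha> that] n by auto
  have "of_int (n (\<mu> \<otimes>\<^bsub>root_lattice\<^esub> \<nu>)) = (of_int (n \<mu>) + of_int (n \<nu>) :: real)"
    if "\<mu> \<in> carrier root_lattice" "\<nu> \<in> carrier root_lattice" for \<mu> \<nu>
  proof -
    have "(\<mu> \<otimes>\<^bsub>root_lattice\<^esub> \<nu>) ?h = of_int (n \<mu> + n \<nu>)" using nh that by (simp add: root_lattice_mult)
    from n[of "\<mu> \<otimes>\<^bsub>root_lattice\<^esub> \<nu>", OF this] show ?thesis by simp
  qed
  from tg.real_functional_exists[OF this] obtain f where
    f: "real_functional root_space f" "\<And>\<mu>. \<mu> \<in> carrier root_lattice \<Longrightarrow> f (tg.ot \<mu>) = of_int (n \<mu>)" by blast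
  have fk: "f (tg.ot \<mu>) = of_int k" if "\<mu> \<in> roots" "\<mu> ?h = of_int k" for \<mu> k
    using f(2) that roots_lattice n by auto
  interpret V: Module.module real_field root_space by (rule tg.module_V)
  \<comment> \<open>\<open>ot_pow\<close> handles natural multiples, so for negative
    \<open>k\<close> the identity is obtained with the two weights exchanged.\<close>
  have reflect: "tg.ot \<mu> \<ominus>\<^bsub>root_space\<^esub> of_int k \<odot>\<^bsub>root_space\<^esub> tg.ot \<alpha> = tg.ot (\<lambda>z. \<mu> z - of_int k * \<alpha> z)"
    if mu: "\<mu> \<in> roots" "(\<lambda>z. \<mu> z - of_int k * \<alpha> z) \<in> roots" for \<mu> and k :: int
  proof -
    let ?\<nu> = "\<lambda>z. \<mu> z - of_int k * \<alpha> z"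
    have c: "\<mu> \<in> carrier root_lattice" "?\<nu> \<in> carrier root_lattice" "\<alpha> \<in> carrier root_lattice"
      using mu \<alpha> roots_lattice by blast+
    note o = tg.ot_closed[OF c(1)] tg.ot_closed[OF c(2)] tg.ot_closed[OF c(3)]
    have sc: "c \<odot>\<^bsub>root_space\<^esub> tg.ot \<alpha> \<in> carrier root_space" for c
      using V.smult_closed[of c] o(3) by (simp add: tg.real_field_simps)
    have add: "c \<odot>\<^bsub>root_space\<^esub> tg.ot \<alpha> \<oplus>\<^bsub>root_space\<^esub> d \<odot>\<^bsub>root_space\<^esub> tg.ot \<alpha> = (c + d) \<odot>\<^bsub>root_space\<^esub> tg.ot \<alpha>" for c d
      using V.smult_l_distr[of c d, OF _ _ o(3)] by (simp add: tg.real_field_simps)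
    have zero: "0 \<odot>\<^bsub>root_space\<^esub> tg.ot \<alpha> = \<zero>\<^bsub>root_space\<^esub>"
      using V.smult_l_null[OF o(3)] by (simp add: ring_of_type_algebra_def)
    have "tg.ot \<mu> = tg.ot ?\<nu> \<oplus>\<^bsub>root_space\<^esub> of_int k \<odot>\<^bsub>root_space\<^esub> tg.ot \<alpha>"
    proof (cases "k \<ge> 0")
      case True
      then obtain m where m: "k = int m" using nonneg_int_cases by blast
      have "?\<nu> \<otimes>\<^bsub>root_lattice\<^esub> \<alpha> [^]\<^bsub>root_lattice\<^esub> m = \<mu>"
        by (simp add: root_lattice_mult root_lattice_pow m)
      then show ?thesis using tg.ot_pow[OF c(2,3), of m] by (simp add: m)
    next
      case False
      then obtain m where m: "k = - int m" by (metis int_cases4 of_nat_0_le_iff)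
      have "\<mu> \<otimes>\<^bsub>root_lattice\<^esub> \<alpha> [^]\<^bsub>root_lattice\<^esub> m = ?\<nu>"
        by (simp add: root_lattice_mult root_lattice_pow m)
      then have "tg.ot ?\<nu> = tg.ot \<mu> \<oplus>\<^bsub>root_space\<^esub> real m \<odot>\<^bsub>root_space\<^esub> tg.ot \<alpha>"
        using tg.ot_pow[OF c(1,3), of m] by simp
      then have "tg.ot ?\<nu> \<oplus>\<^bsub>root_space\<^esub> of_int k \<odot>\<^bsub>root_space\<^esub> tg.ot \<alpha> =
          tg.ot \<mu> \<oplus>\<^bsub>root_space\<^esub> (real m \<odot>\<^bsub>root_space\<^esub> tg.ot \<alpha> \<oplus>\<^bsub>root_space\<^esub> of_int k \<odot>\<^bsub>root_space\<^esub> tg.ot \<alpha>)"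
        using o sc by (simp add: V.M.a_assoc)
      also have "\<dots> = tg.ot \<mu>" using o by (simp add: add m zero)
      finally show ?thesis by simp
    qed
    then show ?thesis using o sc by (simp add: a_minus_def V.M.a_assoc V.M.r_neg)
  qed
  have "(\<lambda>v. v \<ominus>\<^bsub>root_space\<^esub> f v \<odot>\<^bsub>root_space\<^esub> tg.ot \<alpha>) ` (tg.ot ` roots) = tg.ot ` roots"
  proof
    show "(\<lambda>v. v \<ominus>\<^bsub>root_space\<^esub> f v \<odot>\<^bsub>root_space\<^esub> tg.ot \<alpha>) ` (tg.ot ` roots) \<subseteq> tg.ot ` roots"
    proof (intro subsetI, elim imageE)
      fix x v \<mu> assume "x = v \<ominus>\<^bsub>root_space\<^esub> f v \<odot>\<^bsub>root_space\<^esub> tg.ot \<alpha>" "v = tg.ot \<mu>" and \<mu>: "\<mu> \<in> roots"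
      moreover obtain k :: int where k: "\<mu> ?h = of_int k" "(\<lambda>z. \<mu> z - of_int k * \<alpha> z) \<in> roots"
        using coroot_element(3)[OF \<alpha> \<mu>] by blast
      ultimately have "x = tg.ot (\<lambda>z. \<mu> z - of_int k * \<alpha> z)" using reflect[OF \<mu> k(2)] fk[OF \<mu> k(1)] by simp
      then show "x \<in> tg.ot ` roots" using k(2) by blast
    qed
    show "tg.ot ` roots \<subseteq> (\<lambda>v. v \<ominus>\<^bsub>root_space\<^esub> f v \<odot>\<^bsub>root_space\<^esub> tg.ot \<alpha>) ` (tg.ot ` roots)"
    proof (intro subsetI, elim imageE)
      fix x \<mu> assume x: "x = tg.ot \<mu>" and \<mu>: "\<mu> \<in> roots"
      obtain k :: int where k: "\<mu> ?h = of_int k" "(\<lambda>z. \<mu> z - of_int k * \<alpha> z) \<in> roots"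
        using coroot_element(3)[OF \<alpha> \<mu>] by blast
      let ?\<nu> = "\<lambda>z. \<mu> z - of_int k * \<alpha> z"
      \<comment> \<open>The reflection is an involution: \<nu> pairs to k - 2k = -k, so reflecting
        it returns \<mu>.\<close>
      have \<nu>h: "?\<nu> ?h = of_int (- k)" using k(1) coroot_element(2)[OF \<alpha>] by simp
      have bk: "(\<lambda>z. ?\<nu> z - of_int (- k) * \<alpha> z) = \<mu>" by simp
      have "tg.ot ?\<nu> \<ominus>\<^bsub>root_space\<^esub> f (tg.ot ?\<nu>) \<odot>\<^bsub>root_space\<^esub> tg.ot \<alpha> = tg.ot \<mu>"
        using reflect[OF k(2), of "- k", unfolded bk, OF \<mu>] fk[OF k(2) \<nu>h] by simp
      then show "x \<in> (\<lambda>v. v \<ominus>\<^bsub>root_space\<^esub> f v \<odot>\<^bsub>root_space\<^esub> tg.ot \<alpha>) ` (tg.ot ` roots)"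
        unfolding x by (intro image_eqI[OF _ imageI[OF k(2)]]) (rule sym)
    qed
  qed
  moreover have "f (tg.ot \<alpha>) = 2" using fk[OF \<alpha>, of 2] coroot_element(2)[OF \<alpha>] by simp
  moreover have "f ` tg.ot ` roots \<subseteq> \<int>" using f(2) roots_lattice by auto
  ultimately have co: "is_coroot root_space (tg.ot ` roots) (tg.ot \<alpha>) f"
    using f(1) unfolding is_coroot_def by (intro conjI)
  show ?thesis
  proof (rule exI[of _ f], intro conjI ballI allI impI)
    show "is_coroot root_space (tg.ot ` roots) (tg.ot \<alpha>) f" by (rule co)
    fix \<mu> and k :: int assume "\<mu> \<in> roots" "\<mu> ?h = of_int k"
    then show "f (tg.ot \<mu>) = of_int k" by (rule fk)
  qed
qed

lemma root_system_roots: "root_system root_space (tg.ot ` roots)"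
proof -
  interpret V: Module.module real_field root_space by (rule tg.module_V)
  \<comment> \<open>A functional vanishes at 0, while the coroot of \<alpha> takes the value 2 at
    the image of \<alpha>.\<close>
  have zero: "\<zero>\<^bsub>root_space\<^esub> \<notin> tg.ot ` roots"
  proof
    assume "\<zero>\<^bsub>root_space\<^esub> \<in> tg.ot ` roots"
    then obtain \<alpha> where \<alpha>: "\<alpha> \<in> roots" "tg.ot \<alpha> = \<zero>\<^bsub>root_space\<^esub>" by (metis imageE)
    obtain f where "is_coroot root_space (tg.ot ` roots) (tg.ot \<alpha>) f"
      using coroot_exists[OF \<alpha>(1)] by (elim exE conjE)
    note f = conjunct1[OF this[unfolded is_coroot_def]] conjunct1[OF conjunct2[OF this[unfolded is_coroot_def]]]
    have "f (\<zero>\<^bsub>root_space\<^esub> \<oplus>\<^bsub>root_space\<^esub> \<zero>\<^bsub>root_space\<^esub>) = f \<zero>\<^bsub>root_space\<^esub> + f \<zero>\<^bsub>root_space\<^esub>"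
      using f(1) V.M.zero_closed unfolding real_functional_def by blast
    then show False using f(2) \<alpha>(2) by simp
  qed
  have span: "W = carrier root_space" if "submodule W real_field root_space" "tg.ot ` roots \<subseteq> W" for W
    by (rule tg.span_ot[OF that root_lattice_generated roots_lattice])
  have sub: "tg.ot ` roots \<subseteq> carrier root_space" using tg.ot_closed roots_lattice by blast
  have co: "\<exists>f. is_coroot root_space (tg.ot ` roots) a f" if "a \<in> tg.ot ` roots" for a
    using coroot_exists that by blast
  show ?thesis unfolding root_system_def
  proof (intro conjI allI impI ballI)
    show "Module.module real_field root_space" by (rule tg.module_V)
    show "finite (tg.ot ` roots)" using finite_roots by (rule finite_imageI)
    show "W = carrier root_space" if "submodule W real_field root_space \<and> tg.ot ` roots \<subseteq> W" for W
      using that by (elim conjE) (rule span)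
  qed (fact sub, fact zero, rule co)
qed

text \<open>An orthogonal partition of the image is pulled back to the roots themselves. Vanishing
  of the real coroots there becomes vanishing at the coroot elements, which contradicts
  simplicity.\<close>

lemma irreducible_roots:
  assumes simple "T \<noteq> {id}"
  shows "irreducible_root_system root_space (tg.ot ` roots)"
  unfolding irreducible_root_system_def
proof (intro conjI root_system_roots notI)
  show "tg.ot ` roots = {} \<Longrightarrow> False" using roots_nonempty[OF assms(2)] by simp
  assume "\<exists>\<Phi>1 \<Phi>2. \<Phi>1 \<noteq> {} \<and> \<Phi>2 \<noteq> {} \<and> \<Phi>1 \<inter> \<Phi>2 = {} \<and> tg.ot ` roots = \<Phi>1 \<union> \<Phi>2 \<and>
      (\<forall>\<alpha>\<in>\<Phi>1. \<forall>\<beta>\<in>\<Phi>2. orthogonal_roots root_space (tg.ot ` roots) \<alpha> \<beta>)"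
  then obtain \<Phi>1 \<Phi>2 where P: "\<Phi>1 \<noteq> {}" "\<Phi>2 \<noteq> {}" "tg.ot ` roots = \<Phi>1 \<union> \<Phi>2"
    and orth: "\<forall>\<alpha>\<in>\<Phi>1. \<forall>\<beta>\<in>\<Phi>2. orthogonal_roots root_space (tg.ot ` roots) \<alpha> \<beta>"
    by (elim exE conjE) (rule that)
  \<comment> \<open>The real coroot and evaluation at the coroot element share the same integer
    \<open>k\<close>, so the vanishing of one forces that of the other.\<close>
  have zero: "\<beta> (coroot_element \<alpha>) = 0"
    if ab: "\<alpha> \<in> roots" "\<beta> \<in> roots" and o: "\<And>f. is_coroot root_space (tg.ot ` roots) (tg.ot \<alpha>) f \<Longrightarrow> f (tg.ot \<beta>) = 0"
    for \<alpha> \<beta>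
  proof -
    obtain f where f: "is_coroot root_space (tg.ot ` roots) (tg.ot \<alpha>) f"
      "\<forall>\<mu>\<in>roots. \<forall>k::int. \<mu> (coroot_element \<alpha>) = of_int k \<longrightarrow> f (tg.ot \<mu>) = of_int k"
      using coroot_exists[OF ab(1)] by (elim exE conjE)
    obtain k :: int where k: "\<beta> (coroot_element \<alpha>) = of_int k" using coroot_element(3)[OF ab] by blast
    have "f (tg.ot \<beta>) = of_int k" using f(2)[rule_format, OF ab(2) k] .
    then show ?thesis using k o[OF f(1)] by simp
  qed
  show False
  proof (rule roots_not_orthogonal[OF assms(1), of "{\<alpha>\<in>roots. tg.ot \<alpha> \<in> \<Phi>1}" "{\<alpha>\<in>roots. tg.ot \<alpha> \<in> \<Phi>2}" coroot_element])
    have "tg.ot \<alpha> \<in> \<Phi>1 \<union> \<Phi>2" if "\<alpha> \<in> roots" for \<alpha>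
      unfolding P(3)[symmetric] using that by (rule imageI)
    then show "roots = {\<alpha>\<in>roots. tg.ot \<alpha> \<in> \<Phi>1} \<union> {\<alpha>\<in>roots. tg.ot \<alpha> \<in> \<Phi>2}" by auto
    have ne: "{\<alpha>\<in>roots. tg.ot \<alpha> \<in> S} \<noteq> {}" if S: "S \<noteq> {}" "S \<subseteq> tg.ot ` roots" for S
    proof -
      obtain s where s: "s \<in> S" using S(1) by blast
      then obtain \<alpha> where "s = tg.ot \<alpha>" "\<alpha> \<in> roots" using subsetD[OF S(2) s] by (elim imageE)
      then have "\<alpha> \<in> {\<alpha>\<in>roots. tg.ot \<alpha> \<in> S}" using s by simp
      then show ?thesis by (metis empty_iff)
    qed
    show "{\<alpha>\<in>roots. tg.ot \<alpha> \<in> \<Phi>1} \<noteq> {}" by (rule ne[OF P(1)]) (simp only: P(3) Un_upper1)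
    show "{\<alpha>\<in>roots. tg.ot \<alpha> \<in> \<Phi>2} \<noteq> {}" by (rule ne[OF P(2)]) (simp only: P(3) Un_upper2)
    show "coroot_element \<alpha> \<in> H" "\<alpha> (coroot_element \<alpha>) = 2" if "\<alpha> \<in> roots" for \<alpha>
      using coroot_element[OF that] by blast+
    show "(\<lambda>z. - \<alpha> z) \<in> roots" if \<alpha>: "\<alpha> \<in> roots" for \<alpha>
    proof -
      obtain k :: int where k: "\<alpha> (coroot_element \<alpha>) = of_int k" "(\<lambda>z. \<alpha> z - of_int k * \<alpha> z) \<in> roots"
        using coroot_element(3)[OF \<alpha> \<alpha>] by blast
      have "of_int k = (of_int 2 :: 'k)" using k(1) coroot_element(2)[OF \<alpha>] by simp
      then have "k = 2" by (simp only: of_int_eq_iff)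
      then show ?thesis using k(2) by simp
    qed
    fix \<alpha> \<beta> assume ab: "\<alpha> \<in> {\<alpha>\<in>roots. tg.ot \<alpha> \<in> \<Phi>1}" "\<beta> \<in> {\<alpha>\<in>roots. tg.ot \<alpha> \<in> \<Phi>2}"
    then have o: "orthogonal_roots root_space (tg.ot ` roots) (tg.ot \<alpha>) (tg.ot \<beta>)" using orth by blast
    show "\<beta> (coroot_element \<alpha>) = 0" "\<alpha> (coroot_element \<beta>) = 0"
      using o ab by (auto intro!: zero simp: orthogonal_roots_def)
  qed
qed

end

theorem theorem6p1:
  fixes scale :: "'k::{alg_closed_field, field_char_0} \<Rightarrow> 'l::ab_group_add \<Rightarrow> 'l"
    and bracket :: "'l \<Rightarrow> 'l \<Rightarrow> 'l"
    and Basis :: "'l set"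
    and G :: "('g, 'm) monoid_scheme"
    and \<Gamma> :: "'g \<Rightarrow> 'l set"
    and T :: "('l \<Rightarrow> 'l) set"
    and H :: "'l set"
    and \<Phi> :: "('l \<Rightarrow> 'k) set"
    and Z\<Phi> :: "('l \<Rightarrow> 'k) monoid"
  assumes "lie_algebra scale bracket"
    and "finite_dimensional_vector_space scale Basis"
    and "lie_algebra.semisimple scale bracket"
    and "comm_group G"
    and "lie_algebra.grading scale bracket G \<Gamma>"
    and "lie_algebra.toral_rank scale bracket G \<Gamma> \<ge> 1"
    and "maximal_torus scale (lie_algebra.Stab scale bracket G \<Gamma>) T"
    and "H = lie_algebra.lie_subalgebra_of scale bracket T"
    and "\<Phi> = lie_algebra.nonzero_weights scale bracket H"
    and "Z\<Phi> = subgroup_generated (dual_group scale H) \<Phi>"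
  shows "root_system (real_tensor Z\<Phi>) (one_tensor Z\<Phi> ` \<Phi>) \<and>
         (lie_algebra.simple scale bracket \<longrightarrow>
            irreducible_root_system (real_tensor Z\<Phi>) (one_tensor Z\<Phi> ` \<Phi>))"
proof -
  interpret graded_lie_algebra scale bracket Basis G \<Gamma> T H
    using assms(1-5,7,8)
    by (intro graded_lie_algebra.intro fin_dim_lie_algebra.intro alg_closed_endomorphisms.intro
        fin_dim_endomorphisms.intro endomorphisms.intro graded_lie_algebra_axioms.intro)
       (simp_all add: lie_algebra_def)
  have Z: "Z\<Phi> = root_lattice" and \<Phi>: "\<Phi> = roots"
    using assms(9,10) by (simp_all add: root_lattice_def)
  have "T \<noteq> {id}" using toral_rank_zero assms(6) by auto
  then show ?thesis using root_system_roots irreducible_roots unfolding Z \<Phi> by blast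
qed

end
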